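(* Let $p,q$ be integers with $p\ge3$ and $q>\frac{2p}{p-2}$. Then $$r^h(p,q)=2\,r_{opt}(p,q),\qquad R^h(p,q)=2\,R_{opt}(p,q),$$ and consequently $$\mathrm{Area}(C(r^h(p,q)))=4\pi\sinh^2\Bigl(\frac{r^h(p,q)}{2}\Bigr)=4\,\mathrm{Area}(\mathcal{C}(r_{opt}(p,q)))=4\pi\sinh^2(r_{opt}(p,q)),$$ $$\mathrm{Area}(C(R^h(p,q)))=4\pi\sinh^2\Bigl(\frac{R^h(p,q)}{2}\Bigr)=4\,\mathrm{Area}(\mathcal{C}(R_{opt}(p,q)))=4\pi\sinh^2(R_{opt}(p,q)),$$ $$\mathrm{Area}(M_p^q)=4\,\mathrm{Area}(\mathcal{P}(p,q)).$$
   Context: Hyperbolic side: $M_p^q$ is a tile of the regular tessellation of the hyperbolic plane $\mathbf{H}^2$ (curvature $-1$) with Schl\"afli symbol $\{p,q\}$, $\frac1p+\frac1q<\frac12$. $C(r^h(p,q))$ and $C(R^h(p,q))$ are its inscribed and circumscribed circles (discs), with radii $r^h(p,q)=\mathrm{arccosh}\Bigl(\frac{\cos(\pi/q)}{\sin(\pi/p)}\Bigr)$, $R^h(p,q)=\mathrm{arccosh}\bigl(\cot\frac\pi p\cot\frac\pi q\bigr)$, and $\mathrm{Area}(M_p^q)=2p\bigl(\frac\pi2-\frac\pi p-\frac\pi q\bigr)$. Areas of $C(\cdot)$ and $M_p^q$ are hyperbolic areas. $\widetilde{\mathbf{SL}_2\mathbf{R}}$ side: the metric in hyperboloid coordinates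 $(r,\theta,\phi)$ is $(\mathrm{d}s)^2=(\mathrm{d}r)^2+\cosh^2r\sinh^2r(\mathrm{d}\theta)^2+[\mathrm{d}\phi+\sinh^2r\,\mathrm{d}\theta]^2$, with volume element $\frac12\sinh(2r)\,\mathrm{d}r\,\mathrm{d}\theta\,\mathrm{d}\phi$. The base plane is $\phi=0$; in the projective model it is the open unit disc with Euclidean coordinates $y=\tanh r\cos\theta$, $z=\tanh r\sin\theta$. The circle of radius $r$ about the origin is thus the Euclidean circle of radius $\tanh r$. The area of a region $D$ of the base plane is the volume of the solid of fibre height $1$ over it, i.e. $\mathrm{Area}(D)=\int_D\frac12\sinh(2r)\,\mathrm{d}r\,\mathrm{d}\theta$; $\mathcal{C}(r)$ denotes the disc of radius $r$ about the origin. $\mathcal{P}(p,q)$ is the base figure of the infinite regular $p$-sided prism, centred at the origin, of the regular infinite prism tiling $\mathcal{T}^i_p(q)$ with $q$ prisms meeting at each side edge. Explicitly: its vertices $A_1,\dots,A_p$ form a regular Euclidean $p$-gon centred at the origin with circumradius $b=\sqrt{\frac{1-\tan\frac\pi p\tan\frac\pi q}{1+\tan\frac\pi p\tan\frac\pi q}}$, and it is the region containing the origin bounded by the side curves $c_{A_iA_{i+1}}$ (indices mod $p$), each the minor circular arc from $A_i$ to $A_{i+1}$, curved towards the origin, of a Euclidean circle of radius $1/C_p(q)$, where $$C_p(q)=\sqrt{\frac{\cos\left(\frac{\pi}{p}+\frac{\pi}{q}\right)\left(\sin\frac{2\pi}{p}+\sin\frac{2\pi}{q}\right)}{\sin\left(\frac{\pi}{p}+\frac{\pi}{q}\right)\left(1-\cos\frac{2\pi}{p}\right)}}.$$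 $r_{opt}(p,q)$ is the radius (in the $\widetilde{\mathbf{SL}_2\mathbf{R}}$ sense) of the inscribed circle of $\mathcal{P}(p,q)$, i.e. the circle about the origin touching all side curves; $R_{opt}(p,q)=\mathrm{arctanh}(b)$ is the radius of its circumscribed circle, i.e. the circle about the origin through the vertices. *)

theory Defs
  imports "HOL-Complex_Analysis.Riemann_Mapping"
begin

text \<open>A circle of radius \<open>r\<close> about \<open>c\<close>, with respect to the distance \<open>d\<close>, touches the curve \<open>S\<close>:
  it meets \<open>S\<close>, and no point of \<open>S\<close> lies inside it.\<close>

definition touches :: "('a \<Rightarrow> 'a \<Rightarrow> real) \<Rightarrow> 'a \<Rightarrow> real \<Rightarrow> 'a set \<Rightarrow> bool" where
  "touches d c r S \<longleftrightarrow> (\<exists>z\<in>S. d c z = r) \<and> (\<forall>z\<in>S. r \<le> d c z)"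


section \<open>The hyperbolic plane\<close>

text \<open>The Poincare disc model of the hyperbolic plane of curvature $-1$: its line element is
  $2|dz|/(1-|z|^2)$, which gives the distance and the area element below.\<close>

definition hplane :: "complex set" where
  "hplane = ball 0 1"

definition hdist :: "complex \<Rightarrow> complex \<Rightarrow> real" where
  "hdist z w = arcosh (1 + 2 * (norm (z - w))\<^sup>2 / ((1 - (norm z)\<^sup>2) * (1 - (norm w)\<^sup>2)))"

definition harea :: "complex set \<Rightarrow> real" where
  "harea S = (LINT z:S|lborel. 4 / (1 - (norm z)\<^sup>2)\<^sup>2)"

definition hdisc :: "complex \<Rightarrow> real \<Rightarrow> complex set" where
  "hdisc c r = {z \<in> hplane. hdist c z \<le> r}"

definition hsegment :: "complex \<Rightarrow> complex \<Rightarrow> complex set" where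
  "hsegment a b = {z \<in> hplane. hdist a z + hdist z b = hdist a b}"

definition hconvex :: "complex set \<Rightarrow> bool" where
  "hconvex S \<longleftrightarrow> S \<subseteq> hplane \<and> (\<forall>a\<in>S. \<forall>b\<in>S. hsegment a b \<subseteq> S)"

text \<open>Rotation of the hyperbolic plane about \<open>c\<close> by the angle \<open>t\<close>:
  \<open>Moebius_function 0 c\<close> is the isometry \<open>z \<mapsto> (z - c) / (1 - cnj c * z)\<close> taking \<open>c\<close> to the
  origin, and \<open>Moebius_function 0 (- c)\<close> is its inverse.\<close>

definition hrot :: "complex \<Rightarrow> real \<Rightarrow> complex \<Rightarrow> complex" where
  "hrot c t z = Moebius_function 0 (- c) (cis t * Moebius_function 0 c z)"

text \<open>The vertices, in cyclic order, of the regular hyperbolic \<open>p\<close>-gon with centre \<open>c\<close> and a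
  vertex \<open>v\<close>. The polygon itself is the hyperbolic convex hull of the set of its vertices.\<close>

definition hvertex :: "nat \<Rightarrow> complex \<Rightarrow> complex \<Rightarrow> nat \<Rightarrow> complex" where
  "hvertex p c v k = hrot c (2 * pi * real k / real p) v"

definition hvertices :: "nat \<Rightarrow> complex \<Rightarrow> complex \<Rightarrow> complex set" where
  "hvertices p c v = hvertex p c v ` {..<p}"

text \<open>A regular tessellation with Schlaefli symbol \<open>{p,q}\<close>, given by the set \<open>T\<close> of the vertex
  sets of its tiles (each tile is the hyperbolic convex hull of its vertex set). The tiles are
  congruent regular \<open>p\<close>-gons; they cover the plane without overlap and in a locally finite way;
  the tiling is edge-to-edge, i.e. a vertex of one tile is a vertex of every tile that contains
  it; and \<open>q\<close> tiles meet at each vertex.\<close>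

definition regular_tessellation :: "nat \<Rightarrow> nat \<Rightarrow> complex set set \<Rightarrow> bool" where
  "regular_tessellation p q T \<longleftrightarrow>
     (\<exists>R>0. \<forall>V\<in>T. \<exists>c\<in>hplane. \<exists>v\<in>hplane. hdist c v = R \<and> V = hvertices p c v) \<and>
     (\<Union>V\<in>T. hconvex hull V) = hplane \<and>
     (\<forall>V\<in>T. \<forall>W\<in>T. V \<noteq> W \<longrightarrow> interior (hconvex hull V) \<inter> interior (hconvex hull W) = {}) \<and>
     (\<forall>K. compact K \<and> K \<subseteq> hplane \<longrightarrow> finite {V\<in>T. (hconvex hull V) \<inter> K \<noteq> {}}) \<and>
     (\<forall>V\<in>T. \<forall>x\<in>V. (\<forall>W\<in>T. x \<in> hconvex hull W \<longrightarrow> x \<in> W) \<and> card {W\<in>T. x \<in> W} = q)"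

definition r_h :: "nat \<Rightarrow> nat \<Rightarrow> real" where
  "r_h p q = arcosh (cos (pi / real q) / sin (pi / real p))"

definition R_h :: "nat \<Rightarrow> nat \<Rightarrow> real" where
  "R_h p q = arcosh (cot (pi / real p) * cot (pi / real q))"


section \<open>The base plane of the universal cover of SL(2,R)\<close>

text \<open>The point of the base plane $\phi = 0$ with hyperboloid coordinates $(r,\theta)$, in the
  projective model; the Euclidean coordinates $(y,z)$ are the real and imaginary part.\<close>

definition base_point :: "real \<Rightarrow> real \<Rightarrow> complex" where
  "base_point r \<theta> = Complex (tanh r * cos \<theta>) (tanh r * sin \<theta>)"

definition sl2_area :: "complex set \<Rightarrow> real" where
  "sl2_area D =
     (LINT x:{(r, \<theta>). 0 \<le> r \<and> 0 \<le> \<theta> \<and> \<theta> < 2 * pi \<and> base_point r \<theta> \<in> D}|lborel.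
        sinh (2 * fst x) / 2)"

definition sl2_disc :: "real \<Rightarrow> complex set" where
  "sl2_disc r = {base_point s \<theta> | s \<theta>. 0 \<le> s \<and> s \<le> r}"

definition prism_b :: "nat \<Rightarrow> nat \<Rightarrow> real" where
  "prism_b p q = sqrt ((1 - tan (pi / real p) * tan (pi / real q)) /
                       (1 + tan (pi / real p) * tan (pi / real q)))"

definition prism_C :: "nat \<Rightarrow> nat \<Rightarrow> real" where
  "prism_C p q =
     sqrt ((cos (pi / real p + pi / real q) * (sin (2 * pi / real p) + sin (2 * pi / real q))) /
           (sin (pi / real p + pi / real q) * (1 - cos (2 * pi / real p))))"

definition prism_vertex :: "nat \<Rightarrow> nat \<Rightarrow> nat \<Rightarrow> complex" where
  "prism_vertex p q k = of_real (prism_b p q) * cis (2 * pi * real k / real p)"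

text \<open>The chord from vertex \<open>k\<close> to vertex \<open>k + 1\<close> is orthogonal to the unit vector \<open>e\<close>, has
  distance \<open>h\<close> from the origin and half-length \<open>prism_b p q * sin (pi / p)\<close>. The arc is curved
  towards the origin, so the centre \<open>m\<close> of the circle lies beyond the chord, and the minor arc is
  the part of the circle on the origin's side of the chord.\<close>

definition side_curve :: "nat \<Rightarrow> nat \<Rightarrow> nat \<Rightarrow> complex set" where
  "side_curve p q k =
     (let \<rho> = 1 / prism_C p q;
          e = cis (pi * (2 * real k + 1) / real p);
          h = prism_b p q * cos (pi / real p);
          m = of_real (h + sqrt (\<rho>\<^sup>2 - (prism_b p q * sin (pi / real p))\<^sup>2)) * e
      in {z. dist m z = \<rho> \<and> z \<bullet> e \<le> h})"

text \<open>The region containing the origin bounded by the side curves, boundary included.\<close>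

definition prism_base :: "nat \<Rightarrow> nat \<Rightarrow> complex set" where
  "prism_base p q =
     (let S = (\<Union>k<p. side_curve p q k) in connected_component_set (- S) 0 \<union> S)"

text \<open>The circle of radius \<open>r\<close> about the origin is the Euclidean circle of radius \<open>tanh r\<close>.\<close>

definition r_opt :: "nat \<Rightarrow> nat \<Rightarrow> real" where
  "r_opt p q = (THE r. \<forall>k<p. touches dist 0 (tanh r) (side_curve p q k))"

definition R_opt :: "nat \<Rightarrow> nat \<Rightarrow> real" where
  "R_opt p q = artanh (prism_b p q)"

end

theory Submission
  imports Defs
begin

text \<open>
  In the Euclidean coordinates of modulus \<open>tanh r\<close> the base plane of $\widetilde{SL_2 R}$ is the Poincare disc, where a point at
  hyperbolic distance \<open>d\<close> from the origin has modulus \<open>tanh (d / 2)\<close>: radii are halved and areas are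
  divided by four. The side arcs of the prism base lie on circles whose centre \<open>m\<close> and radius \<open>\<rho>\<close>
  satisfy $|m|^2 = 1 + \rho^2$, so they are geodesics and the prism base is literally the regular
  hyperbolic \<open>p\<close>-gon of circumradius \<open>2 artanh b\<close>. No area has to be computed: it suffices that the
  area is invariant under isometries and that a tile of a \<open>{p,q}\<close> tessellation has this
  circumradius. The latter holds because the \<open>q\<close> congruent tiles at a vertex cut a small disc about
  it into \<open>q\<close> sectors of equal area, which forces the angle \<open>2 pi / q\<close>.
\<close>

section \<open>Change of variables in the plane\<close>

text \<open>The definition of a tessellation speaks of vertex sets, hulls, interiors and a count,
  never of angles. Area near a vertex replaces the angle: once the vertex is moved to the origin its
  two sides are straight, so near the vertex the tile is an exact sector, and
  \<open>q * arctan slope = pi\<close> follows from one small disc. Solving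
  \<open>slope = tan (pi / q)\<close> for the Poincare circumradius gives the expression under the
  root in \<open>prism_b\<close>. Two models are needed: distance and area are handled in the
  Poincare disc, hulls in the Klein model, where they are Euclidean. A vertex set might a priori be
  written as \<open>hvertices p c v\<close> with another centre than the one granted by the
  definition of a tessellation; this is excluded before \<open>hdist c v\<close> can be called the
  circumradius. With \<alpha> = pi / p and \<beta> = pi / q, the constants \<open>b\<close>,
  \<open>\<mu>\<close>, \<open>\<rho>\<close> are cos (\<alpha> + \<beta>), cos \<beta>, sin
  \<alpha> over the common denominator sqrt (cos (\<alpha> + \<beta>) cos (\<alpha> - \<beta>));
  this is what \<open>prism_C\<close> encodes.\<close>

lemma lborel_distr_basis_bij:
  fixes i :: "'a::euclidean_space \<Rightarrow> 'b::euclidean_space"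
  assumes lin: "linear i" and bij: "bij_betw i Basis Basis"
  shows "distr lborel borel i = lborel"
proof (rule lborel_eqI[symmetric])
  have [measurable]: "i \<in> borel_measurable borel"
    using lin by (simp add: borel_measurable_continuous_onI linear_continuous_on linear_conv_bounded_linear)
  have iB: "i b \<in> Basis" if "b \<in> Basis" for b using bij that by (auto simp: bij_betw_def)
  have inner: "i x \<bullet> i b = x \<bullet> b" if b: "b \<in> Basis" for x b
  proof -
    have "i x = (\<Sum>c\<in>Basis. (x \<bullet> c) *\<^sub>R i c)"
      by (subst euclidean_representation[of x, symmetric]) (simp add: linear_sum[OF lin] linear_scale[OF lin])
    then have "i x \<bullet> i b = (\<Sum>c\<in>Basis. (x \<bullet> c) * (i c \<bullet> i b))" by (simp add: inner_sum_left)
    also have "\<dots> = (\<Sum>c\<in>Basis. if c = b then x \<bullet> c else 0)"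
      by (rule sum.cong) (use bij b in \<open>auto simp: inner_Basis iB bij_betw_def inj_on_def\<close>)
    finally show ?thesis using b by simp
  qed
  fix l u :: 'b assume le: "\<And>b. b \<in> Basis \<Longrightarrow> l \<bullet> b \<le> u \<bullet> b"
  define L where "L = (\<Sum>b\<in>Basis. (l \<bullet> i b) *\<^sub>R b)"
  define U where "U = (\<Sum>b\<in>Basis. (u \<bullet> i b) *\<^sub>R b)"
  have LU: "L \<bullet> b = l \<bullet> i b" "U \<bullet> b = u \<bullet> i b" if "b \<in> Basis" for b
    using that by (auto simp: L_def U_def inner_sum_left inner_Basis if_distrib cong: if_cong)
  have all: "(\<forall>b\<in>Basis. P b) \<longleftrightarrow> (\<forall>b\<in>Basis. P (i b))" for P
    using bij unfolding bij_betw_def by (metis imageI image_iff)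
  \<comment> \<open>Boxes pull back to boxes with the same side lengths up to order, and Lebesgue
    measure is determined by its values on boxes.\<close>
  have "i -` box l u = box L U"
    unfolding box_def by (subst all) (auto simp: LU inner)
  then have "emeasure (distr lborel borel i) (box l u) = emeasure lborel (box L U)"
    by (simp add: emeasure_distr)
  also have "\<dots> = (\<Prod>b\<in>Basis. (U - L) \<bullet> b)"
    by (rule emeasure_lborel_box) (use le iB in \<open>auto simp: LU\<close>)
  also have "(\<Prod>b\<in>Basis. (U - L) \<bullet> b) = (\<Prod>b\<in>Basis. (u - l) \<bullet> i b)"
    by (rule prod.cong) (auto simp: LU inner_diff_left)
  also have "\<dots> = (\<Prod>b\<in>Basis. (u - l) \<bullet> b)"
    using prod.reindex_bij_betw[OF bij] by metis
  finally show "emeasure (distr lborel borel i) (box l u) = (\<Prod>b\<in>Basis. (u - l) \<bullet> b)" .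
qed simp

text \<open>No integrability is assumed: the two integrands are absolutely integrable together or
  not at all, and in the second case both integrals have the default value 0.\<close>

lemma LINT_change_of_variables:
  fixes g :: "real^'n::{finite,wellorder} \<Rightarrow> real^'n::_" and f :: "real^'n::_ \<Rightarrow> real"
  assumes S: "S \<in> sets borel" and gS: "g ` S \<in> sets borel"
    and f: "set_borel_measurable borel (g ` S) f"
    and fg: "set_borel_measurable borel S (\<lambda>x. \<bar>det (matrix (g' x))\<bar> * f (g x))"
    and der: "\<And>x. x \<in> S \<Longrightarrow> (g has_derivative g' x) (at x within S)"
    and inj: "inj_on g S"
  shows "(LINT z:g ` S|lborel. f z) = (LINT x:S|lborel. \<bar>det (matrix (g' x))\<bar> * f (g x))"
proof -
  let ?h = "\<lambda>x. \<bar>det (matrix (g' x))\<bar> * f (g x)"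
  \<comment> \<open>The theorem applied here concerns vector-valued integrands, so the scalar
    \<open>f\<close> is read as a vector in \<open>real^1\<close>.\<close>
  have eq: "?h absolutely_integrable_on S \<and> integral S ?h = b \<longleftrightarrow>
      f absolutely_integrable_on (g ` S) \<and> integral (g ` S) f = b" for b
    using has_absolute_integral_change_of_variables[of S g g' "\<lambda>x. (\<chi> k. f x)::real^1" "\<chi> k. b", OF _ der inj] S
    unfolding absolutely_integrable_on_1_iff integral_on_1_eq
    by (simp add: absolutely_integrable_on_1_iff integral_on_1_eq vec_eq_iff)
  have leb: "(LINT x:T|lborel. k x) = (LINT x:T|lebesgue. k x)"
    if "set_borel_measurable borel T k" for T and k :: "real^'n::{finite,wellorder} \<Rightarrow> real"
    using that unfolding set_lebesgue_integral_def set_borel_measurable_def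
    by (subst integral_completion) auto
  show ?thesis
  proof (cases "f absolutely_integrable_on (g ` S)")
    case True
    then have "?h absolutely_integrable_on S" "integral S ?h = integral (g ` S) f" using eq by blast+
    with True show ?thesis unfolding leb[OF f] leb[OF fg]
      by (simp only: set_lebesgue_integral_eq_integral(2))
  next
    case False
    with eq have "\<not> ?h absolutely_integrable_on S" by blast
    with False show ?thesis unfolding leb[OF f] leb[OF fg]
      unfolding set_integrable_def set_lebesgue_integral_def
      by (simp add: not_integrable_integral_eq)
  qed
qed

text \<open>The maps \<open>i\<close> and \<open>j\<close> only rename coordinates and preserve
  Lebesgue measure; the Jacobian is that of \<open>g'\<close> written in these coordinates.\<close>

lemma LINT_change_of_variables_2:
  fixes i :: "real^2 \<Rightarrow> 'a::euclidean_space" and j :: "real^2 \<Rightarrow> 'b::euclidean_space"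
    and g :: "'a \<Rightarrow> 'b" and f :: "'b \<Rightarrow> real"
  assumes i: "linear i" "bij_betw i Basis Basis" "linear i'" "\<And>x. i' (i x) = x" "\<And>x. i (i' x) = x"
    and j: "linear j" "bij_betw j Basis Basis" "linear j'" "\<And>x. j' (j x) = x" "\<And>x. j (j' x) = x"
    and S: "S \<in> sets borel" and gS: "g ` S \<in> sets borel"
    and f: "set_borel_measurable borel (g ` S) f"
    and fg: "set_borel_measurable borel S (\<lambda>x. d x * f (g x))"
    and der: "\<And>x. x \<in> S \<Longrightarrow> (g has_derivative g' x) (at x within S)"
    and d: "\<And>x. x \<in> S \<Longrightarrow> d x = \<bar>det (matrix (\<lambda>y. j' (g' x (i y))))\<bar>"
    and inj: "inj_on g S"
  shows "(LINT z:g ` S|lborel. f z) = (LINT x:S|lborel. d x * f (g x))"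
proof -
  have bl: "bounded_linear i" "bounded_linear i'" "bounded_linear j" "bounded_linear j'"
    using i j by (auto simp: linear_conv_bounded_linear)
  then have [measurable]: "i \<in> borel_measurable borel" "i' \<in> borel_measurable borel"
     "j \<in> borel_measurable borel" "j' \<in> borel_measurable borel"
    by (auto intro!: borel_measurable_continuous_onI linear_continuous_on)
  let ?S = "i -` S" and ?g = "\<lambda>x. j' (g (i x))" and ?f = "\<lambda>x. f (j x)"
  have img: "?g ` ?S = j -` (g ` S)" (is "?L = ?R")
  proof
    show "?L \<subseteq> ?R" by (auto simp: j)
    show "?R \<subseteq> ?L"
    proof
      fix y assume "y \<in> ?R"
      then obtain x where x: "x \<in> S" "j y = g x" by auto
      then have "y = ?g (i' x)" using j(4)[of y] by (simp add: i)
      moreover have "i' x \<in> ?S" using x by (simp add: i)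
      ultimately show "y \<in> ?L" by blast
    qed
  qed
  have borel[measurable]: "?S \<in> sets borel" "j -` (g ` S) \<in> sets borel"
    by (rule measurable_sets_borel[OF _ S], simp) (rule measurable_sets_borel[OF _ gS], simp)
  have tr: "(LINT x:T|lborel. k x) = (LINT y:l -` T|lborel. k (l y))"
    if l: "linear l" "bij_betw l Basis Basis" and [measurable]: "set_borel_measurable borel T k"
    for l :: "real^2 \<Rightarrow> 'c::euclidean_space" and T and k :: "'c \<Rightarrow> real"
  proof -
    have [measurable]: "l \<in> borel_measurable borel"
      using l by (simp add: borel_measurable_continuous_onI linear_continuous_on linear_conv_bounded_linear)
    have "(LINT x:T|lborel. k x) = (LINT x|distr lborel borel l. indicator T x *\<^sub>R k x)"
      unfolding set_lebesgue_integral_def lborel_distr_basis_bij[OF l] ..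
    also have "\<dots> = (LINT y|lborel. indicator T (l y) *\<^sub>R k (l y))"
      by (rule integral_distr) (use that(3) in \<open>auto simp: set_borel_measurable_def\<close>)
    also have "\<dots> = (LINT y:l -` T|lborel. k (l y))"
      unfolding set_lebesgue_integral_def by (simp add: indicator_vimage)
    finally show ?thesis .
  qed
  have sbm: "set_borel_measurable borel (l -` T) (\<lambda>y. k (l y))"
    if [measurable]: "set_borel_measurable borel T k" "l \<in> borel_measurable borel"
    for l :: "real^2 \<Rightarrow> 'c::euclidean_space" and T and k :: "'c \<Rightarrow> real"
    using measurable_compose[OF that(2) that(1)[unfolded set_borel_measurable_def]]
    unfolding set_borel_measurable_def by (simp add: indicator_vimage)
  have "(\<lambda>x. indicator ?S x *\<^sub>R (\<bar>det (matrix (\<lambda>y. j' (g' (i x) (i y))))\<bar> * ?f (?g x)))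
      = (\<lambda>x. indicator ?S x *\<^sub>R (d (i x) * f (g (i x))) :: real)"
    by (rule ext) (simp add: indicator_def d j(5))
  then have dd: "set_borel_measurable borel ?S (\<lambda>x. \<bar>det (matrix (\<lambda>y. j' (g' (i x) (i y))))\<bar> * ?f (?g x))"
    using sbm[OF fg, of i] unfolding set_borel_measurable_def by simp
  have "(LINT z:g ` S|lborel. f z) = (LINT y:?g ` ?S|lborel. ?f y)"
    unfolding img by (rule tr[OF j(1,2) f])
  also have "\<dots> = (LINT x:?S|lborel. \<bar>det (matrix (\<lambda>y. j' (g' (i x) (i y))))\<bar> * ?f (?g x))"
  proof (rule LINT_change_of_variables)
    show "?S \<in> sets borel" by (fact borel)
    show "?g ` ?S \<in> sets borel" unfolding img by (fact borel)
    show "set_borel_measurable borel ?S (\<lambda>x. \<bar>det (matrix (\<lambda>y. j' (g' (i x) (i y))))\<bar> * ?f (?g x))" by (fact dd)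
    show "set_borel_measurable borel (?g ` ?S) ?f" unfolding img by (rule sbm[OF f]) simp
    show "inj_on ?g ?S"
      using inj unfolding inj_on_def by (metis i(4) j(5) vimageE)
    fix x assume x: "x \<in> ?S"
    have di: "(i has_derivative i) (at x within ?S)" using bl by (simp add: bounded_linear_imp_has_derivative)
    have "((\<lambda>y. g (i y)) has_derivative (\<lambda>y. g' (i x) (i y))) (at x within ?S)"
      by (rule has_derivative_in_compose2[OF der _ x di]) auto
    then show "(?g has_derivative (\<lambda>y. j' (g' (i x) (i y)))) (at x within ?S)"
      by (rule bounded_linear.has_derivative[OF bl(4)])
  qed
  also have "\<dots> = (LINT x:?S|lborel. d (i x) * f (g (i x)))"
    by (rule set_lebesgue_integral_cong) (use borel in \<open>simp_all add: d j(5)\<close>)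
  also have "\<dots> = (LINT x:S|lborel. d x * f (g x))"
    by (rule tr[OF i(1,2) fg, symmetric])
  finally show ?thesis .
qed

definition complex_of_vec :: "real^2 \<Rightarrow> complex" where "complex_of_vec x = Complex (x$1) (x$2)"
definition vec_of_complex :: "complex \<Rightarrow> real^2" where "vec_of_complex z = vector [Re z, Im z]"
definition pair_of_vec :: "real^2 \<Rightarrow> real \<times> real" where "pair_of_vec x = (x$1, x$2)"
definition vec_of_pair :: "real \<times> real \<Rightarrow> real^2" where "vec_of_pair x = vector [fst x, snd x]"

lemma Basis_real_2: "(Basis :: (real^2) set) = {axis 1 1, axis 2 1}"
  by (auto simp: Basis_vec_def UNIV_2)

lemma complex_of_vec:
  "linear complex_of_vec" "bij_betw complex_of_vec Basis Basis" "linear vec_of_complex"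
  "vec_of_complex (complex_of_vec x) = x" "complex_of_vec (vec_of_complex z) = z"
proof -
  show "bij_betw complex_of_vec Basis Basis"
    by (auto simp: bij_betw_def Basis_real_2 Basis_complex_def inj_on_def complex_of_vec_def axis_def complex_eq_iff)
qed (auto simp: complex_of_vec_def vec_of_complex_def vec_eq_iff forall_2 complex_eq_iff
    intro!: linearI)

lemma pair_of_vec:
  "linear pair_of_vec" "bij_betw pair_of_vec Basis Basis" "linear vec_of_pair"
  "vec_of_pair (pair_of_vec x) = x" "pair_of_vec (vec_of_pair y) = y"
proof -
  show "bij_betw pair_of_vec Basis Basis"
    by (auto simp: bij_betw_def Basis_real_2 Basis_prod_def inj_on_def pair_of_vec_def axis_def)
qed (auto simp: pair_of_vec_def vec_of_pair_def vec_eq_iff forall_2 intro!: linearI)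

text \<open>A complex derivative acts on the plane as multiplication by \<open>g' z\<close>, a
  rotation combined with a scaling, whose real determinant is the squared modulus.\<close>

lemma LINT_conformal_image:
  fixes g :: "complex \<Rightarrow> complex" and f :: "complex \<Rightarrow> real"
  assumes S: "S \<in> sets borel" and gS: "g ` S \<in> sets borel"
    and f: "set_borel_measurable borel (g ` S) f"
    and fg: "set_borel_measurable borel S (\<lambda>z. (cmod (g' z))\<^sup>2 * f (g z))"
    and der: "\<And>z. z \<in> S \<Longrightarrow> (g has_field_derivative g' z) (at z within S)"
    and inj: "inj_on g S"
  shows "(LINT z:g ` S|lborel. f z) = (LINT z:S|lborel. (cmod (g' z))\<^sup>2 * f (g z))"
proof (rule LINT_change_of_variables_2[OF complex_of_vec complex_of_vec S gS f fg _ _ inj])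
  show "(g has_derivative (\<lambda>h. g' z * h)) (at z within S)" if "z \<in> S" for z
    using der[OF that] by (simp add: has_field_derivative_def)
  show "(cmod (g' z))\<^sup>2 = \<bar>det (matrix (\<lambda>y. vec_of_complex (g' z * complex_of_vec y)))\<bar>" for z
    by (simp add: det_2 matrix_def vec_of_complex_def complex_of_vec_def axis_def cmod_power2)
      (simp add: power2_eq_square)
qed

text \<open>\<open>g1\<close> and \<open>g2\<close> are the columns of the Jacobian matrix, and
  \<open>Im (cnj g1 * g2)\<close> is the determinant of two plane vectors.\<close>

lemma LINT_parametrized_image:
  fixes g :: "real \<times> real \<Rightarrow> complex" and f :: "complex \<Rightarrow> real"
  assumes S: "S \<in> sets borel" and gS: "g ` S \<in> sets borel"
    and f: "set_borel_measurable borel (g ` S) f"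
    and fg: "set_borel_measurable borel S (\<lambda>x. \<bar>Im (cnj (g1 x) * g2 x)\<bar> * f (g x))"
    and der: "\<And>x. x \<in> S \<Longrightarrow> (g has_derivative (\<lambda>(u,v). u *\<^sub>R g1 x + v *\<^sub>R g2 x)) (at x within S)"
    and inj: "inj_on g S"
  shows "(LINT z:g ` S|lborel. f z) = (LINT x:S|lborel. \<bar>Im (cnj (g1 x) * g2 x)\<bar> * f (g x))"
proof (rule LINT_change_of_variables_2[OF pair_of_vec complex_of_vec S gS f fg _ _ inj])
  show "(g has_derivative (\<lambda>(u,v). u *\<^sub>R g1 x + v *\<^sub>R g2 x)) (at x within S)" if "x \<in> S" for x
    by (rule der[OF that])
  show "\<bar>Im (cnj (g1 x) * g2 x)\<bar> = \<bar>det (matrix (\<lambda>y. vec_of_complex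
         (case pair_of_vec y of (u, v) \<Rightarrow> u *\<^sub>R g1 x + v *\<^sub>R g2 x)))\<bar>" for x
    by (simp add: det_2 matrix_def vec_of_complex_def pair_of_vec_def axis_def mult.commute)
qed

section \<open>Polar coordinates and the comparison of the two area integrals\<close>

lemma base_point_cis: "base_point r \<theta> = of_real (tanh r) * cis \<theta>"
  by (simp add: base_point_def complex_eq_iff)

lemma base_point_has_derivative:
  "((\<lambda>x. base_point (fst x) (snd x)) has_derivative
     (\<lambda>(u,v). u *\<^sub>R (of_real (1 - (tanh (fst x))\<^sup>2) * cis (snd x)) +
              v *\<^sub>R (\<i> * of_real (tanh (fst x)) * cis (snd x)))) (at x within S)"
proof -
  have eq: "(\<lambda>x. base_point (fst x) (snd x)) =
      (\<lambda>x. tanh (fst x) *\<^sub>R (of_real (cos (snd x)) + \<i> * of_real (sin (snd x))))"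
    by (simp add: fun_eq_iff base_point_def complex_eq_iff)
  have "((\<lambda>x. tanh (fst x)) has_derivative (\<lambda>h. fst h * (1 - (tanh (fst x))\<^sup>2))) (at x within S)"
    by (rule DERIV_compose_FDERIV) (auto intro!: derivative_eq_intros)
  moreover have "((\<lambda>x. complex_of_real (cos (snd x)) + \<i> * complex_of_real (sin (snd x))) has_derivative
      (\<lambda>h. complex_of_real (snd h * - sin (snd x)) + \<i> * complex_of_real (snd h * cos (snd x)))) (at x within S)"
    by (intro has_derivative_add has_derivative_mult_right has_derivative_of_real DERIV_compose_FDERIV)
      (auto intro!: derivative_eq_intros)
  ultimately show ?thesis unfolding eq
    by (rule has_derivative_eq_rhs[OF has_derivative_scaleR])
      (auto simp: fun_eq_iff complex_eq_iff algebra_simps power2_eq_square)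
qed

text \<open>The origin has to be excluded, since there every angle gives the same point.\<close>

lemma inj_on_base_point:
  "inj_on (\<lambda>x. base_point (fst x) (snd x)) {(r, \<theta>). 0 < r \<and> 0 \<le> \<theta> \<and> \<theta> < 2 * pi}"
proof (rule inj_onI, clarsimp simp: base_point_cis)
  fix r \<theta> s \<phi> :: real
  assume r: "0 < r" "0 < s" and a: "0 \<le> \<theta>" "\<theta> < 2*pi" "0 \<le> \<phi>" "\<phi> < 2*pi"
    and eq: "of_real (tanh r) * cis \<theta> = of_real (tanh s) * cis \<phi>"
  have "cmod (of_real (tanh r) * cis \<theta>) = cmod (of_real (tanh s) * cis \<phi>)" using eq by simp
  then have t: "tanh r = tanh s" using r by (simp add: norm_mult)
  then have "r = s" by simp
  moreover have "cis \<theta> = cis \<phi>" using eq t r by simp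
  then have "cis (\<theta> - \<phi>) = 1" by (simp flip: cis_divide)
  then have "cos (\<theta> - \<phi>) = 1" by (simp add: complex_eq_iff)
  then obtain n :: int where n: "\<theta> - \<phi> = 2 * pi * n" using cos_one_2pi_int by (auto simp: mult.commute)
  have "2 * pi * of_int n < 2 * pi * 1" "2 * pi * (-1) < 2 * pi * of_int n" using n a by linarith+
  then have "of_int n < (1::real)" "-1 < (of_int n::real)"
    by (simp_all only: mult_less_cancel_left_pos[of "2*pi"] pi_gt_zero mult_pos_pos zero_less_numeral)
  then have "n = 0" by linarith
  then have "\<theta> = \<phi>" using n by simp
  ultimately show "r = s \<and> \<theta> = \<phi>" by simp
qed

text \<open>The domain of integration in \<open>sl2_area\<close>, named so that its measurability
  can be stated.\<close>

definition polar_preimage :: "complex set \<Rightarrow> (real \<times> real) set" where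
  "polar_preimage D = {(r, \<theta>). 0 \<le> r \<and> 0 \<le> \<theta> \<and> \<theta> < 2 * pi \<and> base_point r \<theta> \<in> D}"

lemma base_point_borel [measurable]: "(\<lambda>x. base_point (fst x) (snd x)) \<in> borel_measurable borel"
  unfolding base_point_cis by (intro borel_measurable_continuous_onI continuous_intros) auto

lemma polar_preimage_borel [measurable]:
  assumes [measurable]: "D \<in> sets borel"
  shows "polar_preimage D \<in> sets borel"
proof -
  have "polar_preimage D = {x. 0 \<le> fst x \<and> 0 \<le> snd x \<and> snd x < 2 * pi} \<inter>
     (\<lambda>x. base_point (fst x) (snd x)) -` D"
    by (auto simp: polar_preimage_def)
  moreover have "{x::real\<times>real. 0 \<le> fst x \<and> 0 \<le> snd x \<and> snd x < 2 * pi} \<in> sets borel"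
  proof -
    have "{x::real\<times>real. 0 \<le> fst x \<and> 0 \<le> snd x \<and> snd x < 2 * pi} = {0..} \<times> {0..<2 * pi}" by auto
    then show ?thesis by (simp only:) (rule borel_Times, auto)
  qed
  moreover have "(\<lambda>x. base_point (fst x) (snd x)) -` D \<in> sets borel"
    by (rule measurable_sets_borel[OF base_point_borel assms])
  ultimately show ?thesis by simp
qed

lemma tanh_artanh_real:
  fixes x :: real
  assumes "\<bar>x\<bar> < 1"
  shows "tanh (artanh x) = x"
proof -
  have "exp (2 * artanh x) = (1 + x) / (1 - x)" using assms by (simp add: artanh_def abs_if split: if_splits)
  then have e: "exp (- 2 * artanh x) = (1 - x) / (1 + x)" by (simp add: exp_minus)
  show ?thesis using assms unfolding tanh_real_altdef e by (simp add: divide_simps)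
qed

lemma base_point_surj:
  assumes "z \<in> hplane"
  obtains r \<theta> where "0 \<le> r" "0 \<le> \<theta>" "\<theta> < 2 * pi" "z = base_point r \<theta>"
proof
  show "0 \<le> artanh (cmod z)" using assms by (simp add: hplane_def artanh_def)
  show "0 \<le> Arg2pi z" "Arg2pi z < 2 * pi" by (auto simp: Arg2pi)
  show "z = base_point (artanh (cmod z)) (Arg2pi z)"
    using assms Arg2pi_eq[of z] by (simp add: base_point_cis hplane_def tanh_artanh_real cis_conv_exp Arg2pi)
qed

text \<open>With \<open>cmod z = tanh r\<close> the polar Jacobian is
  \<open>tanh r / cosh r ^ 2\<close> and the hyperbolic density is \<open>4 * cosh r ^ 4\<close>;
  the product \<open>4 * sinh r * cosh r\<close> is four times the integrand
  \<open>sinh (2 * r) / 2\<close>.\<close>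

lemma harea_eq_sl2_area:
  assumes [measurable]: "D \<in> sets borel" and D: "D \<subseteq> hplane"
  shows "harea D = 4 * sl2_area D"
proof -
  let ?b = "\<lambda>x. base_point (fst x) (snd x)"
  \<comment> \<open>The origin is left out because polar coordinates are not injective
    there.\<close>
  let ?S = "polar_preimage (D - {0})"
  let ?f = "\<lambda>z::complex. 4 / (1 - (norm z)\<^sup>2)\<^sup>2"
  let ?g1 = "\<lambda>x::real\<times>real. of_real (1 - (tanh (fst x))\<^sup>2) * cis (snd x)"
  let ?g2 = "\<lambda>x::real\<times>real. \<i> * of_real (tanh (fst x)) * cis (snd x)"
  have pos: "0 < fst x" "0 \<le> snd x" "snd x < 2*pi" if "x \<in> ?S" for x
    using that by (cases x, cases "fst x = 0"; force simp: polar_preimage_def base_point_cis)+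
  have img: "?b ` ?S = D - {0}"
  proof
    show "D - {0} \<subseteq> ?b ` ?S"
    proof
      fix z assume z: "z \<in> D - {0}"
      then obtain r \<theta> where "0 \<le> r" "0 \<le> \<theta>" "\<theta> < 2 * pi" "z = base_point r \<theta>"
        using base_point_surj D by blast
      then have "(r, \<theta>) \<in> ?S" "z = ?b (r, \<theta>)" using z by (auto simp: polar_preimage_def)
      then show "z \<in> ?b ` ?S" by blast
    qed
  qed (auto simp: polar_preimage_def)
  have [measurable]: "?f \<in> borel_measurable borel" by measurable
  have S[measurable]: "?S \<in> sets borel" by measurable
  have jac: "\<bar>Im (cnj (?g1 x) * ?g2 x)\<bar> * ?f (?b x) = 2 * sinh (2 * fst x)" if "x \<in> ?S" for x
  proof -
    have p: "0 < fst x" using pos[OF that] by simp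
    have t: "1 - (tanh (fst x))\<^sup>2 = 1 / (cosh (fst x))\<^sup>2"
      using hyperbolic_pythagoras[of "fst x"] by (simp add: tanh_def divide_simps)
    have "cnj (?g1 x) * ?g2 x = \<i> * of_real (tanh (fst x) * (1 - (tanh (fst x))\<^sup>2)) * (cnj (cis (snd x)) * cis (snd x))"
      by simp
    also have "cnj (cis (snd x)) * cis (snd x) = 1"
      by (simp add: cis_cnj cis_mult)
    finally have "Im (cnj (?g1 x) * ?g2 x) = tanh (fst x) * (1 - (tanh (fst x))\<^sup>2)"
      by (simp only: Im_i_times Re_complex_of_real mult_1_right)
    then have j1: "\<bar>Im (cnj (?g1 x) * ?g2 x)\<bar> = tanh (fst x) * (1 - (tanh (fst x))\<^sup>2)"
      using p unfolding t by (simp only: abs_of_nonneg) simp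
    have j2: "?f (?b x) = 4 / (1 - (tanh (fst x))\<^sup>2)\<^sup>2"
      by (simp add: base_point_cis norm_mult)
    have "\<bar>Im (cnj (?g1 x) * ?g2 x)\<bar> * ?f (?b x) = 2 * (2 * sinh (fst x) * cosh (fst x))"
      unfolding j1 j2 unfolding t by (simp add: tanh_def power2_eq_square)
    then show ?thesis by (simp only: sinh_double)
  qed
  have fg: "set_borel_measurable borel ?S (\<lambda>x. \<bar>Im (cnj (?g1 x) * ?g2 x)\<bar> * ?f (?b x))"
  proof -
    have "(\<lambda>x::real\<times>real. 2 * sinh (2 * fst x)) \<in> borel_measurable borel"
      by (intro borel_measurable_continuous_onI continuous_intros)
    then have "(\<lambda>x. indicator ?S x *\<^sub>R (2 * sinh (2 * fst x))) \<in> borel_measurable borel"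
      using S by measurable
    moreover have "(\<lambda>x. indicator ?S x *\<^sub>R (2 * sinh (2 * fst x))) =
        (\<lambda>x. indicator ?S x *\<^sub>R (\<bar>Im (cnj (?g1 x) * ?g2 x)\<bar> * ?f (?b x)))"
      using jac by (force simp: fun_eq_iff indicator_def)
    ultimately show ?thesis by (simp add: set_borel_measurable_def)
  qed
  have "harea D = (LINT z:D - {0}|lborel. ?f z)"
    unfolding harea_def
  proof (rule set_integral_cong_set)
    show "AE x in lborel. x \<in> D - {0} \<longleftrightarrow> x \<in> D"
      using AE_lborel_singleton[of "0::complex"] by eventually_elim auto
  qed (auto simp: set_borel_measurable_def)
  also have "\<dots> = (LINT z:?b ` ?S|lborel. ?f z)" by (simp only: img)
  also have "\<dots> = (LINT x:?S|lborel. \<bar>Im (cnj (?g1 x) * ?g2 x)\<bar> * ?f (?b x))"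
  proof (rule LINT_parametrized_image[OF S _ _ fg base_point_has_derivative])
    show "inj_on ?b ?S"
      by (rule inj_on_subset[OF inj_on_base_point]) (use pos in auto)
  qed (auto simp: img set_borel_measurable_def)
  also have "\<dots> = (LINT x:?S|lborel. 4 * (sinh (2 * fst x) / 2))"
    by (rule set_lebesgue_integral_cong) (use S jac in auto)
  also have "\<dots> = 4 * (LINT x:?S|lborel. sinh (2 * fst x) / 2)"
    by (rule set_integral_mult_right)
  also have "(LINT x:?S|lborel. sinh (2 * fst x) / 2) = (LINT x:polar_preimage D|lborel. sinh (2 * fst x) / 2)"
  proof (rule set_integral_cong_set)
    have [measurable]: "(\<lambda>x::real\<times>real. sinh (2 * fst x) / 2) \<in> borel_measurable borel"
      by (intro borel_measurable_continuous_onI continuous_intros) auto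
    show "set_borel_measurable lborel ?S (\<lambda>x. sinh (2 * fst x) / 2)"
      "set_borel_measurable lborel (polar_preimage D) (\<lambda>x. sinh (2 * fst x) / 2)"
      unfolding set_borel_measurable_def by measurable
    \<comment> \<open>The two domains differ only where \<open>r = 0\<close>, a line in the
      parameter plane.\<close>
    have "negligible {x::real\<times>real. x \<bullet> (1,0) = 0}"
      by (rule negligible_standard_hyperplane) (simp add: Basis_prod_def)
    then have "AE x in lebesgue. x \<notin> {x::real\<times>real. x \<bullet> (1,0) = 0}"
      by (intro AE_not_in) (simp only: negligible_iff_null_sets)
    then have "AE x in lborel. x \<notin> {x::real\<times>real. x \<bullet> (1,0) = 0}"
      by (simp add: AE_completion_iff)
    then show "AE x in lborel. (x \<in> polar_preimage D) = (x \<in> ?S)"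
      by eventually_elim (auto simp: polar_preimage_def base_point_cis inner_prod_def)
  qed
  finally show ?thesis by (simp add: sl2_area_def polar_preimage_def)
qed

section \<open>Geodesics, the Klein model and convexity\<close>

lemma hplane_iff: "z \<in> hplane \<longleftrightarrow> cmod z < 1"
  by (simp add: hplane_def)

lemma hplane_norm_sq: "z \<in> hplane \<Longrightarrow> (cmod z)\<^sup>2 < 1"
  by (simp add: hplane_iff power_less_one_iff)

section \<open>Moebius maps as isometries\<close>

abbreviation mob :: "complex \<Rightarrow> complex \<Rightarrow> complex" where
  "mob c \<equiv> Moebius_function 0 c"

lemma mob_in_hplane: "c \<in> hplane \<Longrightarrow> z \<in> hplane \<Longrightarrow> mob c z \<in> hplane"
  by (simp add: hplane_iff Moebius_function_norm_lt_1)

lemma mob_inverse: "c \<in> hplane \<Longrightarrow> z \<in> hplane \<Longrightarrow> mob (- c) (mob c z) = z"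
  using Moebius_function_compose[of "-c" c z] by (simp add: hplane_iff)

lemma mob_inverse': "c \<in> hplane \<Longrightarrow> z \<in> hplane \<Longrightarrow> mob c (mob (- c) z) = z"
  using mob_inverse[of "-c" z] by (simp add: hplane_iff)

lemma mob_denom:
  assumes "c \<in> hplane" "z \<in> hplane"
  shows "1 - cnj c * z \<noteq> 0"
proof
  assume "1 - cnj c * z = 0"
  then have "cmod (cnj c * z) = 1" by simp
  moreover have "cmod (cnj c * z) < 1" using assms norm_mult_less[of "cnj c" 1 z 1] by (simp add: hplane_iff)
  ultimately show False by simp
qed

text \<open>Rests on \<open>cmod (1 - cnj c * z) ^ 2 - cmod (z - c) ^ 2 = (1 - cmod c ^ 2) * (1 -
  cmod z ^ 2)\<close>. It yields the invariance of both the distance and the area element.\<close>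

lemma one_minus_cmod_mob:
  assumes "c \<in> hplane" "z \<in> hplane"
  shows "1 - (cmod (mob c z))\<^sup>2 = (1 - (cmod c)\<^sup>2) * (1 - (cmod z)\<^sup>2) / (cmod (1 - cnj c * z))\<^sup>2"
proof -
  have "(cmod (1 - cnj c * z))\<^sup>2 - (cmod (z - c))\<^sup>2 = (1 - (cmod c)\<^sup>2) * (1 - (cmod z)\<^sup>2)"
    unfolding cmod_power2 by (simp add: power2_eq_square algebra_simps)
  then show ?thesis using mob_denom[OF assms]
    by (simp add: Moebius_function_simple norm_divide power_divide divide_simps)
qed

lemma mob_diff:
  fixes z w :: complex
  assumes "c \<in> hplane" "z \<in> hplane" "w \<in> hplane"
  shows "mob c z - mob c w = of_real (1 - (cmod c)\<^sup>2) * (z - w) / ((1 - cnj c * z) * (1 - cnj c * w))"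
  using mob_denom[OF assms(1,2)] mob_denom[OF assms(1,3)] complex_norm_square[of c]
  by (simp add: Moebius_function_simple divide_simps) (simp add: algebra_simps)

text \<open>The factors that \<open>mob c\<close> contributes to the squared difference are exactly
  those it contributes to the two denominators, so the quotient inside \<open>hdist\<close> does not
  change.\<close>

lemma hdist_mob:
  assumes "c \<in> hplane" "z \<in> hplane" "w \<in> hplane"
  shows "hdist (mob c z) (mob c w) = hdist z w"
proof -
  have n: "(cmod (mob c z - mob c w))\<^sup>2 = (1 - (cmod c)\<^sup>2)\<^sup>2 * (cmod (z - w))\<^sup>2 / ((cmod (1 - cnj c * z))\<^sup>2 * (cmod (1 - cnj c * w))\<^sup>2)"
    unfolding mob_diff[OF assms] by (simp only: norm_mult norm_divide norm_of_real power_mult_distrib power_divide power2_abs)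
  have cancel: "k\<^sup>2 * m / (P * Q) / ((k * A / P) * (k * B / Q)) = m / (A * B)"
    if "k \<noteq> 0" "P \<noteq> 0" "Q \<noteq> 0" for k m P Q A B :: real
    using that by (simp add: divide_simps power2_eq_square)
  have "1 - (cmod c)\<^sup>2 \<noteq> 0" "1 - cnj c * z \<noteq> 0" "1 - cnj c * w \<noteq> 0"
    using mob_denom[OF assms(1,2)] mob_denom[OF assms(1,3)] hplane_norm_sq[OF assms(1)] by auto
  then have "(cmod (mob c z - mob c w))\<^sup>2 / ((1 - (cmod (mob c z))\<^sup>2) * (1 - (cmod (mob c w))\<^sup>2))
      = (cmod (z - w))\<^sup>2 / ((1 - (cmod z)\<^sup>2) * (1 - (cmod w)\<^sup>2))"
    unfolding one_minus_cmod_mob[OF assms(1,2)] one_minus_cmod_mob[OF assms(1,3)] n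
    by (intro cancel) auto
  then show ?thesis by (simp add: hdist_def flip: times_divide_eq_right)
qed

lemma hdist_cis: "hdist (cis t * z) (cis t * w) = hdist z w"
  by (simp add: hdist_def norm_mult flip: right_diff_distrib)

lemma hdist_commute: "hdist z w = hdist w z"
  by (simp add: hdist_def norm_minus_commute mult.commute)

lemma cosh_hdist:
  assumes "z \<in> hplane" "w \<in> hplane"
  shows "cosh (hdist z w) = 1 + 2 * (cmod (z - w))\<^sup>2 / ((1 - (cmod z)\<^sup>2) * (1 - (cmod w)\<^sup>2))"
    and "hdist z w \<ge> 0"
proof -
  have "0 \<le> 2 * (cmod (z - w))\<^sup>2 / ((1 - (cmod z)\<^sup>2) * (1 - (cmod w)\<^sup>2))"
    using assms by (simp add: hplane_norm_sq less_imp_le)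
  then show "cosh (hdist z w) = 1 + 2 * (cmod (z - w))\<^sup>2 / ((1 - (cmod z)\<^sup>2) * (1 - (cmod w)\<^sup>2))"
    "hdist z w \<ge> 0"
    unfolding hdist_def by (simp_all add: add_increasing2)
qed

lemma cosh_hdist_0:
  assumes "z \<in> hplane"
  shows "cosh (hdist 0 z) = (1 + (cmod z)\<^sup>2) / (1 - (cmod z)\<^sup>2)"
    and "sinh (hdist 0 z) = 2 * cmod z / (1 - (cmod z)\<^sup>2)"
proof -
  have p: "(cmod z)\<^sup>2 < 1" using assms by (rule hplane_norm_sq)
  show c: "cosh (hdist 0 z) = (1 + (cmod z)\<^sup>2) / (1 - (cmod z)\<^sup>2)"
    using p assms cosh_hdist(1)[of 0 z] by (simp add: hplane_iff divide_simps)
  have h: "hdist 0 z \<ge> 0" using assms by (intro cosh_hdist) (auto simp: hplane_iff)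
  have "(sinh (hdist 0 z))\<^sup>2 = ((1 + (cmod z)\<^sup>2) / (1 - (cmod z)\<^sup>2))\<^sup>2 - 1"
    by (simp add: sinh_square_eq c)
  also have "\<dots> = (2 * cmod z / (1 - (cmod z)\<^sup>2))\<^sup>2"
    using p by (simp add: divide_simps power2_eq_square) (simp add: algebra_simps)
  finally show "sinh (hdist 0 z) = 2 * cmod z / (1 - (cmod z)\<^sup>2)"
    by (rule power2_eq_imp_eq) (use h p in auto)
qed

text \<open>This is the half-argument formula \<open>tanh (x / 2) = sinh x / (1 + cosh x)\<close>.
  It is the origin of the factor 2 in the theorem, because \<open>base_point r\<close> has modulus
  \<open>tanh r\<close>.\<close>

lemma cmod_eq_tanh_hdist:
  assumes "z \<in> hplane"
  shows "cmod z = tanh (hdist 0 z / 2)"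
proof -
  have p: "(cmod z)\<^sup>2 < 1" using assms by (rule hplane_norm_sq)
  let ?x = "hdist 0 z / 2"
  have "sinh (2 * ?x) / (1 + cosh (2 * ?x)) = cmod z"
    using p by (simp add: cosh_hdist_0[OF assms] divide_simps)
  moreover have "sinh (2 * ?x) / (1 + cosh (2 * ?x)) = tanh ?x"
    unfolding sinh_double cosh_double_cosh tanh_def by (simp add: divide_simps power2_eq_square)
  ultimately show ?thesis by simp
qed

text \<open>In the hyperboloid model \<open>z\<close> is the ray through $(1+|z|^2, 2z)$, and the segment from \<open>a\<close> to \<open>b\<close>
  consists of the rays in the cone spanned by those of \<open>a\<close> and \<open>b\<close>. Moebius maps act linearly on these
  vectors up to a positive factor, so this betweenness is invariant and can be tested with \<open>z\<close> moved to \<open>0\<close>.\<close>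

definition hbetween :: "complex \<Rightarrow> complex \<Rightarrow> complex \<Rightarrow> bool" where
  "hbetween a b z \<longleftrightarrow> (\<exists>s t. 0 \<le> s \<and> 0 \<le> t \<and>
      1 + (cmod z)\<^sup>2 = s * (1 + (cmod a)\<^sup>2) + t * (1 + (cmod b)\<^sup>2) \<and> z = of_real s * a + of_real t * b)"

text \<open>Both right-hand sides are linear in $(1+|z|^2, z)$ up to the common factor $|1-\bar c z|^{-2}$.\<close>

lemma mob_vector:
  assumes c: "c \<in> hplane" and z: "z \<in> hplane"
  shows "1 + (cmod (mob c z))\<^sup>2 = ((1 + (cmod c)\<^sup>2) * (1 + (cmod z)\<^sup>2) - 4 * Re (cnj c * z)) / (cmod (1 - cnj c * z))\<^sup>2"
    and "mob c z = (z + c\<^sup>2 * cnj z - c * (1 + (cmod z)\<^sup>2)) / of_real ((cmod (1 - cnj c * z))\<^sup>2)"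
proof -
  have nz: "1 - cnj c * z \<noteq> 0" by (rule mob_denom[OF assms])
  have "(cmod (1 - cnj c * z))\<^sup>2 + (cmod (z - c))\<^sup>2 = (1 + (cmod c)\<^sup>2) * (1 + (cmod z)\<^sup>2) - 4 * Re (cnj c * z)"
    unfolding cmod_power2 by (simp add: power2_eq_square algebra_simps)
  then show "1 + (cmod (mob c z))\<^sup>2 = ((1 + (cmod c)\<^sup>2) * (1 + (cmod z)\<^sup>2) - 4 * Re (cnj c * z)) / (cmod (1 - cnj c * z))\<^sup>2"
    using nz by (simp add: Moebius_function_simple norm_divide power_divide divide_simps)
  have "mob c z = (z - c) * cnj (1 - cnj c * z) / ((1 - cnj c * z) * cnj (1 - cnj c * z))"
    by (simp only: Moebius_function_simple mult_divide_mult_cancel_right complex_cnj_zero_iff nz not_False_eq_True)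
  also have "(1 - cnj c * z) * cnj (1 - cnj c * z) = of_real ((cmod (1 - cnj c * z))\<^sup>2)"
    by (simp only: complex_norm_square)
  also have "(z - c) * cnj (1 - cnj c * z) = z + c\<^sup>2 * cnj z - c * (1 + (cmod z)\<^sup>2)"
    using complex_norm_square[of z] by (simp add: algebra_simps power2_eq_square)
  finally show "mob c z = (z + c\<^sup>2 * cnj z - c * (1 + (cmod z)\<^sup>2)) / of_real ((cmod (1 - cnj c * z))\<^sup>2)" .
qed

lemma hbetween_mob:
  assumes c: "c \<in> hplane" and h: "a \<in> hplane" "b \<in> hplane" "z \<in> hplane" and "hbetween a b z"
  shows "hbetween (mob c a) (mob c b) (mob c z)"
proof -
  obtain s t where st: "0 \<le> s" "0 \<le> t"
      and e1: "1 + (cmod z)\<^sup>2 = s * (1 + (cmod a)\<^sup>2) + t * (1 + (cmod b)\<^sup>2)"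
      and e2: "z = of_real s * a + of_real t * b"
    using assms(5) unfolding hbetween_def by blast
  define N where "N = (\<lambda>z. (cmod (1 - cnj c * z))\<^sup>2)"
  have N: "N z > 0" "N a > 0" "N b > 0" unfolding N_def using mob_denom[OF c] h by simp_all
  have v1: "1 + (cmod (mob c w))\<^sup>2 = ((1 + (cmod c)\<^sup>2) * (1 + (cmod w)\<^sup>2) - 4 * Re (cnj c * w)) / N w"
    and v2: "mob c w = (w + c\<^sup>2 * cnj w - c * (1 + (cmod w)\<^sup>2)) / of_real (N w)" if "w \<in> hplane" for w
    using mob_vector[OF c that] unfolding N_def by blast+
  \<comment> \<open>The numerators in \<open>mob_vector\<close> are linear in the hyperboloid
    vectors; the new coefficients only absorb the positive denominators \<open>N\<close>.\<close>
  define S T where "S = s * N a / N z" and "T = t * N b / N z"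
  have "0 \<le> S" "0 \<le> T" using N st by (auto simp: S_def T_def)
  moreover have "1 + (cmod (mob c z))\<^sup>2 = S * (1 + (cmod (mob c a))\<^sup>2) + T * (1 + (cmod (mob c b))\<^sup>2)"
  proof -
    have "S * (1 + (cmod (mob c a))\<^sup>2) + T * (1 + (cmod (mob c b))\<^sup>2) =
      (s * ((1 + (cmod c)\<^sup>2) * (1 + (cmod a)\<^sup>2) - 4 * Re (cnj c * a)) +
       t * ((1 + (cmod c)\<^sup>2) * (1 + (cmod b)\<^sup>2) - 4 * Re (cnj c * b))) / N z"
      unfolding v1[OF h(1)] v1[OF h(2)] S_def T_def using N by (simp add: add_divide_distrib)
    also have "s * ((1 + (cmod c)\<^sup>2) * (1 + (cmod a)\<^sup>2) - 4 * Re (cnj c * a)) +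
       t * ((1 + (cmod c)\<^sup>2) * (1 + (cmod b)\<^sup>2) - 4 * Re (cnj c * b))
      = (1 + (cmod c)\<^sup>2) * (s * (1 + (cmod a)\<^sup>2) + t * (1 + (cmod b)\<^sup>2)) - 4 * Re (cnj c * (of_real s * a + of_real t * b))"
      by (simp add: algebra_simps)
    also have "\<dots> = (1 + (cmod c)\<^sup>2) * (1 + (cmod z)\<^sup>2) - 4 * Re (cnj c * z)"
      using e1 e2 by simp
    finally show ?thesis unfolding v1[OF h(3)] ..
  qed
  moreover have "mob c z = of_real S * mob c a + of_real T * mob c b"
  proof -
    have "of_real S * mob c a + of_real T * mob c b =
      (of_real s * (a + c\<^sup>2 * cnj a - c * (1 + (cmod a)\<^sup>2)) + of_real t * (b + c\<^sup>2 * cnj b - c * (1 + (cmod b)\<^sup>2))) / of_real (N z)"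
      unfolding v2[OF h(1)] v2[OF h(2)] S_def T_def using N by (simp add: add_divide_distrib)
    also have "of_real s * (a + c\<^sup>2 * cnj a - c * (1 + (cmod a)\<^sup>2)) + of_real t * (b + c\<^sup>2 * cnj b - c * (1 + (cmod b)\<^sup>2))
      = (of_real s * a + of_real t * b) + c\<^sup>2 * cnj (of_real s * a + of_real t * b) - c * of_real (s * (1 + (cmod a)\<^sup>2) + t * (1 + (cmod b)\<^sup>2))"
      by (simp add: algebra_simps)
    also have "\<dots> = z + c\<^sup>2 * cnj z - c * of_real (1 + (cmod z)\<^sup>2)"
      using e1 e2 by simp
    finally show ?thesis unfolding v2[OF h(3)] by simp
  qed
  ultimately show ?thesis unfolding hbetween_def by blast
qed

lemma hbetween_mob_iff:
  assumes c: "c \<in> hplane" and h: "a \<in> hplane" "b \<in> hplane" "z \<in> hplane"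
  shows "hbetween (mob c a) (mob c b) (mob c z) \<longleftrightarrow> hbetween a b z"
  using hbetween_mob[OF c h] hbetween_mob[of "-c" "mob c a" "mob c b" "mob c z"] c h mob_in_hplane
  by (auto simp: mob_inverse hplane_iff)

text \<open>Nonnegative lengths agree when their \<open>cosh\<close> agree; the addition theorem
  then reduces equality in the triangle inequality through 0 to \<open>a\<close> and
  \<open>b\<close> having opposite directions, or one of them being 0.\<close>

lemma hdist_add_through_0:
  assumes a: "a \<in> hplane" and b: "b \<in> hplane"
  shows "hdist a 0 + hdist 0 b = hdist a b \<longleftrightarrow> a \<bullet> b = - (cmod a * cmod b)"
proof -
  have p: "(cmod a)\<^sup>2 < 1" "(cmod b)\<^sup>2 < 1" using assms by (auto intro: hplane_norm_sq)
  have 0: "0 \<in> hplane" by (simp add: hplane_iff)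
  have nn: "hdist a 0 + hdist 0 b \<ge> 0" "hdist a b \<ge> 0"
    using cosh_hdist(2) 0 a b by (auto intro: add_nonneg_nonneg)
  have n: "(cmod (a - b))\<^sup>2 = (cmod a)\<^sup>2 + (cmod b)\<^sup>2 - 2 * (a \<bullet> b)"
    by (simp add: power2_norm_eq_inner inner_diff inner_commute)
  have "hdist a 0 + hdist 0 b = hdist a b \<longleftrightarrow> cosh (hdist 0 a + hdist 0 b) = cosh (hdist a b)"
    using nn by (simp add: hdist_commute[of a 0] cosh_real_eq_iff)
  also have "\<dots> \<longleftrightarrow> (1 + (cmod a)\<^sup>2) * (1 + (cmod b)\<^sup>2) + 4 * cmod a * cmod b
      = (1 - (cmod a)\<^sup>2) * (1 - (cmod b)\<^sup>2) + 2 * (cmod (a - b))\<^sup>2"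
    unfolding cosh_add cosh_hdist_0[OF a] cosh_hdist_0[OF b] cosh_hdist(1)[OF a b]
    using p by (simp add: divide_simps mult.assoc)
  also have "\<dots> \<longleftrightarrow> a \<bullet> b = - (cmod a * cmod b)"
    unfolding n by (simp add: algebra_simps) linarith
  finally show ?thesis .
qed

text \<open>A nonnegative combination vanishes with coefficients not both 0 exactly when the vectors
  are opposite, which is the extreme case of Cauchy-Schwarz.\<close>

lemma hbetween_0:
  "hbetween a b 0 \<longleftrightarrow> a \<bullet> b = - (cmod a * cmod b)"
proof
  assume "hbetween a b 0"
  then obtain s t where st: "0 \<le> s" "0 \<le> t" and e: "1 = s * (1 + (cmod a)\<^sup>2) + t * (1 + (cmod b)\<^sup>2)"
    and 0: "0 = s *\<^sub>R a + t *\<^sub>R b"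
    unfolding hbetween_def by (auto simp: scaleR_conv_of_real)
  have sa: "s *\<^sub>R a = - (t *\<^sub>R b)" using 0 by (simp add: eq_neg_iff_add_eq_0)
  then have n: "s * cmod a = t * cmod b" using st by (metis abs_of_nonneg norm_minus_cancel norm_scaleR)
  have "s \<noteq> 0 \<or> t \<noteq> 0" using e by auto
  then show "a \<bullet> b = - (cmod a * cmod b)"
  proof
    assume s: "s \<noteq> 0"
    have "s * (a \<bullet> b) = (s *\<^sub>R a) \<bullet> b" by simp
    also have "\<dots> = - (t * (cmod b)\<^sup>2)" unfolding sa by (simp add: dot_square_norm)
    also have "\<dots> = s * - (cmod a * cmod b)" using n by (simp add: power2_eq_square)
    finally show ?thesis using s unfolding mult_cancel_left by simp
  next
    assume t: "t \<noteq> 0"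
    have "t * (a \<bullet> b) = a \<bullet> (t *\<^sub>R b)" by simp
    also have "t *\<^sub>R b = - (s *\<^sub>R a)" using sa by simp
    also have "a \<bullet> (- (s *\<^sub>R a)) = t * - (cmod a * cmod b)" using n by (simp add: dot_square_norm power2_eq_square)
    finally show ?thesis using t unfolding mult_cancel_left by simp
  qed
next
  assume h: "a \<bullet> b = - (cmod a * cmod b)"
  show "hbetween a b 0"
  proof (cases "a = 0")
    case True
    show ?thesis unfolding hbetween_def
      by (rule exI[of _ 1], rule exI[of _ 0]) (simp add: True)
  next
    case False
    have "a \<bullet> (- b) = norm a * norm (- b)" using h by simp
    then have "norm a *\<^sub>R (- b) = norm (- b) *\<^sub>R a" by (simp only: norm_cauchy_schwarz_eq)
    then have "cmod b *\<^sub>R a = - (cmod a *\<^sub>R b)" by simp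
    then have e: "cmod b *\<^sub>R a + cmod a *\<^sub>R b = 0" by simp
    \<comment> \<open>Opposite vectors satisfy \<open>cmod b * a + cmod a * b = 0\<close>; dividing
      by \<open>D\<close> makes the first hyperboloid coordinate equal to 1.\<close>
    define D where "D = cmod b * (1 + (cmod a)\<^sup>2) + cmod a * (1 + (cmod b)\<^sup>2)"
    have D: "D > 0" unfolding D_def using False by (intro add_nonneg_pos) (auto intro!: mult_pos_pos add_pos_nonneg)
    show ?thesis unfolding hbetween_def
    proof (rule exI[of _ "cmod b / D"], rule exI[of _ "cmod a / D"], intro conjI)
      show "1 + (cmod 0)\<^sup>2 = cmod b / D * (1 + (cmod a)\<^sup>2) + cmod a / D * (1 + (cmod b)\<^sup>2)"
        using D by (simp flip: add_divide_distrib) (simp add: D_def)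
      have "of_real (cmod b / D) * a + of_real (cmod a / D) * b = (1 / D) *\<^sub>R (cmod b *\<^sub>R a + cmod a *\<^sub>R b)"
        by (simp add: scaleR_conv_of_real algebra_simps)
      then show "0 = of_real (cmod b / D) * a + of_real (cmod a / D) * b" unfolding e by simp
    qed (use D in auto)
  qed
qed

lemma hsegment_iff:
  assumes "a \<in> hplane" "b \<in> hplane"
  shows "z \<in> hsegment a b \<longleftrightarrow> z \<in> hplane \<and> hbetween a b z"
proof (cases "z \<in> hplane")
  case True
  have z0: "mob z z = 0" by (simp add: Moebius_function_eq_zero)
  have "hdist a z + hdist z b = hdist a b \<longleftrightarrow> hdist (mob z a) 0 + hdist 0 (mob z b) = hdist (mob z a) (mob z b)"
    using hdist_mob[OF True] True assms z0 by metis
  also have "\<dots> \<longleftrightarrow> hbetween (mob z a) (mob z b) 0"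
    using hdist_add_through_0 hbetween_0 mob_in_hplane[OF True] assms by metis
  also have "\<dots> \<longleftrightarrow> hbetween a b z"
    using hbetween_mob_iff[OF True assms True] z0 by simp
  finally show ?thesis using True by (simp add: hsegment_def)
qed (simp add: hsegment_def)

text \<open>The passage from the Poincare to the Klein model, where hyperbolic segments are Euclidean ones.\<close>

definition klein :: "complex \<Rightarrow> complex" where
  "klein z = (2 / (1 + (cmod z)\<^sup>2)) *\<^sub>R z"

text \<open>Equal images force \<open>(cmod z - cmod w) * (1 - cmod z * cmod w) = 0\<close>, whose
  second factor is positive; once the moduli agree, so do the scaling factors.\<close>

lemma klein_inj:
  assumes "z \<in> hplane" "w \<in> hplane" "klein z = klein w"
  shows "z = w"
proof -
  have lt: "cmod z < 1" "cmod w < 1" using assms by (auto simp: hplane_iff)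
  have pos: "1 + (cmod z)\<^sup>2 > 0" "1 + (cmod w)\<^sup>2 > 0" by (auto intro: add_pos_nonneg)
  have "norm (klein z) = norm (klein w)" using assms(3) by simp
  then have "2 * cmod z / (1 + (cmod z)\<^sup>2) = 2 * cmod w / (1 + (cmod w)\<^sup>2)"
    using pos by (simp add: klein_def)
  then have "cmod z * (1 + (cmod w)\<^sup>2) = cmod w * (1 + (cmod z)\<^sup>2)"
    using pos by (simp add: field_simps)
  then have "(cmod z - cmod w) * (1 - cmod z * cmod w) = 0"
    by (simp add: algebra_simps power2_eq_square)
  moreover have "cmod z * cmod w < 1" using lt by (metis norm_mult norm_mult_less mult_1)
  ultimately have "cmod z = cmod w" by simp
  then show ?thesis using assms(3) pos by (simp add: klein_def)
qed

lemma klein_surj: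
  assumes "y \<in> hplane"
  obtains z where "z \<in> hplane" "klein z = y"
proof -
  \<comment> \<open>The preimage is sought as \<open>y / k\<close>, which leads to
    \<open>k^2 - 2 * k + cmod y ^ 2 = 0\<close>; the larger root gives a point of the disc.\<close>
  define k where "k = 1 + sqrt (1 - (cmod y)\<^sup>2)"
  have p: "(cmod y)\<^sup>2 < 1" using assms by (rule hplane_norm_sq)
  then have k1: "k > 1" by (simp add: k_def)
  have "(k - 1)\<^sup>2 = 1 - (cmod y)\<^sup>2" using p by (simp add: k_def)
  then have k: "(cmod y)\<^sup>2 = 2 * k - k\<^sup>2" by (simp add: power2_diff)
  show ?thesis
  proof
    have "cmod y / k < 1" using k1 assms by (simp add: hplane_iff)
    then show "(1/k) *\<^sub>R y \<in> hplane" using k1 by (simp add: hplane_iff)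
    have "1 + (cmod ((1/k) *\<^sub>R y))\<^sup>2 = 2 / k"
      using k1 by (simp add: power_divide k) (simp add: field_simps power2_eq_square)
    then show "klein ((1/k) *\<^sub>R y) = y" unfolding klein_def using k1 by simp
  qed
qed

lemma klein_in_hplane:
  assumes "z \<in> hplane"
  shows "klein z \<in> hplane"
proof -
  have pos: "1 + (cmod z)\<^sup>2 > 0" by (auto intro: add_pos_nonneg)
  have "0 < (1 - cmod z)\<^sup>2" using assms by (simp add: hplane_iff)
  then have "2 * cmod z < 1 + (cmod z)\<^sup>2" by (simp add: power2_diff)
  then show ?thesis using pos by (simp add: hplane_iff klein_def)
qed

lemma klein_image_hplane: "klein ` hplane = hplane"
proof
  show "klein ` hplane \<subseteq> hplane" using klein_in_hplane by blast
  show "hplane \<subseteq> klein ` hplane" by (rule subsetI, erule klein_surj) blast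
qed

text \<open>\<open>klein z\<close> arises from the vector \<open>(1 + cmod z ^ 2, 2 * z)\<close> by
  dividing by its first coordinate, which turns conic combinations into convex ones after rescaling
  the coefficients.\<close>

lemma hbetween_klein: "hbetween a b z \<longleftrightarrow> klein z \<in> closed_segment (klein a) (klein b)"
proof -
  have pos: "1 + (cmod w)\<^sup>2 > 0" for w :: complex by (auto intro: add_pos_nonneg)
  have half: "((1 + (cmod w)\<^sup>2) / 2) *\<^sub>R klein w = w" for w
  proof -
    have "(x / 2) * (2 / x) = 1" if "x > 0" for x :: real using that by simp
    from this[OF pos[of w]] show ?thesis by (simp only: klein_def scaleR_scaleR scaleR_one)
  qed
  show ?thesis
  proof
    assume "hbetween a b z"
    then obtain s t where st: "0 \<le> s" "0 \<le> t"
      and e1: "1 + (cmod z)\<^sup>2 = s * (1 + (cmod a)\<^sup>2) + t * (1 + (cmod b)\<^sup>2)"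
      and e2: "z = of_real s * a + of_real t * b"
      unfolding hbetween_def by blast
    define u v where "u = s * (1 + (cmod a)\<^sup>2) / (1 + (cmod z)\<^sup>2)" and "v = t * (1 + (cmod b)\<^sup>2) / (1 + (cmod z)\<^sup>2)"
    have uv: "0 \<le> u" "0 \<le> v" using st pos by (auto simp: u_def v_def less_imp_le)
    have "u + v = 1" unfolding u_def v_def using pos[of z] e1 by (simp flip: add_divide_distrib)
    moreover have "klein z = u *\<^sub>R klein a + v *\<^sub>R klein b"
    proof -
      have "klein z = (2 / (1 + (cmod z)\<^sup>2)) *\<^sub>R (s *\<^sub>R a + t *\<^sub>R b)"
        unfolding klein_def by (subst (2) e2) (simp add: scaleR_conv_of_real)
      also have "\<dots> = u *\<^sub>R klein a + v *\<^sub>R klein b"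
        unfolding klein_def u_def v_def using pos[of a] pos[of b]
        by (simp add: scaleR_add_right mult.commute)
      finally show ?thesis .
    qed
    ultimately show "klein z \<in> closed_segment (klein a) (klein b)"
      using uv unfolding closed_segment_def by (auto intro!: exI[of _ v] simp: eq_diff_eq[symmetric])
  next
    assume "klein z \<in> closed_segment (klein a) (klein b)"
    then obtain v where v: "0 \<le> v" "v \<le> 1" "klein z = (1 - v) *\<^sub>R klein a + v *\<^sub>R klein b"
      unfolding closed_segment_def by blast
    define s t where "s = (1 - v) * (1 + (cmod z)\<^sup>2) / (1 + (cmod a)\<^sup>2)" and "t = v * (1 + (cmod z)\<^sup>2) / (1 + (cmod b)\<^sup>2)"
    have cancel2: "x / 2 * (u * (2 / y)) = u * x / y" for u x y :: real by simp
    have "0 \<le> s" "0 \<le> t" using v pos by (auto simp: s_def t_def less_imp_le)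
    moreover have "1 + (cmod z)\<^sup>2 = s * (1 + (cmod a)\<^sup>2) + t * (1 + (cmod b)\<^sup>2)"
    proof -
      have "s * (1 + (cmod a)\<^sup>2) = (1 - v) * (1 + (cmod z)\<^sup>2)" "t * (1 + (cmod b)\<^sup>2) = v * (1 + (cmod z)\<^sup>2)"
        unfolding s_def t_def using pos[of a] pos[of b] by simp_all
      then show ?thesis by (simp add: algebra_simps)
    qed
    moreover have "z = of_real s * a + of_real t * b"
    proof -
      have "z = ((1 + (cmod z)\<^sup>2) / 2) *\<^sub>R ((1 - v) *\<^sub>R klein a + v *\<^sub>R klein b)"
        using half[of z] v by simp
      also have "\<dots> = s *\<^sub>R a + t *\<^sub>R b"
        using pos[of a] pos[of b] cancel2[of "1 + (cmod z)\<^sup>2" "1 - v" "1 + (cmod a)\<^sup>2"] cancel2[of "1 + (cmod z)\<^sup>2" v "1 + (cmod b)\<^sup>2"]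
        by (simp only: klein_def s_def t_def scaleR_add_right scaleR_scaleR less_numeral_extra(3) simp_thms)
      finally show ?thesis by (simp add: scaleR_conv_of_real)
    qed
    ultimately show "hbetween a b z" unfolding hbetween_def by blast
  qed
qed

lemma hsegment_klein:
  assumes "a \<in> hplane" "b \<in> hplane"
  shows "z \<in> hsegment a b \<longleftrightarrow> z \<in> hplane \<and> klein z \<in> closed_segment (klein a) (klein b)"
  using hsegment_iff[OF assms] hbetween_klein by simp

lemma convex_hplane: "convex hplane" by (simp add: hplane_def)

text \<open>On the disc \<open>klein\<close> is a bijection that carries hyperbolic segments to
  Euclidean ones.\<close>

lemma hconvex_iff: "hconvex S \<longleftrightarrow> S \<subseteq> hplane \<and> convex (klein ` S)"
proof
  assume h: "hconvex S"
  then have S: "S \<subseteq> hplane" by (simp add: hconvex_def)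
  have "closed_segment (klein a) (klein b) \<subseteq> klein ` S" if ab: "a \<in> S" "b \<in> S" for a b
  proof
    fix y assume y: "y \<in> closed_segment (klein a) (klein b)"
    have "klein a \<in> hplane" "klein b \<in> hplane" using ab S by (auto intro: klein_in_hplane)
    then have "y \<in> hplane" using y convex_hplane by (metis closed_segment_subset in_mono)
    then obtain z where z: "z \<in> hplane" "klein z = y" using klein_surj by blast
    then have "z \<in> hsegment a b" using ab S y by (simp add: hsegment_klein subset_iff)
    then show "y \<in> klein ` S" using h ab z unfolding hconvex_def by blast
  qed
  then show "S \<subseteq> hplane \<and> convex (klein ` S)" using S by (auto simp: convex_contains_segment)
next
  assume h: "S \<subseteq> hplane \<and> convex (klein ` S)"
  show "hconvex S" unfolding hconvex_def
  proof (intro conjI ballI subsetI)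
    fix a b z assume ab: "a \<in> S" "b \<in> S" and z: "z \<in> hsegment a b"
    have "z \<in> hplane" "klein z \<in> closed_segment (klein a) (klein b)"
      using z ab h by (auto simp: hsegment_klein subset_iff)
    moreover have "closed_segment (klein a) (klein b) \<subseteq> klein ` S"
      using h ab by (simp add: closed_segment_subset)
    ultimately show "z \<in> S" using h klein_inj by (metis (no_types, lifting) imageE subsetD)
  qed (use h in auto)
qed

lemma hconvex_hplane: "hconvex hplane"
  by (simp add: hconvex_iff klein_image_hplane convex_hplane)

text \<open>The empty intersection is the whole type and not contained in \<open>hplane\<close>, so
  the family must have a member; for hulls of subsets of \<open>hplane\<close>,
  \<open>hplane\<close> itself is one.\<close>

lemma hconvex_Inter: "(\<And>S. S \<in> F \<Longrightarrow> hconvex S) \<Longrightarrow> F \<noteq> {} \<Longrightarrow> hconvex (\<Inter>F)"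
  unfolding hconvex_def by (intro conjI ballI Inter_greatest) (blast, metis InterD)

lemma hconvex_hconvex_hull: "V \<subseteq> hplane \<Longrightarrow> hconvex (hconvex hull V)"
  unfolding hull_def by (rule hconvex_Inter) (use hconvex_hplane in auto)

lemma hull_subset_hplane: "V \<subseteq> hplane \<Longrightarrow> hconvex hull V \<subseteq> hplane"
  using hconvex_hconvex_hull hconvex_def by blast

text \<open>Reduces statements on tiles to Euclidean convex hulls; each inclusion uses the
  minimality of one of the two hulls.\<close>

lemma klein_hull:
  assumes "V \<subseteq> hplane"
  shows "hconvex hull V = {z \<in> hplane. klein z \<in> convex hull (klein ` V)}"
proof
  let ?H = "{z \<in> hplane. klein z \<in> convex hull (klein ` V)}"
  have sub: "convex hull (klein ` V) \<subseteq> hplane"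
    by (rule hull_minimal) (use assms klein_in_hplane convex_hplane in auto)
  have "klein ` ?H = convex hull (klein ` V)"
  proof
    show "convex hull (klein ` V) \<subseteq> klein ` ?H"
    proof
      fix y assume y: "y \<in> convex hull (klein ` V)"
      then obtain z where "z \<in> hplane" "klein z = y" using sub klein_surj by blast
      then show "y \<in> klein ` ?H" using y by blast
    qed
  qed auto
  then have "hconvex ?H" by (simp add: hconvex_iff subset_iff)
  moreover have "V \<subseteq> ?H" using assms by (auto intro: hull_inc)
  ultimately show "hconvex hull V \<subseteq> ?H" by (simp add: hull_minimal)
  show "?H \<subseteq> hconvex hull V"
  proof
    fix z assume z: "z \<in> ?H"
    let ?C = "hconvex hull V"
    have C: "?C \<subseteq> hplane" "convex (klein ` ?C)"
      using hconvex_hconvex_hull[OF assms] by (auto simp: hconvex_iff)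
    have "convex hull (klein ` V) \<subseteq> klein ` ?C"
      by (rule hull_minimal) (use C hull_subset[of V hconvex] in auto)
    then obtain w where w: "w \<in> ?C" "klein z = klein w" using z by blast
    then have "z = w" using z C klein_inj by blast
    then show "z \<in> ?C" using w by simp
  qed
qed

section \<open>Isometries and the area of discs and sectors\<close>

lemma AE_lborel_fst_neq: "AE x in lborel. fst (x :: real \<times> real) \<noteq> k"
  and AE_lborel_snd_neq: "AE x in lborel. snd (x :: real \<times> real) \<noteq> k"
proof -
  have *: "AE x in lborel. x \<bullet> b \<noteq> k" if "b \<in> Basis" for b :: "real \<times> real"
  proof -
    have "AE x in lebesgue. x \<notin> {x. x \<bullet> b = k}"
      using negligible_standard_hyperplane[OF that] by (intro AE_not_in) (simp only: negligible_iff_null_sets)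
    then show ?thesis by (simp add: AE_completion_iff)
  qed
  show "AE x in lborel. fst (x :: real \<times> real) \<noteq> k"
    using *[of "(1,0)"] by (simp add: Basis_prod_def inner_prod_def)
  show "AE x in lborel. snd (x :: real \<times> real) \<noteq> k"
    using *[of "(0,1)"] by (simp add: Basis_prod_def inner_prod_def)
qed

lemma LINT_sinh_rectangle:
  fixes r A B :: real
  assumes "0 \<le> r" "A \<le> B"
  shows "(LINT x:{0..r} \<times> {A..B}|lborel. sinh (2 * fst x) / 2) = (B - A) * (sinh r)\<^sup>2 / 2"
proof -
  let ?f = "\<lambda>x::real\<times>real. sinh (2 * fst x) / 2"
  have box: "{0..r} \<times> {A..B} = cbox (0, A) (r, B)" unfolding cbox_Pair_eq unfolding cbox_interval ..
  have cont: "continuous_on X ?f" for X by (intro continuous_intros) auto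
  have int: "set_integrable lborel (cbox (0, A) (r, B)) ?f"
    unfolding set_integrable_def by (rule borel_integrable_compact[OF compact_cbox cont])
  have inner: "((\<lambda>x. (B - A) * (sinh (2 * x) / 2)) has_integral (B - A) * (sinh r)\<^sup>2 / 2 - (B - A) * (sinh 0)\<^sup>2 / 2) {0..r}"
    by (rule fundamental_theorem_of_calculus[OF assms(1)])
      (auto intro!: derivative_eq_intros simp: has_real_derivative_iff_has_vector_derivative[symmetric] sinh_double)
  have "(LINT x:cbox (0, A) (r, B)|lborel. ?f x) = integral (cbox (0, A) (r, B)) ?f"
    by (rule set_borel_integral_eq_integral(2)[OF int])
  also have "\<dots> = integral (cbox 0 r) (\<lambda>x. integral (cbox A B) (\<lambda>y. ?f (x, y)))"
    by (rule integral_prod_continuous[OF cont])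
  also have "\<dots> = integral {0..r} (\<lambda>x. (B - A) * (sinh (2 * x) / 2))"
    using assms by (simp add: cbox_interval)
  also have "\<dots> = (B - A) * (sinh r)\<^sup>2 / 2"
    using integral_unique[OF inner] by simp
  finally show ?thesis unfolding box .
qed

text \<open>Membership is tested only off four lines, which are null sets; so it does not matter
  which boundary points belong to \<open>D\<close>.\<close>

lemma sl2_area_sector:
  fixes r A B :: real
  assumes D: "D \<in> sets borel" and r: "0 \<le> r" and AB: "A \<le> B"
    and mem: "\<And>s \<theta>. s \<noteq> 0 \<Longrightarrow> s \<noteq> r \<Longrightarrow> \<theta> \<noteq> A \<Longrightarrow> \<theta> \<noteq> B \<Longrightarrow>
      (s, \<theta>) \<in> polar_preimage D \<longleftrightarrow> 0 \<le> s \<and> s \<le> r \<and> A \<le> \<theta> \<and> \<theta> \<le> B"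
  shows "sl2_area D = (B - A) * (sinh r)\<^sup>2 / 2"
proof -
  have [measurable]: "(\<lambda>x::real\<times>real. sinh (2 * fst x) / 2) \<in> borel_measurable borel"
    by (intro borel_measurable_continuous_onI continuous_intros) auto
  have "sl2_area D = (LINT x:polar_preimage D|lborel. sinh (2 * fst x) / 2)"
    by (simp add: sl2_area_def polar_preimage_def)
  also have "\<dots> = (LINT x:{0..r} \<times> {A..B}|lborel. sinh (2 * fst x) / 2)"
  proof (rule set_integral_cong_set)
    have [measurable]: "{0..r} \<times> {A..B} \<in> sets borel" by (rule borel_Times) auto
    have [measurable]: "polar_preimage D \<in> sets borel" using D by measurable
    show "set_borel_measurable lborel ({0..r} \<times> {A..B}) (\<lambda>x. sinh (2 * fst x) / 2)"
      "set_borel_measurable lborel (polar_preimage D) (\<lambda>x. sinh (2 * fst x) / 2)"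
      unfolding set_borel_measurable_def by measurable
    show "AE x in lborel. (x \<in> {0..r} \<times> {A..B}) = (x \<in> polar_preimage D)"
      using AE_lborel_fst_neq[of 0] AE_lborel_fst_neq[of r] AE_lborel_snd_neq[of A] AE_lborel_snd_neq[of B]
    proof eventually_elim
      case (elim x)
      then show ?case using mem[of "fst x" "snd x"] by (cases x) auto
    qed
  qed
  finally show ?thesis using LINT_sinh_rectangle[OF r AB] by simp
qed

lemma base_point_mem_cball:
  assumes "0 \<le> s" "0 \<le> r"
  shows "cmod (base_point s \<theta>) \<le> tanh r \<longleftrightarrow> s \<le> r"
  using assms by (simp add: base_point_cis norm_mult)

lemma sl2_disc_eq:
  assumes "0 \<le> r"
  shows "sl2_disc r = cball 0 (tanh r)"
proof
  show "sl2_disc r \<subseteq> cball 0 (tanh r)"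
    using assms by (auto simp: sl2_disc_def base_point_mem_cball)
  show "cball 0 (tanh r) \<subseteq> sl2_disc r"
  proof
    fix z :: complex assume z: "z \<in> cball 0 (tanh r)"
    then have "cmod z < 1" using tanh_real_lt_1[of r] by (simp add: order.strict_trans1)
    then obtain s \<theta> where s: "0 \<le> s" "z = base_point s \<theta>"
      by (meson base_point_surj hplane_iff)
    then have "s \<le> r" using z assms by (simp add: base_point_mem_cball)
    then show "z \<in> sl2_disc r" using s by (auto simp: sl2_disc_def)
  qed
qed

lemma sl2_area_disc:
  assumes "0 \<le> r"
  shows "sl2_area (sl2_disc r) = pi * (sinh r)\<^sup>2"
proof -
  have "sl2_area (sl2_disc r) = (2 * pi - 0) * (sinh r)\<^sup>2 / 2"
    by (rule sl2_area_sector) (use assms in \<open>auto simp: sl2_disc_eq polar_preimage_def base_point_mem_cball\<close>)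
  then show ?thesis by simp
qed

text \<open>Every tile will be the image of one polygon about the origin under such a map; the angle
  \<open>t\<close> decides which vertex goes where.\<close>

definition hmotion :: "complex \<Rightarrow> real \<Rightarrow> complex \<Rightarrow> complex" where
  "hmotion c t z = mob (- c) (cis t * z)"

definition hmotion_inv :: "complex \<Rightarrow> real \<Rightarrow> complex \<Rightarrow> complex" where
  "hmotion_inv c t z = cis (- t) * mob c z"

lemma cis_cancel: "cis (- t) * (cis t * z) = z" "cis t * (cis (- t) * z) = z"
  by (simp_all add: cis_mult flip: mult.assoc)

lemma cis_in_hplane: "cis t * z \<in> hplane \<longleftrightarrow> z \<in> hplane" by (simp add: hplane_iff norm_mult)

context
  fixes c :: complex
  assumes c: "c \<in> hplane"
begin

lemma uminus_c: "- c \<in> hplane" using c by (simp add: hplane_iff)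

lemma hmotion_in_hplane: "z \<in> hplane \<Longrightarrow> hmotion c t z \<in> hplane"
  by (simp add: hmotion_def mob_in_hplane uminus_c cis_in_hplane)

lemma hmotion_inv_in_hplane: "z \<in> hplane \<Longrightarrow> hmotion_inv c t z \<in> hplane"
  by (simp add: hmotion_inv_def mob_in_hplane c cis_in_hplane)

lemma hmotion_inv_hmotion: "z \<in> hplane \<Longrightarrow> hmotion_inv c t (hmotion c t z) = z"
  by (simp add: hmotion_inv_def hmotion_def mob_inverse' c cis_in_hplane cis_cancel)

lemma hmotion_hmotion_inv: "z \<in> hplane \<Longrightarrow> hmotion c t (hmotion_inv c t z) = z"
  by (simp add: hmotion_inv_def hmotion_def mob_inverse c cis_cancel)

lemma hmotion_0: "hmotion c t 0 = c"
  by (simp add: hmotion_def Moebius_function_of_zero)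

lemma hdist_hmotion: "z \<in> hplane \<Longrightarrow> w \<in> hplane \<Longrightarrow> hdist (hmotion c t z) (hmotion c t w) = hdist z w"
  by (simp add: hmotion_def hdist_mob uminus_c cis_in_hplane hdist_cis)

lemma hdist_hmotion_inv: "z \<in> hplane \<Longrightarrow> w \<in> hplane \<Longrightarrow> hdist (hmotion_inv c t z) (hmotion_inv c t w) = hdist z w"
  by (simp add: hmotion_inv_def hdist_mob c hdist_cis)

lemma inj_on_hmotion: "inj_on (hmotion c t) hplane"
  by (rule inj_on_inverseI[where g = "hmotion_inv c t"]) (rule hmotion_inv_hmotion)

text \<open>Written as a preimage under the inverse map, an image of a Borel or open set is seen to
  be Borel or open again.\<close>

lemma hmotion_image: "S \<subseteq> hplane \<Longrightarrow> hmotion c t ` S = {w \<in> hplane. hmotion_inv c t w \<in> S}"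
proof -
  assume S: "S \<subseteq> hplane"
  have "w \<in> hmotion c t ` S" if "w \<in> hplane" "hmotion_inv c t w \<in> S" for w
    using that hmotion_hmotion_inv by (metis imageI)
  then show ?thesis using S hmotion_in_hplane by (auto simp: hmotion_inv_hmotion subset_iff)
qed

lemma hmotion_inv_image: "S \<subseteq> hplane \<Longrightarrow> hmotion_inv c t ` S = {w \<in> hplane. hmotion c t w \<in> S}"
proof -
  assume S: "S \<subseteq> hplane"
  have "w \<in> hmotion_inv c t ` S" if "w \<in> hplane" "hmotion c t w \<in> S" for w
    using that hmotion_inv_hmotion by (metis imageI)
  then show ?thesis using S hmotion_inv_in_hplane by (auto simp: hmotion_hmotion_inv subset_iff)
qed

lemma hmotion_has_field_derivative:
  assumes z: "z \<in> hplane"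
  shows "(hmotion c t has_field_derivative of_real (1 - (cmod c)\<^sup>2) * cis t / (1 + cnj c * (cis t * z))\<^sup>2) (at z)"
proof -
  have nz: "1 + cnj c * (cis t * z) \<noteq> 0"
    using mob_denom[OF uminus_c, of "cis t * z"] z by (simp add: cis_in_hplane)
  have eq: "hmotion c t = (\<lambda>z. (cis t * z + c) / (1 + cnj c * (cis t * z)))"
    by (simp add: fun_eq_iff hmotion_def Moebius_function_simple)
  have cc: "of_real (1 - (cmod c)\<^sup>2) = 1 - c * cnj c"
    by (simp only: of_real_diff of_real_1 complex_norm_square)
  show ?thesis unfolding eq cc
    by (rule derivative_eq_intros refl nz | simp)+
      (use nz in \<open>simp add: field_simps power2_eq_square\<close>)
qed

text \<open>The Jacobian of the isometry cancels against the change of the density, which is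
  computed by \<open>one_minus_cmod_mob\<close>.\<close>

lemma hmotion_density:
  assumes z: "z \<in> hplane"
  shows "(cmod (of_real (1 - (cmod c)\<^sup>2) * cis t / (1 + cnj c * (cis t * z))\<^sup>2))\<^sup>2 * (4 / (1 - (cmod (hmotion c t z))\<^sup>2)\<^sup>2)
    = 4 / (1 - (cmod z)\<^sup>2)\<^sup>2"
proof -
  let ?d = "1 + cnj c * (cis t * z)"
  have nz: "?d \<noteq> 0"
    using mob_denom[OF uminus_c, of "cis t * z"] z by (simp add: cis_in_hplane)
  have cc: "1 - (cmod c)\<^sup>2 \<noteq> 0" using hplane_norm_sq[OF c] by simp
  have 1: "1 - (cmod (hmotion c t z))\<^sup>2 = (1 - (cmod c)\<^sup>2) * (1 - (cmod z)\<^sup>2) / (cmod ?d)\<^sup>2"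
    unfolding hmotion_def using one_minus_cmod_mob[OF uminus_c, of "cis t * z"] z
    by (simp add: cis_in_hplane norm_mult)
  have 2: "(cmod (of_real (1 - (cmod c)\<^sup>2) * cis t / ?d\<^sup>2))\<^sup>2 = (1 - (cmod c)\<^sup>2)\<^sup>2 / ((cmod ?d)\<^sup>2)\<^sup>2"
    by (simp only: norm_mult norm_divide norm_of_real norm_power norm_cis mult_1_right power_divide power2_abs)
  have cancel: "k\<^sup>2 / P\<^sup>2 * (4 / (k * A / P)\<^sup>2) = 4 / A\<^sup>2" if "k \<noteq> 0" "P \<noteq> 0" for k P A :: real
    using that by (simp add: divide_simps power2_eq_square)
  show ?thesis unfolding 1 2 by (rule cancel) (use cc nz in auto)
qed

lemma hmotion_image_borel:
  assumes S[measurable]: "S \<in> sets borel" and sub: "S \<subseteq> hplane"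
  shows "hmotion c t ` S \<in> sets borel"
proof -
  have "hmotion_inv c t \<in> borel_measurable borel"
    unfolding hmotion_inv_def Moebius_function_simple by measurable
  then have "hmotion_inv c t -` S \<in> sets borel" using S by (rule measurable_sets_borel)
  moreover have "hmotion c t ` S = hplane \<inter> hmotion_inv c t -` S"
    unfolding hmotion_image[OF sub] by auto
  ultimately show ?thesis by (simp add: hplane_def)
qed

lemma harea_hmotion:
  assumes S[measurable]: "S \<in> sets borel" and sub: "S \<subseteq> hplane"
  shows "harea (hmotion c t ` S) = harea S"
proof -
  let ?f = "\<lambda>z::complex. 4 / (1 - (norm z)\<^sup>2)\<^sup>2"
  let ?d = "\<lambda>z. of_real (1 - (cmod c)\<^sup>2) * cis t / (1 + cnj c * (cis t * z))\<^sup>2"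
  have [measurable]: "?f \<in> borel_measurable borel" by measurable
  have gS[measurable]: "hmotion c t ` S \<in> sets borel" by (rule hmotion_image_borel[OF assms])
  have eq: "z \<in> S \<Longrightarrow> (cmod (?d z))\<^sup>2 * ?f (hmotion c t z) = ?f z" for z
    using hmotion_density sub by blast
  have "harea (hmotion c t ` S) = (LINT z:S|lborel. (cmod (?d z))\<^sup>2 * ?f (hmotion c t z))"
    unfolding harea_def
  proof (rule LINT_conformal_image[OF S gS])
    show "set_borel_measurable borel (hmotion c t ` S) ?f"
      unfolding set_borel_measurable_def by measurable
    have "(\<lambda>z. indicator S z *\<^sub>R ((cmod (?d z))\<^sup>2 * ?f (hmotion c t z))) = (\<lambda>z. indicator S z *\<^sub>R ?f z)"
    proof
      fix z show "indicator S z *\<^sub>R ((cmod (?d z))\<^sup>2 * ?f (hmotion c t z)) = indicator S z *\<^sub>R ?f z"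
      proof (cases "z \<in> S")
        case True then show ?thesis by (simp only: eq)
      qed simp
    qed
    then show "set_borel_measurable borel S (\<lambda>z. (cmod (?d z))\<^sup>2 * ?f (hmotion c t z))"
      unfolding set_borel_measurable_def by simp
    show "inj_on (hmotion c t) S" using inj_on_hmotion sub by (rule inj_on_subset)
    show "(hmotion c t has_field_derivative ?d z) (at z within S)" if "z \<in> S" for z
      using hmotion_has_field_derivative that sub by (blast intro: has_field_derivative_at_within)
  qed
  also have "\<dots> = harea S"
    unfolding harea_def by (rule set_lebesgue_integral_cong) (use eq S in auto)
  finally show ?thesis .
qed

lemma hmotion_hdisc:
  assumes "a \<in> hplane"
  shows "hmotion c t ` hdisc a r = hdisc (hmotion c t a) r"
proof -
  have "hdisc a r \<subseteq> hplane" by (auto simp: hdisc_def)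
  moreover have "hdist (hmotion c t a) w = hdist a (hmotion_inv c t w)" if "w \<in> hplane" for w
    using hdist_hmotion hmotion_hmotion_inv hmotion_inv_in_hplane assms that by metis
  ultimately show ?thesis using hmotion_inv_in_hplane
    by (auto simp: hmotion_image hdisc_def)
qed

lemma hsegment_hmotion:
  assumes "a \<in> hplane" "b \<in> hplane"
  shows "hsegment (hmotion c t a) (hmotion c t b) = hmotion c t ` hsegment a b"
proof -
  have "hsegment a b \<subseteq> hplane" by (auto simp: hsegment_def)
  moreover have "hdist (hmotion c t a) w = hdist a (hmotion_inv c t w)"
    "hdist w (hmotion c t b) = hdist (hmotion_inv c t w) b" if "w \<in> hplane" for w
    using hdist_hmotion hmotion_hmotion_inv hmotion_inv_in_hplane assms that by metis+
  ultimately show ?thesis using hmotion_inv_in_hplane assms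
    by (auto simp: hmotion_image hsegment_def hdist_hmotion)
qed

lemma hsegment_hmotion_inv:
  assumes "a \<in> hplane" "b \<in> hplane"
  shows "hsegment (hmotion_inv c t a) (hmotion_inv c t b) = hmotion_inv c t ` hsegment a b"
proof -
  have "hsegment a b \<subseteq> hplane" by (auto simp: hsegment_def)
  moreover have "hdist (hmotion_inv c t a) w = hdist a (hmotion c t w)"
    "hdist w (hmotion_inv c t b) = hdist (hmotion c t w) b" if "w \<in> hplane" for w
    using hdist_hmotion hmotion_hmotion_inv hmotion_inv_in_hplane assms that by metis+
  ultimately show ?thesis using hmotion_in_hplane assms
    by (auto simp: hmotion_inv_image hsegment_def hdist_hmotion_inv)
qed

lemma hconvex_hmotion:
  assumes "hconvex S"
  shows "hconvex (hmotion c t ` S)"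
proof -
  have S: "S \<subseteq> hplane" and seg: "\<And>a b. a \<in> S \<Longrightarrow> b \<in> S \<Longrightarrow> hsegment a b \<subseteq> S"
    using assms by (auto simp: hconvex_def)
  have "hsegment (hmotion c t a) (hmotion c t b) \<subseteq> hmotion c t ` S" if "a \<in> S" "b \<in> S" for a b
    using that S seg by (simp only: hsegment_hmotion subsetD image_mono)
  moreover have "hmotion c t ` S \<subseteq> hplane" using S hmotion_in_hplane by blast
  ultimately show ?thesis unfolding hconvex_def by blast
qed

lemma hconvex_hmotion_inv:
  assumes "hconvex S"
  shows "hconvex (hmotion_inv c t ` S)"
proof -
  have S: "S \<subseteq> hplane" and seg: "\<And>a b. a \<in> S \<Longrightarrow> b \<in> S \<Longrightarrow> hsegment a b \<subseteq> S"
    using assms by (auto simp: hconvex_def)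
  have "hsegment (hmotion_inv c t a) (hmotion_inv c t b) \<subseteq> hmotion_inv c t ` S" if "a \<in> S" "b \<in> S" for a b
    using that S seg by (simp only: hsegment_hmotion_inv subsetD image_mono)
  moreover have "hmotion_inv c t ` S \<subseteq> hplane" using S hmotion_inv_in_hplane by blast
  ultimately show ?thesis unfolding hconvex_def by blast
qed

text \<open>Both the motion and its inverse preserve hyperbolic convexity, so minimality of the hull
  applies in both directions.\<close>

lemma hull_hmotion:
  assumes "V \<subseteq> hplane"
  shows "hconvex hull (hmotion c t ` V) = hmotion c t ` (hconvex hull V)"
proof
  show "hconvex hull (hmotion c t ` V) \<subseteq> hmotion c t ` (hconvex hull V)"
  proof (rule hull_minimal)
    show "hmotion c t ` V \<subseteq> hmotion c t ` (hconvex hull V)" by (intro image_mono hull_subset)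
    show "hconvex (hmotion c t ` (hconvex hull V))" by (rule hconvex_hmotion[OF hconvex_hconvex_hull[OF assms]])
  qed
  have V': "hmotion c t ` V \<subseteq> hplane" using assms hmotion_in_hplane by blast
  have "hconvex hull V \<subseteq> hmotion_inv c t ` (hconvex hull (hmotion c t ` V))"
  proof (rule hull_minimal)
    show "V \<subseteq> hmotion_inv c t ` (hconvex hull (hmotion c t ` V))"
    proof
      fix v assume v: "v \<in> V"
      then have "v = hmotion_inv c t (hmotion c t v)" using assms hmotion_inv_hmotion by (simp add: subset_iff)
      moreover have "hmotion c t v \<in> hconvex hull (hmotion c t ` V)" using v by (auto intro: hull_inc)
      ultimately show "v \<in> hmotion_inv c t ` (hconvex hull (hmotion c t ` V))" by blast
    qed
    show "hconvex (hmotion_inv c t ` (hconvex hull (hmotion c t ` V)))"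
      by (rule hconvex_hmotion_inv[OF hconvex_hconvex_hull[OF V']])
  qed
  then show "hmotion c t ` (hconvex hull V) \<subseteq> hconvex hull (hmotion c t ` V)"
    unfolding hmotion_inv_image[OF hull_subset_hplane[OF V']] by blast
qed

end

lemma zero_in_hplane: "0 \<in> hplane" by (simp add: hplane_iff)

lemma hdisc_0:
  assumes "0 \<le> r"
  shows "hdisc 0 r = cball 0 (tanh (r / 2))"
proof -
  have "z \<in> hdisc 0 r \<longleftrightarrow> cmod z \<le> tanh (r / 2)" for z
  proof (cases "z \<in> hplane")
    case True
    then show ?thesis using cmod_eq_tanh_hdist[OF True] by (simp add: hdisc_def)
  next
    case False
    then show ?thesis using tanh_real_lt_1[of "r / 2"] by (auto simp: hdisc_def hplane_iff)
  qed
  then show ?thesis by (intro set_eqI) (simp only: mem_cball_0)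
qed

lemma hdisc_borel:
  assumes "c \<in> hplane" "0 \<le> r"
  shows "hdisc c r \<in> sets borel" "hdisc c r \<subseteq> hplane"
proof -
  show "hdisc c r \<subseteq> hplane" by (auto simp: hdisc_def)
  have "hdisc 0 r \<subseteq> hplane" by (auto simp: hdisc_def)
  then have "hmotion c 0 ` hdisc 0 r \<in> sets borel"
    by (rule hmotion_image_borel[OF assms(1), rotated]) (simp add: hdisc_0 assms)
  then show "hdisc c r \<in> sets borel"
    using hmotion_hdisc[OF assms(1) zero_in_hplane, of 0 r] by (simp add: hmotion_0[OF assms(1)])
qed

text \<open>Moved to the origin, the disc is \<open>sl2_disc (r / 2)\<close>; the factor 4 comes
  from \<open>harea_eq_sl2_area\<close>.\<close>

lemma harea_hdisc:
  assumes c: "c \<in> hplane" and r: "0 \<le> r"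
  shows "harea (hdisc c r) = 4 * pi * (sinh (r / 2))\<^sup>2"
proof -
  have "harea (hdisc c r) = harea (hmotion c 0 ` hdisc 0 r)"
    using hmotion_hdisc[OF c zero_in_hplane, of 0 r] by (simp add: hmotion_0[OF c])
  also have "\<dots> = harea (hdisc 0 r)"
    by (rule harea_hmotion[OF c]) (use hdisc_borel zero_in_hplane r in auto)
  also have "\<dots> = 4 * sl2_area (hdisc 0 r)"
    by (rule harea_eq_sl2_area) (use hdisc_borel zero_in_hplane r in auto)
  also have "hdisc 0 r = sl2_disc (r / 2)" using r by (simp add: hdisc_0 sl2_disc_eq)
  finally show ?thesis using r by (simp add: sl2_area_disc)
qed

section \<open>Regular polygons about the origin\<close>

lemma cos_le_cos_outside:
  fixes a x :: real
  assumes "0 \<le> a" "a \<le> \<bar>x\<bar>" "\<bar>x\<bar> \<le> 2 * pi - a"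
  shows "cos x \<le> cos a"
proof -
  have "cos \<bar>x\<bar> \<le> cos a"
  proof (cases "\<bar>x\<bar> \<le> pi")
    case True then show ?thesis using assms by (intro cos_monotone_0_pi_le) auto
  next
    case False
    then have "cos (2 * pi - \<bar>x\<bar>) \<le> cos a" using assms by (intro cos_monotone_0_pi_le) auto
    then show ?thesis by (simp add: cos_diff)
  qed
  then show ?thesis by simp
qed

lemma cos_less_cos_outside:
  fixes a x :: real
  assumes "0 \<le> a" "a < \<bar>x\<bar>" "\<bar>x\<bar> < 2 * pi - a"
  shows "cos x < cos a"
proof -
  have "cos \<bar>x\<bar> < cos a"
  proof (cases "\<bar>x\<bar> \<le> pi")
    case True then show ?thesis using assms by (intro cos_monotone_0_pi) auto
  next
    case False
    then have "cos (2 * pi - \<bar>x\<bar>) < cos a" using assms by (intro cos_monotone_0_pi) auto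
    then show ?thesis by (simp add: cos_diff)
  qed
  then show ?thesis by simp
qed

lemma sum_roots_of_unity_cis:
  assumes "2 \<le> p"
  shows "(\<Sum>k<p. cis (2 * pi * real k / real p)) = 0"
proof -
  let ?w = "cis (2 * pi / real p)"
  have "?w \<noteq> 1"
  proof
    assume "?w = 1"
    then have "cos (2 * pi / real p) = 1" by (simp add: complex_eq_iff)
    moreover have "cos (2 * pi / real p) < cos 0"
      using assms by (intro cos_monotone_0_pi) (auto simp: field_simps)
    ultimately show False by simp
  qed
  moreover have "cis (2 * pi * real k / real p) = ?w ^ k" for k
    by (simp add: Complex.DeMoivre mult_ac)
  moreover have "?w ^ p = 1" using assms by (simp add: Complex.DeMoivre)
  ultimately show ?thesis using geometric_sum[of ?w p] by simp
qed

lemma cis_inner: "cis s \<bullet> cis t = cos (s - t)"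
  by (simp add: inner_complex_def cos_diff)

lemma klein_inner: "(klein z) \<bullet> w = 2 * (z \<bullet> w) / (1 + (cmod z)\<^sup>2)"
  by (simp add: klein_def)

lemma one_plus_norm_pos: "0 < 1 + (cmod z)\<^sup>2" by (simp add: add_pos_nonneg)

lemma cmod_klein: "cmod (klein z) = 2 * cmod z / (1 + (cmod z)\<^sup>2)"
  using one_plus_norm_pos[of z] by (simp add: klein_def)

text \<open>The difference of the fractions has the sign of \<open>(y - x) * (1 - x * y)\<close>.
  The function is the radial part of \<open>klein\<close>, so moduli can be compared in either
  model.\<close>

lemma half_angle_mono:
  fixes x y :: real
  assumes "0 \<le> x" "0 \<le> y" "x < 1" "y < 1"
  shows "2 * x / (1 + x\<^sup>2) \<le> 2 * y / (1 + y\<^sup>2) \<longleftrightarrow> x \<le> y"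
proof -
  have "x * y < 1" using assms by (metis mult_less_cancel_left2 mult_strict_mono' mult.right_neutral)
  then have "(y - x) * (1 - x * y) \<ge> 0 \<longleftrightarrow> x \<le> y" by (simp add: zero_le_mult_iff)
  moreover have "2 * x / (1 + x\<^sup>2) \<le> 2 * y / (1 + y\<^sup>2) \<longleftrightarrow> (y - x) * (1 - x * y) \<ge> 0"
  proof -
    have "2 * x / (1 + x\<^sup>2) \<le> 2 * y / (1 + y\<^sup>2) \<longleftrightarrow> x / (1 + x\<^sup>2) \<le> y / (1 + y\<^sup>2)"
      by (simp only: times_divide_eq_right[symmetric] mult_le_cancel_left_pos zero_less_numeral)
    also have "\<dots> \<longleftrightarrow> x * (1 + y\<^sup>2) \<le> y * (1 + x\<^sup>2)"
    proof -
      have "x / P \<le> y / Q \<longleftrightarrow> x * Q \<le> y * P" if "0 < P" "0 < Q" for P Q :: real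
        using that by (simp add: field_simps)
      then show ?thesis by (simp add: add_pos_nonneg)
    qed
    also have "\<dots> \<longleftrightarrow> (y - x) * (1 - x * y) \<ge> 0" by (simp add: algebra_simps power2_eq_square)
    finally show ?thesis .
  qed
  ultimately show ?thesis by simp
qed

text \<open>The side from vertex \<open>k\<close> to vertex \<open>k + 1\<close> lies on the circle about \<open>pmu p b * pnormal p k\<close> that is
  orthogonal to the unit circle; the factor \<open>pmu p b\<close> is determined by that circle passing through the vertices.\<close>

definition pvertex :: "nat \<Rightarrow> real \<Rightarrow> nat \<Rightarrow> complex" where
  "pvertex p b k = of_real b * cis (2 * pi * real k / real p)"

definition pnormal :: "nat \<Rightarrow> nat \<Rightarrow> complex" where
  "pnormal p k = cis (pi * (2 * real k + 1) / real p)"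

definition pmu :: "nat \<Rightarrow> real \<Rightarrow> real" where
  "pmu p b = (1 + b\<^sup>2) / (2 * b * cos (pi / real p))"

text \<open>Each inequality keeps \<open>z\<close> out of the open disc with centre
  \<open>pmu p b * pnormal p k\<close> and squared radius \<open>pmu p b ^ 2 - 1\<close>; in the
  Klein model it is a half-plane.\<close>

definition hpoly :: "nat \<Rightarrow> real \<Rightarrow> complex set" where
  "hpoly p b = {z \<in> hplane. \<forall>k<p. 2 * pmu p b * (z \<bullet> pnormal p k) \<le> 1 + (cmod z)\<^sup>2}"

text \<open>An explicit open substitute for the topological interior of
  \<open>hpoly\<close>.\<close>

definition hpoly_int :: "nat \<Rightarrow> real \<Rightarrow> complex set" where
  "hpoly_int p b = {z \<in> hplane. \<forall>k<p. 2 * pmu p b * (z \<bullet> pnormal p k) < 1 + (cmod z)\<^sup>2}"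

locale regular_polygon =
  fixes p :: nat and b :: real
  assumes p: "3 \<le> p" and b: "0 < b" "b < 1"
begin

abbreviation "\<mu> \<equiv> pmu p b"
abbreviation "\<rho> \<equiv> sqrt (\<mu>\<^sup>2 - 1)"
abbreviation "a \<equiv> pi / real p"
abbreviation "e \<equiv> pnormal p"
abbreviation "v \<equiv> pvertex p b"
text \<open>The circumradius of the polygon in the Klein model.\<close>

definition "B = 2 * b / (1 + b\<^sup>2)"

lemma a: "0 < a" "a \<le> pi / 3" "a < pi / 2"
proof -
  show "0 < a" using p by simp
  show "a \<le> pi / 3" using p by (intro divide_left_mono) auto
  then show "a < pi / 2" using pi_gt_zero by linarith
qed

lemma cos_a: "0 < cos a" "cos a < 1"
proof -
  show "0 < cos a" using a by (intro cos_gt_zero) auto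
  show "cos a < 1" using cos_monotone_0_pi[of 0 a] a by simp
qed

lemma sin_a: "0 < sin a" using a pi_gt_zero by (intro sin_gt_zero) linarith+

lemma mu: "1 < \<mu>"
proof -
  have "0 < (1 - b)\<^sup>2" using b by simp
  then have "2 * b < 1 + b\<^sup>2" by (simp add: power2_diff)
  moreover have "2 * b * cos a < 2 * b * 1" using b cos_a by (intro mult_strict_left_mono) auto
  ultimately have "2 * b * cos a < 1 + b\<^sup>2" by linarith
  then show ?thesis using b cos_a by (simp add: pmu_def)
qed

lemma rho: "0 < \<rho>" "\<rho>\<^sup>2 = \<mu>\<^sup>2 - 1" "\<rho> < \<mu>"
proof -
  have m: "1 < \<mu>\<^sup>2" using mu by (simp add: one_less_power)
  then show "0 < \<rho>" "\<rho>\<^sup>2 = \<mu>\<^sup>2 - 1" by auto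
  show "\<rho> < \<mu>" using mu by (intro real_less_lsqrt) auto
qed

text \<open>In the Klein model the polygon has circumradius \<open>B\<close> and apothem
  \<open>B * cos a\<close>; the apothem is the reciprocal of the distance \<open>\<mu>\<close> of
  the circle centres from 0.\<close>

lemma B: "0 < B" "B < 1" "B * cos a = 1 / \<mu>"
proof -
  have pos: "0 < 1 + b\<^sup>2" by (simp add: add_pos_nonneg)
  have "0 < (1 - b)\<^sup>2" using b by simp
  then show "B < 1" using pos by (simp add: B_def power2_diff)
  show "0 < B" using b pos by (simp add: B_def)
  show "B * cos a = 1 / \<mu>" by (simp add: B_def pmu_def)
qed

lemma v_in_hplane: "v k \<in> hplane" using b by (simp add: hplane_iff pvertex_def norm_mult)

lemma cmod_v: "cmod (v k) = b" using b by (simp add: pvertex_def norm_mult)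

lemma klein_v: "klein (v k) = of_real B * cis (2 * pi * real k / real p)"
  by (simp add: klein_def cmod_v B_def) (simp add: pvertex_def scaleR_conv_of_real)

text \<open>Closes the cycle: the side with index \<open>p - 1\<close> ends at \<open>v p\<close>,
  which is \<open>v 0\<close>.\<close>

lemma v_mod: "v (k mod p) = v k"
proof -
  have "2 * pi * real k / real p = 2 * pi * real (k mod p) / real p + 2 * pi * real (k div p)"
  proof -
    have "real k = real (k mod p) + real p * real (k div p)" by (metis mod_mult_div_eq of_nat_add of_nat_mult)
    then show ?thesis using p by (simp add: field_simps)
  qed
  then have "cis (2 * pi * real k / real p) = cis (2 * pi * real (k mod p) / real p) * cis (2 * pi * real (k div p))"
    by (simp only: cis_mult)
  moreover have "cis (2 * pi * real (k div p)) = 1" by (intro cis_multiple_2pi) auto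
  ultimately show ?thesis by (simp add: pvertex_def)
qed

lemma klein_v_inner: "klein (v j) \<bullet> e k = B * cos (2 * pi * real j / real p - pi * (2 * real k + 1) / real p)"
  by (simp add: klein_v pnormal_def cis_inner[symmetric] inner_complex_def) (simp add: algebra_simps)

lemma angle_eq: "2 * pi * real j / real p - pi * (2 * real k + 1) / real p = a * (2 * (real j - real k) - 1)"
  using p by (simp add: field_simps)

text \<open>The angle between vertex \<open>j\<close> and normal \<open>k\<close> is an odd multiple
  of \<open>a\<close>, hence of absolute value at least \<open>a\<close> and, by the index range, at
  most \<open>2 * pi - a\<close>.\<close>

lemma klein_v_inner_le:
  assumes "j < p" "k < p"
  shows "klein (v j) \<bullet> e k \<le> 1 / \<mu>"
proof -
  have "\<bar>2 * (int j - int k) - 1\<bar> \<ge> 1" by presburger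
  then have "real_of_int 1 \<le> real_of_int \<bar>2 * (int j - int k) - 1\<bar>" by (simp only: of_int_le_iff)
  then have 1: "\<bar>2 * (real j - real k) - 1\<bar> \<ge> 1" by simp
  have "\<bar>2 * (int j - int k) - 1\<bar> \<le> 2 * int p - 1" using assms by presburger
  then have "real_of_int \<bar>2 * (int j - int k) - 1\<bar> \<le> real_of_int (2 * int p - 1)" by (simp only: of_int_le_iff)
  then have "\<bar>2 * (real j - real k) - 1\<bar> \<le> 2 * real p - 1" by simp
  then have "a * \<bar>2 * (real j - real k) - 1\<bar> \<le> a * (2 * real p - 1)" using a by (intro mult_left_mono) auto
  also have "\<dots> = 2 * pi - a" using p by (simp add: field_simps)
  finally have "cos (a * (2 * (real j - real k) - 1)) \<le> cos a"
    using 1 a mult_left_mono[OF 1, of a] by (intro cos_le_cos_outside) (auto simp: abs_mult)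
  then have "B * cos (a * (2 * (real j - real k) - 1)) \<le> B * cos a" using B by (intro mult_left_mono) auto
  then show ?thesis unfolding klein_v_inner angle_eq B(3) .
qed

lemma klein_side:
  "klein (v k) = of_real (B * cos a) * e k - of_real (B * sin a) * (\<i> * e k)"
  "klein (v (Suc k)) = of_real (B * cos a) * e k + of_real (B * sin a) * (\<i> * e k)"
proof -
  have 1: "2 * pi * real k / real p = pi * (2 * real k + 1) / real p - a"
    "2 * pi * real (Suc k) / real p = pi * (2 * real k + 1) / real p + a"
    using p by (auto simp: field_simps)
  show "klein (v k) = of_real (B * cos a) * e k - of_real (B * sin a) * (\<i> * e k)"
    "klein (v (Suc k)) = of_real (B * cos a) * e k + of_real (B * sin a) * (\<i> * e k)"
    unfolding klein_v 1 pnormal_def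
    by (simp_all add: complex_eq_iff cos_diff sin_diff cos_add sin_add algebra_simps)
qed

lemma e_inner: "e k \<bullet> e k = 1" "(\<i> * e k) \<bullet> e k = 0" "cmod (e k) = 1"
  by (simp_all add: pnormal_def cis_inner inner_complex_def)

lemma of_real_e_inner: "(of_real x * e k) \<bullet> e k = x"
  by (simp add: e_inner flip: scaleR_conv_of_real)

lemma e_decomp: "y = of_real (y \<bullet> e k) * e k + of_real (y \<bullet> (\<i> * e k)) * (\<i> * e k)"
proof -
  have "of_real (y \<bullet> e k) * e k + of_real (y \<bullet> (\<i> * e k)) * (\<i> * e k) = y * of_real ((cmod (e k))\<^sup>2)"
    unfolding cmod_power2 by (simp add: complex_eq_iff inner_complex_def power2_eq_square algebra_simps)
  then show ?thesis by (simp add: e_inner)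
qed

lemma cmod_decomp: "(cmod y)\<^sup>2 = (y \<bullet> e k)\<^sup>2 + (y \<bullet> (\<i> * e k))\<^sup>2"
proof -
  have "(y \<bullet> e k)\<^sup>2 + (y \<bullet> (\<i> * e k))\<^sup>2 = (cmod y)\<^sup>2 * (cmod (e k))\<^sup>2"
    unfolding cmod_power2 by (simp add: inner_complex_def power2_eq_square algebra_simps)
  then show ?thesis by (simp add: e_inner)
qed

text \<open>In the orthonormal frame \<open>e k\<close>, \<open>\<i> * e k\<close> the side has
  constant first coordinate, so bounding the modulus by \<open>B\<close> bounds the second
  coordinate by \<open>B * sin a\<close>, half the side length.\<close>

lemma segment_iff:
  "y \<in> closed_segment (klein (v k)) (klein (v (Suc k))) \<longleftrightarrow> y \<bullet> e k = B * cos a \<and> cmod y \<le> B"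
proof
  assume y: "y \<in> closed_segment (klein (v k)) (klein (v (Suc k)))"
  have "cmod (klein (v k)) \<le> B" "cmod (klein (v (Suc k))) \<le> B" using B by (simp_all add: klein_v norm_mult)
  then have "closed_segment (klein (v k)) (klein (v (Suc k))) \<subseteq> cball 0 B"
    by (intro closed_segment_subset) auto
  moreover obtain u where u: "y = (1 - u) *\<^sub>R klein (v k) + u *\<^sub>R klein (v (Suc k))"
    using y unfolding closed_segment_def by blast
  have "klein (v k) \<bullet> e k = B * cos a" "klein (v (Suc k)) \<bullet> e k = B * cos a"
    unfolding klein_side[of k] by (simp_all add: inner_add_left inner_diff_left e_inner flip: scaleR_conv_of_real)
  then have "y \<bullet> e k = B * cos a" unfolding u by (simp add: inner_add_left algebra_simps)
  ultimately show "y \<bullet> e k = B * cos a \<and> cmod y \<le> B" using y by auto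
next
  assume y: "y \<bullet> e k = B * cos a \<and> cmod y \<le> B"
  define t where "t = y \<bullet> (\<i> * e k)"
  have "(cmod y)\<^sup>2 \<le> B\<^sup>2" using y by (intro power_mono) auto
  then have "t\<^sup>2 \<le> B\<^sup>2 * (1 - (cos a)\<^sup>2)" using cmod_decomp[of y k] y by (simp add: t_def power_mult_distrib algebra_simps)
  then have "t\<^sup>2 \<le> (B * sin a)\<^sup>2" by (simp add: power_mult_distrib sin_squared_eq)
  then have t: "\<bar>t\<bar> \<le> B * sin a" using B sin_a by (simp add: abs_le_square_iff[symmetric])
  have Bs: "0 < B * sin a" using B sin_a by simp
  \<comment> \<open>The second coordinate, between \<open>- (B * sin a)\<close> and
    \<open>B * sin a\<close>, is rescaled to the unit interval.\<close>
  define u where "u = (t / (B * sin a) + 1) / 2"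
  have "-1 \<le> t / (B * sin a)" "t / (B * sin a) \<le> 1"
    using t Bs by (simp_all add: pos_le_divide_eq pos_divide_le_eq abs_le_iff del: zero_less_mult_iff)
  then have u: "0 \<le> u" "u \<le> 1" by (auto simp: u_def)
  have ut: "(2 * u - 1) * (B * sin a) = t"
  proof -
    have "2 * ((x + 1) / 2) - 1 = x" for x :: real by (simp add: add_divide_distrib)
    then have "2 * u - 1 = t / (B * sin a)" unfolding u_def .
    moreover have "t / K * K = t" if "0 < K" for K using that by simp
    ultimately show ?thesis using Bs by metis
  qed
  have "(1 - u) *\<^sub>R klein (v k) + u *\<^sub>R klein (v (Suc k)) =
      of_real (B * cos a) * e k + of_real ((2 * u - 1) * (B * sin a)) * (\<i> * e k)"
    unfolding klein_side[of k] by (simp add: scaleR_conv_of_real algebra_simps)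
  also have "\<dots> = y" unfolding ut using e_decomp[of y k] y by (simp add: t_def)
  finally show "y \<in> closed_segment (klein (v k)) (klein (v (Suc k)))"
    using u unfolding closed_segment_def by (auto intro!: exI[of _ u])
qed

section \<open>The polygon as a hull and as an intersection of half-planes\<close>

definition "V = v ` {..<p}"

lemma v_in_V: "v k \<in> V"
  using v_mod[of k] p unfolding V_def by (metis imageI lessThan_iff mod_less_divisor gr0I not_numeral_le_zero)

lemma V_in_hplane: "V \<subseteq> hplane" using v_in_hplane by (auto simp: V_def)

text \<open>The origin is the centroid of the vertices.\<close>

lemma zero_in_hull: "0 \<in> convex hull (klein ` V)"
proof -
  have "(\<Sum>k<p. (1 / real p) *\<^sub>R klein (v k)) \<in> convex hull (klein ` V)"
    using p by (intro convex_sum convex_convex_hull) (auto intro!: hull_inc simp: v_in_V)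
  moreover have "(\<Sum>k<p. (1 / real p) *\<^sub>R klein (v k)) = 0"
    using sum_roots_of_unity_cis[of p] p unfolding klein_v
    by (simp flip: scaleR_sum_right sum_distrib_left)
  ultimately show ?thesis by simp
qed

lemma halfplane_iff: "2 * \<mu> * (z \<bullet> w) \<le> 1 + (cmod z)\<^sup>2 \<longleftrightarrow> klein z \<bullet> w \<le> B * cos a"
  "2 * \<mu> * (z \<bullet> w) < 1 + (cmod z)\<^sup>2 \<longleftrightarrow> klein z \<bullet> w < B * cos a"
  "2 * \<mu> * (z \<bullet> w) = 1 + (cmod z)\<^sup>2 \<longleftrightarrow> klein z \<bullet> w = B * cos a"
  unfolding klein_inner B(3) using one_plus_norm_pos[of z] mu by (auto simp: field_simps)

text \<open>For the converse inclusion, the Klein image lies in the angular sector between two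
  consecutive vertices; there the one inequality with normal \<open>e k\<close> bounds the sum of
  the two coefficients by 1.\<close>

lemma hull_V: "hconvex hull V = hpoly p b"
proof -
  have "klein z \<in> convex hull (klein ` V) \<longleftrightarrow> (\<forall>k<p. klein z \<bullet> e k \<le> B * cos a)" for z
  proof
    assume z: "klein z \<in> convex hull (klein ` V)"
    show "\<forall>k<p. klein z \<bullet> e k \<le> B * cos a"
    proof (intro allI impI)
      fix k assume k: "k < p"
      have "convex hull (klein ` V) \<subseteq> {y. e k \<bullet> y \<le> B * cos a}"
        using klein_v_inner_le[OF _ k] by (intro hull_minimal convex_halfspace_le) (auto simp: V_def inner_commute B(3))
      then show "klein z \<bullet> e k \<le> B * cos a" using z by (auto simp: inner_commute)
    qed
  next
    assume h: "\<forall>k<p. klein z \<bullet> e k \<le> B * cos a"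
    define y where "y = klein z"
    define \<theta> where "\<theta> = Arg2pi y"
    define d where "d = 2 * pi / real p"
    have d: "0 < d" "d < pi" "d = 2 * a" using a p by (auto simp: d_def field_simps)
    have th: "0 \<le> \<theta>" "\<theta> < 2 * pi" and y: "y = of_real (cmod y) * cis \<theta>"
      using Arg2pi[of y] Arg2pi_eq[of y] unfolding \<theta>_def cis_conv_exp by auto
    define k where "k = nat \<lfloor>\<theta> / d\<rfloor>"
    have "0 \<le> \<theta> / d" using th d by simp
    then have k1: "real k \<le> \<theta> / d" "\<theta> / d < real k + 1" unfolding k_def by linarith+
    have "\<theta> / d < real p" using th p by (simp add: d_def field_simps)
    then have kp: "k < p" using k1 by linarith
    have k2: "d * real k \<le> \<theta>" "\<theta> < d * (real k + 1)"
      using k1 d(1) by (simp_all add: pos_le_divide_eq pos_divide_less_eq mult.commute)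
    have sd: "0 < sin d" using d by (intro sin_gt_zero) auto
    \<comment> \<open>Cramer's rule for \<open>y\<close> in the basis \<open>klein (v k)\<close>,
      \<open>klein (v (Suc k))\<close>; the sines are determinants of pairs of unit vectors.\<close>
    define s t where "s = cmod y * sin (d * (real k + 1) - \<theta>) / (B * sin d)"
      and "t = cmod y * sin (\<theta> - d * real k) / (B * sin d)"
    have dk: "d * (real k + 1) = d * real k + d" by (simp add: algebra_simps)
    have "0 \<le> sin (d * (real k + 1) - \<theta>)" "0 \<le> sin (\<theta> - d * real k)"
      using k2 d(1,2) dk by (intro sin_ge_zero; linarith)+
    then have st: "0 \<le> s" "0 \<le> t" using B sd by (auto simp: s_def t_def)
    have w: "klein (v k) = of_real B * cis (d * real k)" "klein (v (Suc k)) = of_real B * cis (d * (real k + 1))"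
      unfolding klein_v by (simp_all add: d_def mult.commute add.commute)
    have id: "of_real (sin (d * (real k + 1) - \<theta>)) * cis (d * real k) + of_real (sin (\<theta> - d * real k)) * cis (d * (real k + 1))
        = of_real (sin d) * cis \<theta>"
    proof -
      define x where "x = d * real k"
      have 1: "d * (real k + 1) = x + d" by (simp add: x_def algebra_simps)
      have xx: "cos x * cos x + sin x * sin x = 1" using sin_cos_squared_add2[of x] by (simp add: power2_eq_square)
      have "sin (x + d - \<theta>) * cos x + sin (\<theta> - x) * cos (x + d) = sin d * cos \<theta>"
        "sin (x + d - \<theta>) * sin x + sin (\<theta> - x) * sin (x + d) = sin d * sin \<theta>"
        unfolding sin_diff cos_add sin_add using xx by algebra+
      then show ?thesis unfolding 1 x_def[symmetric] by (simp add: complex_eq_iff)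
    qed
    have comb: "y = s *\<^sub>R klein (v k) + t *\<^sub>R klein (v (Suc k))"
    proof -
      have "s *\<^sub>R klein (v k) + t *\<^sub>R klein (v (Suc k)) = of_real (cmod y / sin d) *
        (of_real (sin (d * (real k + 1) - \<theta>)) * cis (d * real k) + of_real (sin (\<theta> - d * real k)) * cis (d * (real k + 1)))"
        using B sd unfolding w s_def t_def by (simp add: scaleR_conv_of_real field_simps)
      also have "\<dots> = of_real (cmod y) * cis \<theta>" unfolding id using sd by simp
      finally show ?thesis using y by simp
    qed
    have "klein (v k) \<bullet> e k = B * cos a" "klein (v (Suc k)) \<bullet> e k = B * cos a"
      using segment_iff ends_in_segment by blast+
    then have "y \<bullet> e k = (s + t) * (B * cos a)" unfolding comb by (simp add: inner_add_left algebra_simps)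
    moreover have "y \<bullet> e k \<le> B * cos a" using h kp by (simp add: y_def)
    ultimately have "(s + t) * (B * cos a) \<le> 1 * (B * cos a)" by simp
    moreover have "0 < B * cos a" using B(1) cos_a by (intro mult_pos_pos)
    ultimately have le: "s + t \<le> 1" by (rule mult_right_le_imp_le)
    have in_hull: "klein (v j) \<in> convex hull (klein ` V)" for j by (intro hull_inc imageI v_in_V)
    have "y \<in> convex hull (klein ` V)"
    proof (cases "s + t = 0")
      case True
      then have "s = 0" "t = 0" using st by auto
      then show ?thesis using comb zero_in_hull by simp
    next
      case False
      \<comment> \<open>A point on the side is scaled by \<open>s + t\<close>, and the remaining
        weight \<open>1 - (s + t)\<close> goes to the origin.\<close>
      have "(s / (s + t)) *\<^sub>R klein (v k) + (t / (s + t)) *\<^sub>R klein (v (Suc k)) \<in> convex hull (klein ` V)"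
        using in_hull st False by (intro convexD[OF convex_convex_hull]) (auto simp flip: add_divide_distrib)
      then have "(s + t) *\<^sub>R ((s / (s + t)) *\<^sub>R klein (v k) + (t / (s + t)) *\<^sub>R klein (v (Suc k))) + (1 - (s + t)) *\<^sub>R 0
          \<in> convex hull (klein ` V)"
        by (rule convexD[OF convex_convex_hull _ zero_in_hull]) (use st le in auto)
      then show ?thesis using comb False by (simp add: scaleR_add_right)
    qed
    then show "klein z \<in> convex hull (klein ` V)" by (simp add: y_def)
  qed
  then show ?thesis unfolding klein_hull[OF V_in_hplane] hpoly_def by (auto simp: halfplane_iff)
qed

text \<open>Keeps the polygon away from the unit circle, which makes it compact although
  \<open>hplane\<close> is open.\<close>

lemma hpoly_subset_cball: "hpoly p b \<subseteq> cball 0 b"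
proof
  fix z assume z: "z \<in> hpoly p b"
  then have zh: "z \<in> hplane" by (simp add: hpoly_def)
  have "klein z \<in> convex hull (klein ` V)"
    using z unfolding hull_V[symmetric] klein_hull[OF V_in_hplane] by simp
  moreover have "convex hull (klein ` V) \<subseteq> cball 0 B"
    using B by (intro hull_minimal) (auto simp: V_def klein_v norm_mult)
  ultimately have "cmod (klein z) \<le> B" by auto
  then show "z \<in> cball 0 b" using zh b by (simp add: cmod_klein B_def half_angle_mono hplane_iff)
qed

section \<open>Sides as circular arcs and the region they bound\<close>

lemma hsegment_side_iff:
  "z \<in> hsegment (v k) (v (Suc k)) \<longleftrightarrow> cmod z \<le> b \<and> 2 * \<mu> * (z \<bullet> e k) = 1 + (cmod z)\<^sup>2"
proof -
  have "z \<in> hsegment (v k) (v (Suc k)) \<longleftrightarrow> z \<in> hplane \<and> 2 * \<mu> * (z \<bullet> e k) = 1 + (cmod z)\<^sup>2 \<and> cmod (klein z) \<le> B"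
    unfolding hsegment_klein[OF v_in_hplane v_in_hplane] segment_iff halfplane_iff by simp
  moreover have "cmod (klein z) \<le> B \<longleftrightarrow> cmod z \<le> b" if "z \<in> hplane"
    using that b by (simp add: cmod_klein B_def half_angle_mono hplane_iff)
  moreover have "z \<in> hplane" if "cmod z \<le> b" using that b by (simp add: hplane_iff)
  ultimately show ?thesis by blast
qed

text \<open>Expand the squared distance and use \<open>\<rho>^2 = \<mu>^2 - 1\<close>, the condition
  for orthogonality to the unit circle.\<close>

lemma circle_iff: "dist (of_real \<mu> * e k) z = \<rho> \<longleftrightarrow> 2 * \<mu> * (z \<bullet> e k) = 1 + (cmod z)\<^sup>2"
proof -
  have "(dist (of_real \<mu> * e k) z)\<^sup>2 = \<mu>\<^sup>2 + (cmod z)\<^sup>2 - 2 * \<mu> * (z \<bullet> e k)"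
  proof -
    have "(dist (of_real \<mu> * e k) z)\<^sup>2 = (\<mu> *\<^sub>R e k - z) \<bullet> (\<mu> *\<^sub>R e k - z)"
      by (simp only: dist_norm power2_norm_eq_inner scaleR_conv_of_real)
    also have "\<dots> = \<mu> * \<mu> + z \<bullet> z - 2 * \<mu> * (z \<bullet> e k)"
      by (simp add: inner_diff inner_commute e_inner)
    finally show ?thesis by (simp only: power2_norm_eq_inner power2_eq_square[of \<mu>])
  qed
  moreover have "dist (of_real \<mu> * e k) z = \<rho> \<longleftrightarrow> (dist (of_real \<mu> * e k) z)\<^sup>2 = \<rho>\<^sup>2"
    by (rule power2_eq_iff_nonneg[symmetric]) (use rho(1) in auto)
  ultimately show ?thesis unfolding rho(2) by auto
qed

text \<open>On this circle \<open>cmod z ^ 2\<close> is an increasing affine function of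
  \<open>z \<bullet> e k\<close>, and the value \<open>b * cos a\<close> corresponds to modulus
  \<open>b\<close>. The chord condition of \<open>side_curve\<close> thus becomes a bound on the
  modulus.\<close>

lemma cap_iff:
  assumes "2 * \<mu> * (z \<bullet> e k) = 1 + (cmod z)\<^sup>2"
  shows "z \<bullet> e k \<le> b * cos a \<longleftrightarrow> cmod z \<le> b"
proof -
  have h: "2 * \<mu> * (b * cos a) = 1 + b\<^sup>2" using b cos_a by (simp add: pmu_def)
  have "z \<bullet> e k \<le> b * cos a \<longleftrightarrow> 2 * \<mu> * (z \<bullet> e k) \<le> 2 * \<mu> * (b * cos a)" using mu by simp
  also have "\<dots> \<longleftrightarrow> (cmod z)\<^sup>2 \<le> b\<^sup>2" unfolding h assms by simp
  also have "\<dots> \<longleftrightarrow> cmod z \<le> b" using b by (simp add: abs_le_square_iff[symmetric])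
  finally show ?thesis .
qed

lemma arc_eq_hsegment:
  "{z. dist (of_real \<mu> * e k) z = \<rho> \<and> z \<bullet> e k \<le> b * cos a} = hsegment (v k) (v (Suc k))"
  unfolding set_eq_iff mem_Collect_eq circle_iff hsegment_side_iff using cap_iff by blast

lemma hsegment_subset_hpoly: "hsegment (v k) (v (Suc k)) \<subseteq> hpoly p b"
  using hconvex_hconvex_hull[OF V_in_hplane] v_in_V hull_inc[of _ V hconvex]
  unfolding hull_V[symmetric] hconvex_def by blast

lemma hpoly_boundary: "hpoly p b - hpoly_int p b = (\<Union>k<p. hsegment (v k) (v (Suc k)))"
proof
  show "hpoly p b - hpoly_int p b \<subseteq> (\<Union>k<p. hsegment (v k) (v (Suc k)))"
  proof
    fix z assume z: "z \<in> hpoly p b - hpoly_int p b"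
    then obtain k where k: "k < p" "\<not> 2 * \<mu> * (z \<bullet> e k) < 1 + (cmod z)\<^sup>2"
      by (auto simp: hpoly_def hpoly_int_def)
    moreover have "2 * \<mu> * (z \<bullet> e k) \<le> 1 + (cmod z)\<^sup>2" using z k by (simp add: hpoly_def)
    ultimately have "2 * \<mu> * (z \<bullet> e k) = 1 + (cmod z)\<^sup>2" by linarith
    moreover have "cmod z \<le> b" using z hpoly_subset_cball by auto
    ultimately show "z \<in> (\<Union>k<p. hsegment (v k) (v (Suc k)))" using k by (auto simp: hsegment_side_iff)
  qed
  show "(\<Union>k<p. hsegment (v k) (v (Suc k))) \<subseteq> hpoly p b - hpoly_int p b"
    using hsegment_subset_hpoly by (force simp: hsegment_side_iff hpoly_int_def)
qed

lemma hpoly_int_subset: "hpoly_int p b \<subseteq> hpoly p b"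
  by (auto simp: hpoly_def hpoly_int_def less_imp_le)

lemma closed_hpoly: "closed (hpoly p b)"
proof -
  have "hpoly p b = cball 0 b \<inter> (\<Inter>k\<in>{..<p}. {z. 2 * \<mu> * (z \<bullet> e k) \<le> 1 + (cmod z)\<^sup>2})"
    using hpoly_subset_cball b by (auto simp: hpoly_def hplane_iff)
  moreover have "closed (cball 0 b \<inter> (\<Inter>k\<in>{..<p}. {z. 2 * \<mu> * (z \<bullet> e k) \<le> 1 + (cmod z)\<^sup>2}))"
    by (intro closed_Int closed_INT ballI closed_Collect_le continuous_intros closed_cball)
  ultimately show ?thesis by simp
qed

lemma compact_hpoly: "compact (hpoly p b)"
  using closed_hpoly hpoly_subset_cball compact_eq_bounded_closed bounded_subset[OF bounded_cball] by blast

lemma open_hpoly_int: "open (hpoly_int p b)"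
proof -
  have "hpoly_int p b = ball 0 1 \<inter> (\<Inter>k\<in>{..<p}. {z. 2 * \<mu> * (z \<bullet> e k) < 1 + (cmod z)\<^sup>2})"
    by (auto simp: hpoly_int_def hplane_iff)
  moreover have "open (ball 0 1 \<inter> (\<Inter>k\<in>{..<p}. {z. 2 * \<mu> * (z \<bullet> e k) < 1 + (cmod z)\<^sup>2}))"
    by (intro open_Int open_INT ballI open_Collect_less continuous_intros open_ball) auto
  ultimately show ?thesis by simp
qed

lemma zero_in_hpoly_int: "0 \<in> hpoly_int p b"
  by (simp add: hpoly_int_def zero_in_hplane)

text \<open>The sides curve inwards, so the region is not convex in the Euclidean sense; it is
  star-shaped about 0.\<close>

lemma connected_hpoly_int: "connected (hpoly_int p b)"
proof (rule starlike_imp_connected)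
  show "starlike (hpoly_int p b)" unfolding starlike_def
  proof (intro bexI[OF _ zero_in_hpoly_int] ballI subsetI)
    fix z w assume z: "z \<in> hpoly_int p b" and "w \<in> closed_segment 0 z"
    then obtain s where s: "0 \<le> s" "s \<le> 1" and w: "w = s *\<^sub>R z" by (auto simp: closed_segment_def)
    have zz: "cmod z < 1" using z by (simp add: hpoly_int_def hplane_iff)
    then have x: "(cmod z)\<^sup>2 < 1" by (simp add: power_less_one_iff)
    have "cmod w \<le> cmod z" using s by (simp add: w mult_left_le_one_le)
    moreover have "2 * \<mu> * (w \<bullet> e k) < 1 + (cmod w)\<^sup>2" if "k < p" for k
    proof -
      have l: "2 * \<mu> * (z \<bullet> e k) < 1 + (cmod z)\<^sup>2" using z that by (simp add: hpoly_int_def)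
      have "s * (cmod z)\<^sup>2 \<le> 1 * (cmod z)\<^sup>2" using s by (intro mult_right_mono) auto
      then have sx: "s * (cmod z)\<^sup>2 < 1" using x by linarith
      \<comment> \<open>Expanding this product shows that scaling by \<open>s\<close> preserves the
        inequalities; \<open>s = 0\<close> is treated apart because multiplying by it loses
        strictness.\<close>
      then have "0 \<le> (1 - s) * (1 - s * (cmod z)\<^sup>2)" using s by simp
      then have 1: "s * (1 + (cmod z)\<^sup>2) \<le> 1 + s\<^sup>2 * (cmod z)\<^sup>2" by (simp add: algebra_simps power2_eq_square)
      show ?thesis
      proof (cases "s = 0")
        case False
        then have "s * (2 * \<mu> * (z \<bullet> e k)) < s * (1 + (cmod z)\<^sup>2)" using l s by (intro mult_strict_left_mono) auto
        then show ?thesis using 1 s by (simp add: w power_mult_distrib algebra_simps)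
      qed (simp add: w)
    qed
    ultimately show "w \<in> hpoly_int p b" using zz by (auto simp: hpoly_int_def hplane_iff)
  qed
qed

text \<open>\<open>hpoly_int p b\<close> is connected and avoids the sides; a larger component would
  meet its frontier, which is contained in the sides.\<close>

lemma component_Un_boundary:
  "connected_component_set (- (\<Union>k<p. hsegment (v k) (v (Suc k)))) 0 \<union> (\<Union>k<p. hsegment (v k) (v (Suc k))) = hpoly p b"
proof -
  let ?S = "\<Union>k<p. hsegment (v k) (v (Suc k))"
  let ?C = "connected_component_set (- ?S) 0"
  have S: "?S = hpoly p b - hpoly_int p b" by (rule hpoly_boundary[symmetric])
  have "hpoly_int p b \<subseteq> ?C"
    by (rule connected_component_maximal[OF zero_in_hpoly_int connected_hpoly_int]) (auto simp: S)
  moreover have "?C \<subseteq> hpoly_int p b"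
  proof (rule ccontr)
    assume "\<not> ?C \<subseteq> hpoly_int p b"
    moreover have "?C \<inter> hpoly_int p b \<noteq> {}" using zero_in_hpoly_int \<open>hpoly_int p b \<subseteq> ?C\<close> by blast
    ultimately have "?C \<inter> frontier (hpoly_int p b) \<noteq> {}"
      by (intro connected_Int_frontier) auto
    moreover have "frontier (hpoly_int p b) \<subseteq> ?S"
      unfolding S frontier_def interior_open[OF open_hpoly_int]
      using closure_minimal[OF hpoly_int_subset closed_hpoly] by blast
    moreover have "?C \<subseteq> - ?S" by (rule connected_component_subset)
    ultimately show False by blast
  qed
  ultimately show ?thesis unfolding S using hpoly_int_subset by blast
qed

lemma negligible_hpoly_boundary: "negligible (hpoly p b - hpoly_int p b)"
proof -
  have "hpoly p b - hpoly_int p b \<subseteq> (\<Union>k\<in>{..<p}. sphere (of_real \<mu> * e k) \<rho>)"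
    unfolding hpoly_boundary arc_eq_hsegment[symmetric] by auto
  moreover have "negligible (\<Union>k\<in>{..<p}. sphere (of_real \<mu> * e k) \<rho>)"
    by (intro negligible_Union) (auto intro: negligible_sphere)
  ultimately show ?thesis using negligible_subset by blast
qed

text \<open>The point of the circle nearest to 0 lies on the ray to its centre. Since
  \<open>(\<mu> - \<rho>) * (\<mu> + \<rho>) = 1\<close> it is inside the unit disc, and in the
  Klein model it is the midpoint of the side.\<close>

lemma inradius:
  "0 < \<mu> - \<rho>" "\<mu> - \<rho> < 1"
  "of_real (\<mu> - \<rho>) * e k \<in> hsegment (v k) (v (Suc k))"
  "cmod (of_real (\<mu> - \<rho>) * e k) = \<mu> - \<rho>"
  "z \<in> hsegment (v k) (v (Suc k)) \<Longrightarrow> \<mu> - \<rho> \<le> cmod z"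
proof -
  show 0: "0 < \<mu> - \<rho>" using rho by simp
  have prod: "(\<mu> - \<rho>) * (\<mu> + \<rho>) = 1" using rho(2) by (simp add: algebra_simps power2_eq_square)
  have "1 < \<mu> + \<rho>" using mu rho by linarith
  then have "(\<mu> - \<rho>) * 1 < (\<mu> - \<rho>) * (\<mu> + \<rho>)" using 0 by (intro mult_strict_left_mono)
  then show lt: "\<mu> - \<rho> < 1" using prod by simp
  show n: "cmod (of_real (\<mu> - \<rho>) * e k) = \<mu> - \<rho>" using 0 by (simp add: norm_mult e_inner del: of_real_diff)
  have eq: "2 * \<mu> * ((of_real (\<mu> - \<rho>) * e k) \<bullet> e k) = 1 + (cmod (of_real (\<mu> - \<rho>) * e k))\<^sup>2"
    unfolding n of_real_e_inner using rho(2) by (simp add: power2_diff algebra_simps power2_eq_square)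
  have "klein (of_real (\<mu> - \<rho>) * e k) = of_real (B * cos a) * e k"
  proof -
    have "2 * \<mu> * (\<mu> - \<rho>) = 1 + (\<mu> - \<rho>)\<^sup>2" using rho(2) by (simp add: power2_diff algebra_simps power2_eq_square)
    moreover have div: "2 / (1 + x\<^sup>2) * x = 1 / m" if "2 * m * x = 1 + x\<^sup>2" "0 < m" for m x :: real
    proof -
      have "0 < 1 + x\<^sup>2" by (simp add: add_pos_nonneg)
      then show ?thesis using that by (simp add: divide_simps mult.commute mult.left_commute)
    qed
    ultimately have "2 / (1 + (\<mu> - \<rho>)\<^sup>2) * (\<mu> - \<rho>) = 1 / \<mu>"
      by (intro div) (use mu in auto)
    moreover have "klein (of_real (\<mu> - \<rho>) * e k) = of_real (2 / (1 + (\<mu> - \<rho>)\<^sup>2) * (\<mu> - \<rho>)) * e k"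
      unfolding klein_def n by (simp only: scaleR_conv_of_real of_real_mult mult.assoc)
    ultimately show ?thesis unfolding B(3) by (simp only:)
  qed
  then have "cmod (klein (of_real (\<mu> - \<rho>) * e k)) \<le> B"
    using B(1) cos_a mult_left_mono[of "cos a" 1 B] by (simp add: norm_mult e_inner)
  moreover have "of_real (\<mu> - \<rho>) * e k \<in> hplane" using n lt by (simp add: hplane_iff)
  ultimately show "of_real (\<mu> - \<rho>) * e k \<in> hsegment (v k) (v (Suc k))"
    unfolding hsegment_klein[OF v_in_hplane v_in_hplane] segment_iff using eq halfplane_iff(3) by blast
  assume z: "z \<in> hsegment (v k) (v (Suc k))"
  have "\<mu> - cmod z \<le> dist (of_real \<mu> * e k) z"
    using norm_triangle_ineq2[of "of_real \<mu> * e k" z] mu by (simp add: dist_norm norm_mult e_inner)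
  also have "\<dots> = \<rho>" using z unfolding arc_eq_hsegment[symmetric] by simp
  finally show "\<mu> - \<rho> \<le> cmod z" by simp
qed

end

section \<open>The angle of a tile\<close>

text \<open>Below a right angle this compares \<open>tan\<close> with \<open>T\<close>; beyond it
  the cosine is not positive and both sides are false.\<close>

lemma abs_sin_less_iff:
  fixes \<psi> T :: real
  assumes T: "0 < T" and psi: "\<bar>\<psi>\<bar> \<le> pi"
  shows "\<bar>sin \<psi>\<bar> < cos \<psi> * T \<longleftrightarrow> \<bar>\<psi>\<bar> < arctan T"
proof -
  have eq: "\<bar>sin \<psi>\<bar> < cos \<psi> * T \<longleftrightarrow> \<bar>\<psi>\<bar> < arctan T" if c: "\<bar>\<psi>\<bar> < pi / 2"
  proof -
    have cos: "0 < cos \<psi>" using c by (intro cos_gt_zero_pi) auto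
    have "\<bar>sin \<psi>\<bar> = sin \<bar>\<psi>\<bar>"
      using c sin_ge_zero[of "\<bar>\<psi>\<bar>"] psi by (cases "0 \<le> \<psi>") auto
    also have "\<dots> = cos \<psi> * tan \<bar>\<psi>\<bar>" using cos by (simp add: tan_def)
    finally have "\<bar>sin \<psi>\<bar> < cos \<psi> * T \<longleftrightarrow> tan \<bar>\<psi>\<bar> < T" using cos by simp
    also have "\<dots> \<longleftrightarrow> arctan (tan \<bar>\<psi>\<bar>) < arctan T" by (simp only: arctan_less_iff)
    also have "arctan (tan \<bar>\<psi>\<bar>) = \<bar>\<psi>\<bar>" using c by (intro arctan_tan) auto
    finally show ?thesis .
  qed
  show ?thesis
  proof (cases "\<bar>\<psi>\<bar> < pi / 2")
    case False
    then have "cos \<bar>\<psi>\<bar> \<le> cos (pi / 2)" using psi by (intro cos_monotone_0_pi_le) auto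
    then have "cos \<psi> \<le> 0" by simp
    then have "cos \<psi> * T \<le> 0" using T by (simp add: mult_nonpos_nonneg)
    then have "\<not> \<bar>sin \<psi>\<bar> < cos \<psi> * T" using abs_ge_zero[of "sin \<psi>"] by linarith
    moreover have "\<not> \<bar>\<psi>\<bar> < arctan T" using False arctan_ubound[of T] by linarith
    ultimately show ?thesis by simp
  qed (rule eq)
qed

text \<open>The sector opens around the negative real axis because a polygon about 0 lies to the
  left of its vertex \<open>b\<close>; this also keeps its angles away from the cut at 0 and
  \<open>2 * pi\<close>.\<close>

lemma harea_sector:
  assumes T: "0 < T" and e: "0 \<le> \<epsilon>"
  defines "K \<equiv> {w \<in> hdisc 0 \<epsilon>. \<bar>Im w\<bar> < - Re w * T}"
  shows "K \<in> sets borel" "K \<subseteq> hplane" "harea K = 4 * arctan T * (sinh (\<epsilon> / 2))\<^sup>2"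
proof -
  have "K = cball 0 (tanh (\<epsilon> / 2)) \<inter> {w. \<bar>Im w\<bar> < - Re w * T}"
    using e by (auto simp: K_def hdisc_0)
  moreover have "{w. \<bar>Im w\<bar> < - Re w * T} \<in> sets borel"
    by (intro borel_open open_Collect_less continuous_intros)
  ultimately show K: "K \<in> sets borel" by simp
  show sub: "K \<subseteq> hplane" by (auto simp: K_def hdisc_def)
  let ?\<alpha> = "arctan T"
  have al: "0 < ?\<alpha>" "?\<alpha> < pi / 2" using T arctan_ubound[of T] by auto
  have "sl2_area K = (pi + ?\<alpha> - (pi - ?\<alpha>)) * (sinh (\<epsilon> / 2))\<^sup>2 / 2"
  proof (rule sl2_area_sector[OF K])
    fix s \<theta> :: real
    assume ne: "s \<noteq> 0" "s \<noteq> \<epsilon> / 2" "\<theta> \<noteq> pi - ?\<alpha>" "\<theta> \<noteq> pi + ?\<alpha>"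
    show "(s, \<theta>) \<in> polar_preimage K \<longleftrightarrow> 0 \<le> s \<and> s \<le> \<epsilon> / 2 \<and> pi - ?\<alpha> \<le> \<theta> \<and> \<theta> \<le> pi + ?\<alpha>"
    proof (cases "0 < s \<and> 0 \<le> \<theta> \<and> \<theta> < 2 * pi")
      case True
      then have t: "0 < tanh s" by simp
      have "\<bar>Im (base_point s \<theta>)\<bar> < - Re (base_point s \<theta>) * T \<longleftrightarrow> tanh s * \<bar>sin \<theta>\<bar> < tanh s * (- cos \<theta> * T)"
        using t by (simp add: base_point_def abs_mult mult.assoc)
      also have "\<dots> \<longleftrightarrow> \<bar>sin \<theta>\<bar> < - cos \<theta> * T" using t by (simp only: mult_less_cancel_left_pos)
      also have "\<dots> \<longleftrightarrow> \<bar>sin (\<theta> - pi)\<bar> < cos (\<theta> - pi) * T" by (simp add: sin_diff cos_diff)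
      also have "\<dots> \<longleftrightarrow> \<bar>\<theta> - pi\<bar> < ?\<alpha>" using T True by (intro abs_sin_less_iff) auto
      also have "\<dots> \<longleftrightarrow> pi - ?\<alpha> \<le> \<theta> \<and> \<theta> \<le> pi + ?\<alpha>" using ne by auto
      finally have "\<bar>Im (base_point s \<theta>)\<bar> < - Re (base_point s \<theta>) * T \<longleftrightarrow> pi - ?\<alpha> \<le> \<theta> \<and> \<theta> \<le> pi + ?\<alpha>" .
      moreover have "base_point s \<theta> \<in> hdisc 0 \<epsilon> \<longleftrightarrow> s \<le> \<epsilon> / 2"
        using True e by (simp add: hdisc_0 base_point_mem_cball)
      ultimately show ?thesis using True unfolding polar_preimage_def K_def by auto
    next
      case False
      then show ?thesis using ne al unfolding polar_preimage_def by auto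
    qed
  qed (use e al in auto)
  then show "harea K = 4 * arctan T * (sinh (\<epsilon> / 2))\<^sup>2"
    using harea_eq_sl2_area[OF K sub] by simp
qed

text \<open>Both sides carry the same positive denominator; clearing it leaves expressions that are
  polynomial in the coordinates of \<open>w\<close>, hence continuous everywhere.\<close>

lemma hmotion_vector:
  assumes "c \<in> hplane" "w \<in> hplane"
  shows "2 * m * (hmotion c 0 w \<bullet> u) < 1 + (cmod (hmotion c 0 w))\<^sup>2 \<longleftrightarrow>
    2 * m * ((w + c\<^sup>2 * cnj w + c * (1 + (cmod w)\<^sup>2)) \<bullet> u) < (1 + (cmod c)\<^sup>2) * (1 + (cmod w)\<^sup>2) + 4 * Re (cnj c * w)"
proof -
  have c: "- c \<in> hplane" using assms by (simp add: hplane_iff)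
  let ?N = "(cmod (1 - cnj (- c) * w))\<^sup>2"
  have N: "0 < ?N" using mob_denom[OF c assms(2)] by simp
  have h: "hmotion c 0 w = mob (- c) w" by (simp add: hmotion_def)
  have "hmotion c 0 w = (1 / ?N) *\<^sub>R (w + c\<^sup>2 * cnj w + c * (1 + (cmod w)\<^sup>2))"
    unfolding h mob_vector(2)[OF c assms(2)] by (simp add: scaleR_conv_of_real)
  then have 1: "hmotion c 0 w \<bullet> u = ((w + c\<^sup>2 * cnj w + c * (1 + (cmod w)\<^sup>2)) \<bullet> u) / ?N" by simp
  have 2: "1 + (cmod (hmotion c 0 w))\<^sup>2 = ((1 + (cmod c)\<^sup>2) * (1 + (cmod w)\<^sup>2) + 4 * Re (cnj c * w)) / ?N"
    unfolding h mob_vector(1)[OF c assms(2)] by simp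
  show ?thesis unfolding 1 2 using N by (simp only: times_divide_eq_right divide_less_cancel) auto
qed

section \<open>The polygon near one of its vertices\<close>

context regular_polygon
begin

text \<open>The tangent of half the interior angle: moving the vertex \<open>b\<close> to the origin turns the two
  geodesics through it into the lines \<open>Im w = \<plusminus> slope * Re w\<close>.\<close>

definition "slope = (1 - b\<^sup>2) / ((1 + b\<^sup>2) * tan a)"

lemma b_hplane: "of_real b \<in> hplane" using b by (simp add: hplane_iff)

lemma tan_a: "0 < tan a" using a by (intro tan_gt_zero) auto

lemma slope: "0 < slope"
proof -
  have "b\<^sup>2 < 1" using b by (simp add: power_less_one_iff)
  then show ?thesis using tan_a b unfolding slope_def by (intro divide_pos_pos mult_pos_pos add_pos_nonneg) auto
qed

text \<open>The sign \<open>s\<close> selects one of the two sides through the vertex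
  \<open>b\<close>. As the vertex lies on both, the terms with \<open>1 + cmod w ^ 2\<close> cancel
  and a condition linear in \<open>w\<close> remains.\<close>

lemma vertex_halfplane:
  assumes w: "w \<in> hplane" and s: "s = 1 \<or> s = -1"
  shows "2 * \<mu> * (hmotion (of_real b) 0 w \<bullet> cis (s * a)) < 1 + (cmod (hmotion (of_real b) 0 w))\<^sup>2 \<longleftrightarrow>
     s * Im w < - Re w * slope"
proof -
  have b2: "0 < 1 - b\<^sup>2" using b by (simp add: power_less_one_iff)
  have b3: "0 < 1 + b\<^sup>2" by (simp add: add_pos_nonneg)
  have m: "2 * \<mu> * cos a = (1 + b\<^sup>2) / b" using b cos_a by (simp add: pmu_def field_simps)
  have m2: "2 * \<mu> * sin a = (1 + b\<^sup>2) * tan a / b" using b cos_a by (simp add: pmu_def tan_def field_simps)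
  have ss: "cos (s * a) = cos a" "sin (s * a) = s * sin a" using s by auto
  define c where "c = complex_of_real b"
  have c: "c \<in> hplane" "cmod c = b" "Re (cnj c * w) = b * Re w" using b_hplane b by (simp_all add: c_def)
  let ?x = "Re w" and ?y = "Im w" and ?n = "1 + (cmod w)\<^sup>2"
  have inner: "(w + c\<^sup>2 * cnj w + c * (1 + (cmod w)\<^sup>2)) \<bullet> cis (s * a) =
     ((1 + b\<^sup>2) * ?x + b * ?n) * cos a + (1 - b\<^sup>2) * ?y * (s * sin a)"
    unfolding inner_complex_def cis.sel ss c_def by (simp add: power2_eq_square algebra_simps)
  have "2 * \<mu> * ((w + c\<^sup>2 * cnj w + c * (1 + (cmod w)\<^sup>2)) \<bullet> cis (s * a)) =
      ((1 + b\<^sup>2) * ?x + b * ?n) * (2 * \<mu> * cos a) + (1 - b\<^sup>2) * ?y * s * (2 * \<mu> * sin a)"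
    unfolding inner by (simp only: algebra_simps)
  also have "\<dots> = (1 + b\<^sup>2)\<^sup>2 * ?x / b + (1 + b\<^sup>2) * ?n + (1 - b\<^sup>2) * ?y * s * ((1 + b\<^sup>2) * tan a / b)"
    unfolding m m2 using b by (simp add: field_simps power2_eq_square)
  finally have l: "2 * \<mu> * ((w + c\<^sup>2 * cnj w + c * (1 + (cmod w)\<^sup>2)) \<bullet> cis (s * a)) = \<dots>" .
  have "2 * \<mu> * (hmotion (of_real b) 0 w \<bullet> cis (s * a)) < 1 + (cmod (hmotion (of_real b) 0 w))\<^sup>2 \<longleftrightarrow>
    (1 + b\<^sup>2)\<^sup>2 * ?x / b + (1 + b\<^sup>2) * ?n + (1 - b\<^sup>2) * ?y * s * ((1 + b\<^sup>2) * tan a / b) < (1 + b\<^sup>2) * ?n + 4 * b * ?x"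
    unfolding c_def[symmetric] hmotion_vector[OF c(1) w] l c(2,3) by (simp only: mult.assoc)
  also have "\<dots> \<longleftrightarrow> ((1 + b\<^sup>2)\<^sup>2 * ?x + (1 - b\<^sup>2) * ?y * s * ((1 + b\<^sup>2) * tan a)) / b < (4 * b\<^sup>2 * ?x) / b"
    using b by (simp add: add_divide_distrib power2_eq_square mult.assoc)
  also have "\<dots> \<longleftrightarrow> (1 + b\<^sup>2)\<^sup>2 * ?x + (1 - b\<^sup>2) * ?y * s * ((1 + b\<^sup>2) * tan a) < 4 * b\<^sup>2 * ?x"
    using b by (simp add: divide_less_cancel)
  \<comment> \<open>Uses \<open>(1 + b^2)^2 - 4 * b^2 = (1 - b^2)^2\<close> to expose a positive
    factor that can be cancelled.\<close>
  also have "\<dots> \<longleftrightarrow> (1 - b\<^sup>2) * (s * ?y * ((1 + b\<^sup>2) * tan a)) < (1 - b\<^sup>2) * (- ?x * (1 - b\<^sup>2))"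
    by (simp add: algebra_simps power2_eq_square)
  also have "\<dots> \<longleftrightarrow> s * ?y * ((1 + b\<^sup>2) * tan a) < - ?x * (1 - b\<^sup>2)" using b2 by (simp only: mult_less_cancel_left_pos)
  also have "\<dots> \<longleftrightarrow> s * ?y < - ?x * slope"
    unfolding slope_def times_divide_eq_right using b3 tan_a by (subst pos_less_divide_eq) auto
  finally show ?thesis .
qed

text \<open>These are the sides meeting at vertex 0; the factors \<open>1\<close> and
  \<open>-1\<close> match the form \<open>s * a\<close> in \<open>vertex_halfplane\<close>.\<close>

lemma e_ends: "e 0 = cis (1 * a)" "e (p - 1) = cis (-1 * a)"
proof -
  show "e 0 = cis (1 * a)" by (simp add: pnormal_def)
  have "pi * (2 * real (p - 1) + 1) / real p = 2 * pi + (-1 * a)"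
    using p by (simp add: field_simps of_nat_diff)
  then have "e (p - 1) = cis (2 * pi) * cis (-1 * a)" unfolding pnormal_def by (simp only: cis_mult)
  then show "e (p - 1) = cis (-1 * a)" by simp
qed

text \<open>The angle to these normals lies between \<open>3 * a\<close> and
  \<open>2 * pi - 3 * a\<close>. The strict inequality persists nearby, so only two sides matter at
  the vertex.\<close>

lemma other_halfplane:
  assumes "0 < k" "k < p - 1"
  shows "2 * \<mu> * (of_real b \<bullet> e k) < 1 + b\<^sup>2"
proof -
  have le: "3 \<le> 2 * real k + 1" using assms by simp
  have "k + 2 \<le> p" using assms by simp
  then have ge: "2 * real k + 1 \<le> 2 * real p - 3" by linarith
  have 1: "a * 3 \<le> a * (2 * real k + 1)" using le a by (intro mult_left_mono) auto
  have 2: "a * (2 * real k + 1) \<le> a * (2 * real p - 3)" using ge a by (intro mult_left_mono) auto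
  have 3: "a * (2 * real p - 3) = 2 * pi - 3 * a" using p by (simp add: field_simps)
  have pos: "0 \<le> a * (2 * real k + 1)" using a by simp
  have "cos (a * (2 * real k + 1)) < cos a"
    by (rule cos_less_cos_outside) (use 1 2 3 a pos in linarith)+
  then have "2 * \<mu> * b * cos (a * (2 * real k + 1)) < 2 * \<mu> * b * cos a" using mu b by simp
  also have "\<dots> = 1 + b\<^sup>2" using b cos_a by (simp add: pmu_def)
  finally show ?thesis by (simp add: pnormal_def inner_complex_def mult_ac)
qed

lemma sector_at_vertex:
  "\<exists>\<epsilon>0>0. \<forall>\<epsilon>. 0 < \<epsilon> \<and> \<epsilon> \<le> \<epsilon>0 \<longrightarrow> harea (hpoly_int p b \<inter> hdisc (of_real b) \<epsilon>) = 4 * arctan slope * (sinh (\<epsilon> / 2))\<^sup>2"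
proof -
  let ?b = "complex_of_real b"
  \<comment> \<open>The open neighbourhood of 0 on which the inequalities of all sides not through
    the vertex hold.\<close>
  define G where "G = (\<Inter>k\<in>{0<..<p-1}. {w. 2 * \<mu> * ((w + ?b\<^sup>2 * cnj w + ?b * (1 + (cmod w)\<^sup>2)) \<bullet> e k)
     < (1 + (cmod ?b)\<^sup>2) * (1 + (cmod w)\<^sup>2) + 4 * Re (cnj ?b * w)})"
  have "open G" unfolding G_def
    by (intro open_INT ballI open_Collect_less continuous_intros) auto
  moreover have "0 \<in> G" using other_halfplane by (auto simp: G_def)
  ultimately obtain r where r: "0 < r" "ball 0 r \<subseteq> G" using open_contains_ball by blast
  \<comment> \<open>Below 1 so that \<open>tanh\<close> undoes \<open>artanh\<close>, and below
    \<open>r\<close> so that the closed disc stays inside \<open>G\<close>.\<close>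
  define r' where "r' = min (r / 2) (1 / 2)"
  have r': "0 < r'" "r' < 1" "r' < r" using r by (auto simp: r'_def)
  define \<epsilon>0 where "\<epsilon>0 = 2 * artanh r'"
  have e0: "0 < \<epsilon>0" using r' by (simp add: \<epsilon>0_def artanh_def)
  have "harea (hpoly_int p b \<inter> hdisc ?b \<epsilon>) = 4 * arctan slope * (sinh (\<epsilon> / 2))\<^sup>2" if e: "0 < \<epsilon>" "\<epsilon> \<le> \<epsilon>0" for \<epsilon>
  proof -
    define K where "K = {w \<in> hdisc 0 \<epsilon>. \<bar>Im w\<bar> < - Re w * slope}"
    have sub: "K \<subseteq> hplane" by (auto simp: K_def hdisc_def)
    have "tanh (\<epsilon> / 2) \<le> tanh (artanh r')" using e by (simp add: \<epsilon>0_def)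
    then have te: "tanh (\<epsilon> / 2) < r" using r' by (simp add: tanh_artanh_real)
    have inG: "w \<in> G" if "w \<in> hdisc 0 \<epsilon>" for w
      using that e te r by (auto simp: hdisc_0 subset_iff)
    have mem: "hmotion ?b 0 w \<in> hpoly_int p b \<longleftrightarrow> \<bar>Im w\<bar> < - Re w * slope" if w: "w \<in> hdisc 0 \<epsilon>" for w
    proof -
      have wh: "w \<in> hplane" using w by (simp add: hdisc_def)
      let ?P = "\<lambda>k. 2 * \<mu> * (hmotion ?b 0 w \<bullet> e k) < 1 + (cmod (hmotion ?b 0 w))\<^sup>2"
      have mid: "?P k" if "0 < k" "k < p - 1" for k
        unfolding hmotion_vector[OF b_hplane wh] using inG[OF w] that by (auto simp: G_def)
      have "hmotion ?b 0 w \<in> hpoly_int p b \<longleftrightarrow> (\<forall>k<p. ?P k)"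
        using hmotion_in_hplane[OF b_hplane wh] by (simp add: hpoly_int_def)
      also have "\<dots> \<longleftrightarrow> ?P 0 \<and> ?P (p - 1)"
      proof
        assume "?P 0 \<and> ?P (p - 1)"
        then have ends: "?P 0" "?P (p - 1)" by blast+
        show "\<forall>k<p. ?P k"
        proof (intro allI impI)
          fix k assume "k < p"
          then consider "k = 0" | "k = p - 1" | "0 < k" "k < p - 1" by linarith
          then show "?P k" using ends mid by cases blast+
        qed
      qed (use p in auto)
      also have "?P 0 \<longleftrightarrow> 1 * Im w < - Re w * slope" unfolding e_ends by (rule vertex_halfplane[OF wh]) simp
      also have "?P (p - 1) \<longleftrightarrow> -1 * Im w < - Re w * slope" unfolding e_ends by (rule vertex_halfplane[OF wh]) simp
      also have "1 * Im w < - Re w * slope \<and> -1 * Im w < - Re w * slope \<longleftrightarrow> \<bar>Im w\<bar> < - Re w * slope" by auto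
      finally show ?thesis .
    qed
    have img: "hmotion ?b 0 ` K = hpoly_int p b \<inter> hdisc ?b \<epsilon>"
    proof
      have d: "hmotion ?b 0 ` hdisc 0 \<epsilon> = hdisc ?b \<epsilon>"
        using hmotion_hdisc[OF b_hplane zero_in_hplane] by (simp add: hmotion_0[OF b_hplane])
      show "hmotion ?b 0 ` K \<subseteq> hpoly_int p b \<inter> hdisc ?b \<epsilon>" using mem d by (auto simp: K_def)
      show "hpoly_int p b \<inter> hdisc ?b \<epsilon> \<subseteq> hmotion ?b 0 ` K" using mem unfolding d[symmetric] by (auto simp: K_def)
    qed
    have "harea (hmotion ?b 0 ` K) = harea K"
      by (rule harea_hmotion[OF b_hplane]) (use harea_sector[OF slope] e in \<open>auto simp: K_def\<close>)
    then show ?thesis unfolding img using harea_sector(3)[OF slope, of \<epsilon>] e by (simp add: K_def)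
  qed
  then show ?thesis using e0 by blast
qed

end

text \<open>The angle \<open>t\<close> is the argument of \<open>v\<close> after \<open>c\<close>
  has been moved to 0; rotating about \<open>c\<close> then only shifts the index.\<close>

lemma hvertex_hmotion:
  assumes c: "c \<in> hplane" and v: "v \<in> hplane"
  obtains t where "\<And>k. hvertex p c v k = hmotion c t (pvertex p (tanh (hdist c v / 2)) k)"
proof
  fix k
  let ?w = "mob c v"
  have w: "?w \<in> hplane" using c v by (rule mob_in_hplane)
  have "hdist 0 ?w = hdist c v"
    using hdist_mob[OF c c v] by (simp add: Moebius_function_eq_zero)
  then have n: "cmod ?w = tanh (hdist c v / 2)" using cmod_eq_tanh_hdist[OF w] by simp
  have "?w = of_real (cmod ?w) * cis (Arg2pi ?w)"
    using Arg2pi_eq[of ?w] by (simp add: cis_conv_exp)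
  then have "cis (2 * pi * real k / real p) * ?w = cis (Arg2pi ?w) * pvertex p (cmod ?w) k"
    unfolding pvertex_def by (metis mult.commute mult.assoc)
  then show "hvertex p c v k = hmotion c (Arg2pi ?w) (pvertex p (tanh (hdist c v / 2)) k)"
    unfolding hvertex_def hrot_def hmotion_def n by simp
qed

section \<open>Topology and null sets under motions, small discs, additivity of area\<close>

lemma continuous_on_hmotion: "c \<in> hplane \<Longrightarrow> continuous_on hplane (hmotion c t)"
  by (rule DERIV_continuous_on) (rule has_field_derivative_at_within, rule hmotion_has_field_derivative)

lemma continuous_on_hmotion_inv:
  assumes "c \<in> hplane"
  shows "continuous_on hplane (hmotion_inv c t)"
  unfolding hmotion_inv_def Moebius_function_simple
  by (intro continuous_intros) (use mob_denom[OF assms] in auto)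

lemma open_hplane: "open hplane" by (simp add: hplane_def)

lemma hmotion_image_open:
  assumes c: "c \<in> hplane" and S: "open S" "S \<subseteq> hplane"
  shows "open (hmotion c t ` S)"
proof -
  have "hmotion c t ` S = hplane \<inter> hmotion_inv c t -` S" unfolding hmotion_image[OF c S(2)] by auto
  then show ?thesis using continuous_open_preimage[OF continuous_on_hmotion_inv[OF c] open_hplane S(1)] by simp
qed

lemma compact_hmotion_image:
  assumes "c \<in> hplane" "compact S" "S \<subseteq> hplane"
  shows "compact (hmotion c t ` S)"
  by (rule compact_continuous_image[OF continuous_on_subset[OF continuous_on_hmotion]]) (use assms in auto)

lemma negligible_hmotion_image:
  assumes c: "c \<in> hplane" and S: "negligible S" "S \<subseteq> hplane"
  shows "negligible (hmotion c t ` S)"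
proof (rule negligible_differentiable_image_negligible)
  show "hmotion c t differentiable_on S"
    unfolding differentiable_on_def differentiable_def
    using hmotion_has_field_derivative[OF c] S(2)
    by (meson has_field_derivative_at_within has_field_derivative_imp_has_derivative subsetD)
qed (use S in auto)

lemma hdisc_eq_image:
  assumes "c \<in> hplane" "0 \<le> r"
  shows "hdisc c r = hmotion c 0 ` cball 0 (tanh (r / 2))"
  using hmotion_hdisc[OF assms(1) zero_in_hplane, of 0 r] assms by (simp add: hmotion_0 hdisc_0)

lemma cball_tanh_subset: "cball 0 (tanh r) \<subseteq> hplane"
  using tanh_real_lt_1[of r] by (auto simp: hplane_iff)

lemma compact_hdisc: "c \<in> hplane \<Longrightarrow> 0 \<le> r \<Longrightarrow> compact (hdisc c r)"
  unfolding hdisc_eq_image by (rule compact_hmotion_image) (use cball_tanh_subset in auto)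

lemma small_hdisc_subset:
  assumes x: "x \<in> hplane" and U: "open U" "x \<in> U"
  obtains \<epsilon> where "0 < \<epsilon>" "\<And>\<delta>. 0 \<le> \<delta> \<Longrightarrow> \<delta> \<le> \<epsilon> \<Longrightarrow> hdisc x \<delta> \<subseteq> U"
proof -
  have "open (hplane \<inter> hmotion x 0 -` U)"
    by (rule continuous_open_preimage[OF continuous_on_hmotion[OF x] open_hplane U(1)])
  moreover have "0 \<in> hplane \<inter> hmotion x 0 -` U" using U by (simp add: zero_in_hplane hmotion_0[OF x])
  ultimately obtain r where r: "0 < r" "ball 0 r \<subseteq> hplane \<inter> hmotion x 0 -` U"
    using open_contains_ball by blast
  define s where "s = min (r / 2) (1 / 2)"
  have s: "0 < s" "s < 1" "s < r" using r by (auto simp: s_def)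
  show ?thesis
  proof
    show "0 < 2 * artanh s" using s by (simp add: artanh_def)
    fix \<delta> assume d: "0 \<le> \<delta>" "\<delta> \<le> 2 * artanh s"
    have "tanh (\<delta> / 2) \<le> tanh (artanh s)" using d by simp
    then have "tanh (\<delta> / 2) < r" using s by (simp add: tanh_artanh_real)
    then have "cball 0 (tanh (\<delta> / 2)) \<subseteq> ball (0::complex) r" by auto
    then show "hdisc x \<delta> \<subseteq> U" unfolding hdisc_eq_image[OF x d(1)] using r by blast
  qed
qed

text \<open>The density is continuous on the compact disc, hence integrable, as additivity requires.
  The pieces may miss a null set because the open tiles miss their sides.\<close>

lemma harea_finite_Union:
  assumes fin: "finite I" and disj: "disjoint_family_on A I" and c: "c \<in> hplane" "0 \<le> r"
    and A: "\<And>i. i \<in> I \<Longrightarrow> A i \<in> sets borel" "\<And>i. i \<in> I \<Longrightarrow> A i \<subseteq> hdisc c r"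
    and null: "negligible (hdisc c r - (\<Union>i\<in>I. A i))"
  shows "harea (hdisc c r) = (\<Sum>i\<in>I. harea (A i))"
proof -
  let ?f = "\<lambda>z::complex. 4 / (1 - (norm z)\<^sup>2)\<^sup>2"
  have f[measurable]: "?f \<in> borel_measurable borel" by measurable
  have D[measurable]: "hdisc c r \<in> sets borel" "hdisc c r \<subseteq> hplane" using hdisc_borel[OF c] by auto
  have U[measurable]: "(\<Union>i\<in>I. A i) \<in> sets borel" using fin A by auto
  have "1 - (cmod z)\<^sup>2 \<noteq> 0" if "z \<in> hdisc c r" for z
    using hplane_norm_sq[of z] that D(2) by auto
  then have "continuous_on (hdisc c r) ?f" by (intro continuous_intros) auto
  then have int: "set_integrable lborel (hdisc c r) ?f"
    unfolding set_integrable_def by (rule borel_integrable_compact[OF compact_hdisc[OF c]])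
  have "(LINT z:hdisc c r|lborel. ?f z) = (LINT z:(\<Union>i\<in>I. A i)|lborel. ?f z)"
  proof (rule set_integral_cong_set[symmetric])
    show "set_borel_measurable lborel (\<Union>i\<in>I. A i) ?f" "set_borel_measurable lborel (hdisc c r) ?f"
      unfolding set_borel_measurable_def by measurable
    have "AE x in lebesgue. x \<notin> hdisc c r - (\<Union>i\<in>I. A i)"
      using null by (intro AE_not_in) (simp only: negligible_iff_null_sets)
    then have "AE x in lborel. x \<notin> hdisc c r - (\<Union>i\<in>I. A i)"
      by (simp only: AE_completion_iff)
    then show "AE x in lborel. (x \<in> hdisc c r) = (x \<in> (\<Union>i\<in>I. A i))"
      by eventually_elim (use A(2) in auto)
  qed
  also have "\<dots> = (\<Sum>i\<in>I. LINT z:A i|lborel. ?f z)"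
  proof (rule set_integral_finite_Union[OF fin disj])
    fix i assume "i \<in> I"
    then show "set_integrable lborel (A i) ?f" "A i \<in> sets lborel"
      using A by (auto intro!: set_integrable_subset[OF int])
  qed
  finally show ?thesis unfolding harea_def .
qed

context regular_polygon
begin

lemma V_range: "V = range v"
  using v_in_V by (auto simp: V_def)

lemma rotate_V: "(\<lambda>z. cis (2 * pi * real j / real p) * z) ` V = V"
proof -
  have rot: "cis (2 * pi * real j / real p) * v k = v (k + j)" for k
    by (simp add: pvertex_def cis_mult add_divide_distrib algebra_simps mult.left_commute[of "cis _" "of_real _"])
  \<comment> \<open>Going back \<open>j\<close> steps is done by going forward
    \<open>(p - 1) * j\<close> steps, since indices are natural numbers and \<open>p * j\<close>
    steps are full turns.\<close>
  have shift: "v k = v (k + (p - 1) * j + j)" for k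
  proof -
    have "k + (p - 1) * j + j = k + p * j" using p by (cases p) auto
    moreover have "v (k + p * j) = v k" using v_mod[of "k + p * j"] v_mod[of k] by simp
    ultimately show ?thesis by (simp only:)
  qed
  show ?thesis unfolding V_range image_image rot
  proof
    show "range v \<subseteq> range (\<lambda>k. v (k + j))" by (rule image_subsetI, subst shift) (rule rangeI)
  qed auto
qed

lemma hmotion_rotate: "hmotion c (t + s) z = hmotion c t (cis s * z)"
  by (simp add: hmotion_def cis_mult flip: mult.assoc)

lemma v0: "v 0 = of_real b" by (simp add: pvertex_def)

text \<open>Rotations of the polygon act transitively on its vertices, so any chosen vertex of a
  tile can be the image of \<open>b\<close>, where the sector is known.\<close>

lemma tile_from_vertex:
  assumes W: "W = hmotion c t ` V" and x: "x \<in> W"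
  obtains t' where "W = hmotion c t' ` V" "x = hmotion c t' (of_real b)"
proof -
  obtain j where j: "x = hmotion c t (v j)" using x W by (auto simp: V_def)
  let ?s = "2 * pi * real j / real p"
  show ?thesis
  proof
    show "W = hmotion c (t + ?s) ` V" unfolding hmotion_rotate W
      by (subst (1) rotate_V[of j, symmetric]) (simp only: image_image)
    show "x = hmotion c (t + ?s) (of_real b)" unfolding hmotion_rotate j by (simp add: pvertex_def mult.commute)
  qed
qed

text \<open>The centre of a tile is determined by its set of vertices: a point equidistant from the vertices
  has the same inner product with each of them, which is \<open>0\<close> because they sum to \<open>0\<close>.\<close>

lemma equidistant_centre:
  assumes x: "x \<in> hplane" and d: "\<And>k. hdist x (v k) = D"
  shows "x = 0"
proof -
  have b1: "1 - b\<^sup>2 > 0" "1 - (cmod x)\<^sup>2 > 0" using b hplane_norm_sq[OF x] by (auto simp: power_less_one_iff)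
  have inn: "x \<bullet> v k = x \<bullet> v 0" for k
  proof -
    have "cosh (hdist x (v k)) = cosh (hdist x (v 0))" using d by simp
    then have "(cmod (x - v k))\<^sup>2 = (cmod (x - v 0))\<^sup>2"
      unfolding cosh_hdist(1)[OF x v_in_hplane] cmod_v using b1 by simp
    then show ?thesis by (simp add: power2_norm_eq_inner inner_diff inner_commute)
      (simp add: cmod_v flip: power2_norm_eq_inner)
  qed
  have "(\<Sum>k<p. x \<bullet> v k) = (\<Sum>k<p. x \<bullet> v 0)" by (rule sum.cong[OF refl]) (rule inn)
  then have "(\<Sum>k<p. x \<bullet> v k) = real p * (x \<bullet> v 0)" by simp
  moreover have "(\<Sum>k<p. v k) = 0"
    using sum_roots_of_unity_cis[of p] p by (simp add: pvertex_def flip: sum_distrib_left)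
  then have "(\<Sum>k<p. x \<bullet> v k) = 0" by (simp flip: inner_sum_right)
  ultimately have "x \<bullet> v 0 = 0" using p by simp
  then have re: "Re x = 0" using b by (simp add: v0 inner_complex_def)
  have "x \<bullet> v 1 = 0" using inn[of 1] \<open>x \<bullet> v 0 = 0\<close> by simp
  then have "Im x * (b * sin (2 * pi / real p)) = 0" using re by (simp add: pvertex_def inner_complex_def)
  moreover have "0 < sin (2 * pi / real p)" using p by (intro sin_gt_zero) (auto simp: field_simps)
  ultimately show ?thesis using re b by (simp add: complex_eq_iff)
qed

text \<open>Non-overlap is given for topological interiors, so the areas are those of the open
  images \<open>I W\<close> inside them; what these miss of the disc lies on sides and is
  null.\<close>

lemma angle_at_vertex:
  assumes x: "x \<in> hplane" and F: "finite F" "card F = q" and q: "0 < q"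
    and tiles: "\<And>W. W \<in> F \<Longrightarrow> \<exists>c\<in>hplane. \<exists>t. W = hmotion c t ` V \<and> x = hmotion c t (of_real b)"
    and disj: "\<And>W W'. W \<in> F \<Longrightarrow> W' \<in> F \<Longrightarrow> W \<noteq> W' \<Longrightarrow> interior (hconvex hull W) \<inter> interior (hconvex hull W') = {}"
    and cover: "0 < \<epsilon>1" "hdisc x \<epsilon>1 \<subseteq> (\<Union>W\<in>F. hconvex hull W)"
  shows "real q * arctan slope = pi"
proof -
  have "\<forall>W. \<exists>c t. W \<in> F \<longrightarrow> c \<in> hplane \<and> W = hmotion c t ` V \<and> x = hmotion c t (of_real b)"
    using tiles by metis
  then obtain c t where ct: "\<And>W. W \<in> F \<Longrightarrow> c W \<in> hplane" "\<And>W. W \<in> F \<Longrightarrow> W = hmotion (c W) (t W) ` V"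
      "\<And>W. W \<in> F \<Longrightarrow> x = hmotion (c W) (t W) (of_real b)"
    by metis
  obtain \<epsilon>0 where e0: "0 < \<epsilon>0" and area: "\<And>\<epsilon>. 0 < \<epsilon> \<Longrightarrow> \<epsilon> \<le> \<epsilon>0 \<Longrightarrow>
      harea (hpoly_int p b \<inter> hdisc (of_real b) \<epsilon>) = 4 * arctan slope * (sinh (\<epsilon> / 2))\<^sup>2"
    using sector_at_vertex by blast
  define \<epsilon> where "\<epsilon> = min \<epsilon>0 \<epsilon>1"
  have e: "0 < \<epsilon>" "\<epsilon> \<le> \<epsilon>0" "\<epsilon> \<le> \<epsilon>1" using e0 cover by (auto simp: \<epsilon>_def)
  have sub: "hpoly p b \<subseteq> hplane" "hpoly_int p b \<subseteq> hplane" by (auto simp: hpoly_def hpoly_int_def)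
  define I where "I = (\<lambda>W. hmotion (c W) (t W) ` hpoly_int p b)"
  have H: "hconvex hull W = hmotion (c W) (t W) ` hpoly p b" if "W \<in> F" for W
    using hull_hmotion[OF ct(1)[OF that] V_in_hplane, of "t W", folded ct(2)[OF that]] by (simp only: hull_V)
  have opn: "open (I W)" if "W \<in> F" for W
    unfolding I_def by (rule hmotion_image_open[OF ct(1)[OF that] open_hpoly_int sub(2)])
  have int: "I W \<subseteq> interior (hconvex hull W)" if "W \<in> F" for W
    using opn[OF that] hpoly_int_subset unfolding H[OF that] by (intro interior_maximal) (auto simp: I_def)
  define A where "A = (\<lambda>W. I W \<inter> hdisc x \<epsilon>)"
  have disc: "hdisc x \<epsilon> = hmotion (c W) (t W) ` hdisc (of_real b) \<epsilon>" if "W \<in> F" for W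
    using hmotion_hdisc[OF ct(1)[OF that] b_hplane] ct(3)[OF that] by simp
  have dsub: "hdisc z r \<subseteq> hplane" for z r by (auto simp: hdisc_def)
  have AW: "A W = hmotion (c W) (t W) ` (hpoly_int p b \<inter> hdisc (of_real b) \<epsilon>)" if "W \<in> F" for W
    unfolding A_def I_def disc[OF that]
    by (rule inj_on_image_Int[symmetric, OF inj_on_hmotion[OF ct(1)[OF that]] sub(2) dsub])
  have meas: "hpoly_int p b \<inter> hdisc (of_real b) \<epsilon> \<in> sets borel"
    using open_hpoly_int hdisc_borel(1)[OF b_hplane, of \<epsilon>] e by auto
  have areaA: "harea (A W) = 4 * arctan slope * (sinh (\<epsilon> / 2))\<^sup>2" if "W \<in> F" for W
    unfolding AW[OF that] using harea_hmotion[OF ct(1)[OF that] meas] sub area e by auto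
  have "harea (hdisc x \<epsilon>) = (\<Sum>W\<in>F. harea (A W))"
  proof (rule harea_finite_Union[OF F(1) _ x])
    show "disjoint_family_on A F"
      unfolding disjoint_family_on_def A_def using int disj by blast
    show "A W \<in> sets borel" if "W \<in> F" for W
      using opn[OF that] hdisc_borel(1)[OF x, of \<epsilon>] e by (auto simp: A_def)
    have "hdisc x \<epsilon> \<subseteq> hdisc x \<epsilon>1" using e by (auto simp: hdisc_def)
    then have "hdisc x \<epsilon> - (\<Union>W\<in>F. A W) \<subseteq> (\<Union>W\<in>F. hmotion (c W) (t W) ` (hpoly p b - hpoly_int p b))"
      using cover(2) H by (fastforce simp: A_def I_def)
    moreover have "negligible (\<Union>W\<in>F. hmotion (c W) (t W) ` (hpoly p b - hpoly_int p b))"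
    proof (rule negligible_Union)
      fix N assume "N \<in> (\<lambda>W. hmotion (c W) (t W) ` (hpoly p b - hpoly_int p b)) ` F"
      then show "negligible N" using negligible_hmotion_image[OF ct(1) negligible_hpoly_boundary] sub by blast
    qed (use F in auto)
    ultimately show "negligible (hdisc x \<epsilon> - (\<Union>W\<in>F. A W))" by (rule negligible_subset[rotated])
  qed (use e in \<open>auto simp: A_def\<close>)
  also have "\<dots> = real q * (4 * arctan slope * (sinh (\<epsilon> / 2))\<^sup>2)" using areaA F by simp
  finally have "4 * pi * (sinh (\<epsilon> / 2))\<^sup>2 = real q * (4 * arctan slope * (sinh (\<epsilon> / 2))\<^sup>2)"
    using harea_hdisc[OF x, of \<epsilon>] e by simp
  moreover have "0 < sinh (\<epsilon> / 2)" using e by simp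
  ultimately show ?thesis by (simp add: algebra_simps)
qed

end

lemma tanh_half_bounds:
  assumes "0 < R"
  shows "0 < tanh (R / 2)" "tanh (R / 2 :: real) < 1"
  using assms tanh_real_lt_1 by auto

text \<open>Two gaps are closed before \<open>angle_at_vertex\<close> applies: the pair
  \<open>c\<close>, \<open>v\<close> need not be the one granted the radius \<open>R\<close>, and a
  small disc about a vertex must be covered by the tiles having that vertex.\<close>

lemma tessellation_circumradius:
  assumes p: "3 \<le> p" and q: "0 < q" and T: "regular_tessellation p q T"
    and c: "c \<in> hplane" and v: "v \<in> hplane" and mem: "hvertices p c v \<in> T"
  shows "0 < hdist c v \<and> real q * arctan (regular_polygon.slope p (tanh (hdist c v / 2))) = pi"
proof -
  note T' = T[unfolded regular_tessellation_def]
  obtain R where R: "0 < R" and tiles: "\<And>W. W \<in> T \<Longrightarrow> \<exists>c\<in>hplane. \<exists>v\<in>hplane. hdist c v = R \<and> W = hvertices p c v"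
    using conjunct1[OF T'] by (elim exE conjE) simp
  have cov: "(\<Union>V\<in>T. hconvex hull V) = hplane"
    by (rule conjunct1[OF conjunct2[OF T']])
  have disj: "\<And>V W. V\<in>T \<Longrightarrow> W\<in>T \<Longrightarrow> V \<noteq> W \<Longrightarrow> interior (hconvex hull V) \<inter> interior (hconvex hull W) = {}"
    using conjunct1[OF conjunct2[OF conjunct2[OF T']]] by blast
  have locfin: "\<And>K. compact K \<Longrightarrow> K \<subseteq> hplane \<Longrightarrow> finite {V\<in>T. (hconvex hull V) \<inter> K \<noteq> {}}"
    using conjunct1[OF conjunct2[OF conjunct2[OF conjunct2[OF T']]]] by simp
  have vert: "(\<forall>W\<in>T. x \<in> hconvex hull W \<longrightarrow> x \<in> W) \<and> card {W\<in>T. x \<in> W} = q" if "V \<in> T" "x \<in> V" for V x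
    by (rule bspec[OF bspec[OF conjunct2[OF conjunct2[OF conjunct2[OF conjunct2[OF T']]]] that(1)] that(2)])
  have edge: "x \<in> W" if "V\<in>T" "x\<in>V" "W \<in> T" "x \<in> hconvex hull W" for V x W
    using conjunct1[OF vert[OF that(1,2)]] that(3,4) by blast
  have card: "card {W\<in>T. x \<in> W} = q" if "V\<in>T" "x\<in>V" for V x
    by (rule conjunct2[OF vert[OF that]])
  define b where "b = tanh (R / 2)"
  interpret regular_polygon p b by standard (use p tanh_half_bounds[OF R] in \<open>auto simp: b_def\<close>)
  have tiles': "\<exists>c\<in>hplane. \<exists>t. W = hmotion c t ` V" if W: "W \<in> T" for W
  proof -
    obtain c' v' where cv: "c' \<in> hplane" "v' \<in> hplane" "hdist c' v' = R" "W = hvertices p c' v'" using tiles[OF W] by blast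
    obtain t where "\<And>k. hvertex p c' v' k = hmotion c' t (pvertex p b k)"
      using hvertex_hmotion[OF cv(1,2)] cv(3) unfolding b_def by metis
    then have "W = hmotion c' t ` V" unfolding cv(4) hvertices_def V_def by (simp add: image_image)
    then show ?thesis using cv by blast
  qed
  \<comment> \<open>Two presentations of one vertex set are compared: \<open>c\<close> is
    equidistant from all the vertices, so it is also the centre of the second presentation.\<close>
  have dist: "hdist c v = R"
  proof -
    obtain c' t where c': "c' \<in> hplane" and W: "hvertices p c v = hmotion c' t ` V" using tiles'[OF mem] by blast
    obtain s where s: "\<And>k. hvertex p c v k = hmotion c s (pvertex p (tanh (hdist c v / 2)) k)"
      using hvertex_hmotion[OF c v] by blast
    have pv: "pvertex p (tanh (hdist c v / 2)) k \<in> hplane" "hdist 0 (pvertex p (tanh (hdist c v / 2)) k) = hdist c v" for k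
    proof -
      let ?z = "pvertex p (tanh (hdist c v / 2)) k"
      have h: "0 \<le> hdist c v" by (rule cosh_hdist(2)[OF c v])
      then have n: "cmod ?z = tanh (hdist c v / 2)" by (simp add: pvertex_def norm_mult)
      show z: "?z \<in> hplane" using tanh_real_lt_1 by (simp add: hplane_iff n)
      have "tanh (hdist 0 ?z / 2) = tanh (hdist c v / 2)" using cmod_eq_tanh_hdist[OF z] n by simp
      then show "hdist 0 ?z = hdist c v" by simp
    qed
    have vd: "hdist c y = hdist c v" if y: "y \<in> hvertices p c v" for y
    proof -
      obtain k where "y = hmotion c s (pvertex p (tanh (hdist c v / 2)) k)" using y s by (auto simp: hvertices_def)
      then show ?thesis using hdist_hmotion[OF c zero_in_hplane pv(1)] pv(2) hmotion_0[OF c] by metis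
    qed
    define x where "x = hmotion_inv c' t c"
    have x: "x \<in> hplane" "hmotion c' t x = c"
      using hmotion_inv_in_hplane[OF c' c] hmotion_hmotion_inv[OF c' c] by (auto simp: x_def)
    have "hdist x (pvertex p b k) = hdist c v" for k
    proof -
      have "hmotion c' t (pvertex p b k) \<in> hvertices p c v" unfolding W using v_in_V by blast
      then show ?thesis using vd hdist_hmotion[OF c' x(1) v_in_hplane[of k], of t] x(2) by simp
    qed
    note eqd = this
    then have "x = 0" by (rule equidistant_centre[OF x(1)])
    then have "hdist 0 (pvertex p b 0) = hdist c v" using eqd by simp
    moreover have "tanh (hdist 0 (pvertex p b 0) / 2) = tanh (R / 2)"
      using cmod_eq_tanh_hdist[OF v_in_hplane[of 0]] cmod_v by (simp add: b_def)
    ultimately show ?thesis by simp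
  qed
  define x where "x = hvertex p c v 0"
  have xV: "x \<in> hvertices p c v" using p by (auto simp: x_def hvertices_def)
  define F where "F = {W\<in>T. x \<in> W}"
  have cF: "card F = q" unfolding F_def by (rule card[OF mem xV])
  \<comment> \<open>An infinite set has \<open>card\<close> 0, whereas \<open>q\<close> is
    positive.\<close>
  then have fF: "finite F" using q by (metis card.infinite less_irrefl)
  have sub: "W \<subseteq> hplane" if "W \<in> T" for W
    using tiles'[OF that] hmotion_in_hplane V_in_hplane by blast
  have x: "x \<in> hplane" using sub[OF mem] xV by blast
  have inF: "W \<in> F \<longleftrightarrow> W \<in> T \<and> x \<in> hconvex hull W" for W
    unfolding F_def using edge[OF mem xV, of W] hull_inc[of x W hconvex] by auto
  have comp: "compact (hconvex hull W)" if WT: "W \<in> T" for W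
  proof -
    obtain c' t where c': "c' \<in> hplane" and W: "W = hmotion c' t ` V" using tiles'[OF WT] by blast
    have "hpoly p b \<subseteq> hplane" by (auto simp: hpoly_def)
    then show ?thesis unfolding W hull_hmotion[OF c' V_in_hplane] hull_V
      by (rule compact_hmotion_image[OF c' compact_hpoly])
  qed
  \<comment> \<open>By local finiteness only finitely many tiles come near \<open>x\<close>; those
    not containing \<open>x\<close> are closed, so a smaller disc avoids them all.\<close>
  define G where "G = {W\<in>T. (hconvex hull W) \<inter> hdisc x 1 \<noteq> {}}"
  have fG: "finite G" unfolding G_def
    by (rule locfin[OF compact_hdisc[OF x]]) (auto simp: hdisc_def)
  have "open (- (\<Union>W\<in>G - F. hconvex hull W))"
  proof (intro open_Compl closed_UN ballI)
    fix W assume "W \<in> G - F"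
    then show "closed (hconvex hull W)" using comp by (intro compact_imp_closed) (simp add: G_def)
  qed (use fG in simp)
  moreover have "x \<in> - (\<Union>W\<in>G - F. hconvex hull W)" using inF by (auto simp: G_def)
  ultimately obtain \<epsilon> where e: "0 < \<epsilon>" "\<And>\<delta>. 0 \<le> \<delta> \<Longrightarrow> \<delta> \<le> \<epsilon> \<Longrightarrow> hdisc x \<delta> \<subseteq> - (\<Union>W\<in>G - F. hconvex hull W)"
    using small_hdisc_subset[OF x] by blast
  define \<epsilon>1 where "\<epsilon>1 = min \<epsilon> 1"
  have e1: "0 < \<epsilon>1" "\<epsilon>1 \<le> \<epsilon>" "\<epsilon>1 \<le> 1" using e by (auto simp: \<epsilon>1_def)
  have "hdisc x \<epsilon>1 \<subseteq> (\<Union>W\<in>F. hconvex hull W)"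
  proof
    fix z assume z: "z \<in> hdisc x \<epsilon>1"
    then have "z \<in> hplane" by (simp add: hdisc_def)
    then obtain W where W: "W \<in> T" "z \<in> hconvex hull W" using cov by blast
    have "z \<in> hdisc x 1" using z e1 by (auto simp: hdisc_def)
    then have "W \<in> G" using W by (auto simp: G_def)
    moreover have "z \<in> - (\<Union>W\<in>G - F. hconvex hull W)" using e(2)[of \<epsilon>1] e1 z by auto
    ultimately show "z \<in> (\<Union>W\<in>F. hconvex hull W)" using W by blast
  qed
  note cover = this
  have "real q * arctan slope = pi"
  proof (rule angle_at_vertex[OF x fF cF q _ _ e1(1) cover])
    fix W assume W: "W \<in> F"
    then have "W \<in> T" by (simp add: F_def)
    then obtain c' t where c': "c' \<in> hplane" "W = hmotion c' t ` V" using tiles' by blast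
    have "x \<in> W" using W by (simp add: F_def)
    from tile_from_vertex[OF c'(2) this]
    obtain t' where "W = hmotion c' t' ` V" "x = hmotion c' t' (of_real b)" .
    then show "\<exists>c\<in>hplane. \<exists>t. W = hmotion c t ` V \<and> x = hmotion c t (of_real b)"
      using c'(1) by blast
  qed (use disj in \<open>auto simp: F_def\<close>)
  then show ?thesis using dist R by (simp add: b_def)
qed

section \<open>The trigonometry of the pair p, q\<close>

lemma cosh_double_eq_tanh: "cosh (2 * x) = (1 + (tanh x)\<^sup>2) / (1 - (tanh x)\<^sup>2)" for x :: real
proof -
  have t: "(tanh x)\<^sup>2 = (sinh x)\<^sup>2 / (1 + (sinh x)\<^sup>2)"
    by (simp add: tanh_def power_divide cosh_square_eq)
  have "1 + 2 * s = (1 + s / (1 + s)) / (1 - s / (1 + s))" if "0 \<le> s" for s :: real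
  proof -
    have "1 + s / (1 + s) = (1 + 2 * s) / (1 + s)" "1 - s / (1 + s) = 1 / (1 + s)"
      using that by (simp_all add: field_simps)
    then show ?thesis using that by simp
  qed
  from this[of "(sinh x)\<^sup>2"] show ?thesis unfolding t by (simp add: cosh_double cosh_square_eq)
qed

section \<open>Centre of the side arcs and the touching circle\<close>

context regular_polygon
begin

text \<open>By Pythagoras, \<open>(\<mu> - b * cos a)^2 + (b * sin a)^2 = \<rho>^2\<close>: the
  centre built in \<open>side_curve\<close> is the one that orthogonality prescribes.\<close>

lemma chord_offset: "b * cos a + sqrt (\<rho>\<^sup>2 - (b * sin a)\<^sup>2) = \<mu>"
proof -
  have h: "2 * \<mu> * (b * cos a) = 1 + b\<^sup>2" using b cos_a by (simp add: pmu_def)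
  have "b * cos a < 1 * 1" using b cos_a by (intro mult_strict_mono) auto
  then have pos: "0 \<le> \<mu> - b * cos a" using mu by simp
  have "(\<mu> - b * cos a)\<^sup>2 = \<mu>\<^sup>2 - (1 + b\<^sup>2) + (b * cos a)\<^sup>2" using h by (simp add: power2_diff)
  also have "\<dots> = \<rho>\<^sup>2 - (b * sin a)\<^sup>2"
    unfolding rho(2) by (simp add: power_mult_distrib sin_squared_eq algebra_simps)
  finally have "sqrt (\<rho>\<^sup>2 - (b * sin a)\<^sup>2) = \<mu> - b * cos a" using pos by (metis real_sqrt_unique)
  then show ?thesis by simp
qed

lemma touches_side: "touches dist 0 (\<mu> - \<rho>) (hsegment (v k) (v (Suc k)))"
  unfolding touches_def dist_0_norm using inradius(3,4,5) by blast

text \<open>A touching radius is the minimum of the distances, hence unique; this justifies the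
  \<open>THE\<close> in \<open>r_opt\<close>.\<close>

lemma touches_side_unique:
  assumes "touches dist 0 r (hsegment (v k) (v (Suc k)))"
  shows "r = \<mu> - \<rho>"
proof -
  obtain z w where "z \<in> hsegment (v k) (v (Suc k))" "dist 0 z = r" "w \<in> hsegment (v k) (v (Suc k))" "dist 0 w = \<mu> - \<rho>"
    using assms touches_side[of k] unfolding touches_def by blast
  then have "r \<le> \<mu> - \<rho>" "\<mu> - \<rho> \<le> r" using assms touches_side[of k] unfolding touches_def by force+
  then show ?thesis by (rule antisym)
qed

text \<open>For \<open>t = \<mu> - \<rho>\<close> the relation
  \<open>t * (\<mu> + \<rho>) = 1\<close> gives \<open>1 + t^2 = 2 * t * \<mu>\<close> and
  \<open>1 - t^2 = 2 * t * \<rho>\<close>.\<close>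

lemma cosh_inradius: "cosh (2 * artanh (\<mu> - \<rho>)) = \<mu> / \<rho>"
proof -
  let ?t = "\<mu> - \<rho>"
  have prod: "?t * (\<mu> + \<rho>) = 1" using rho(2) by (simp add: algebra_simps power2_eq_square)
  have t: "0 < ?t" "?t < 1" by (rule inradius)+
  have "1 + ?t\<^sup>2 = ?t * (\<mu> + \<rho>) + ?t\<^sup>2" "1 - ?t\<^sup>2 = ?t * (\<mu> + \<rho>) - ?t\<^sup>2" using prod by simp_all
  then have "1 + ?t\<^sup>2 = ?t * (2 * \<mu>)" "1 - ?t\<^sup>2 = ?t * (2 * \<rho>)" by (simp_all only: power2_eq_square) (simp_all add: algebra_simps)
  then show ?thesis unfolding cosh_double_eq_tanh using t by (simp add: tanh_artanh_real)
qed

end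

locale hyperbolic_pair =
  fixes p q :: nat
  assumes p: "3 \<le> p" and q: "real q > 2 * real p / (real p - 2)"
begin

abbreviation "\<alpha> \<equiv> pi / real p"
abbreviation "\<beta> \<equiv> pi / real q"
abbreviation "cp \<equiv> cos (\<alpha> + \<beta>)"
abbreviation "cm \<equiv> cos (\<alpha> - \<beta>)"

text \<open>Clearing denominators in the bound on \<open>q\<close> gives
  \<open>1 / p + 1 / q < 1 / 2\<close>.\<close>

lemma angles: "0 < \<alpha>" "\<alpha> < pi / 2" "0 < \<beta>" "\<beta> < pi / 2" "\<alpha> + \<beta> < pi / 2"
proof -
  have rp: "3 \<le> real p" using p by simp
  then have "0 < 2 * real p / (real p - 2)" by simp
  then have rq: "0 < real q" using q by linarith
  have "2 * real p < real q * (real p - 2)" using q rp by (simp add: pos_divide_less_eq)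
  then have "2 * (real p + real q) < real p * real q" by (simp add: algebra_simps)
  then have "1 / real p + 1 / real q < 1 / 2" using rp rq by (simp add: field_simps)
  then have "pi * (1 / real p + 1 / real q) < pi * (1 / 2)" by (rule mult_strict_left_mono) simp
  then show s: "\<alpha> + \<beta> < pi / 2" by (simp add: distrib_left)
  show "0 < \<alpha>" "0 < \<beta>" using rp rq by simp_all
  then show "\<alpha> < pi / 2" "\<beta> < pi / 2" using s by linarith+
qed

lemma q_pos: "0 < q" using angles(3) by (cases q) auto

lemma trig_pos: "0 < sin \<alpha>" "0 < sin \<beta>" "0 < cos \<alpha>" "0 < cos \<beta>" "0 < cp" "0 < cm" "cp < cm" "0 < sin (\<alpha> + \<beta>)"
proof -
  show s: "0 < sin \<alpha>" "0 < sin \<beta>" "0 < sin (\<alpha> + \<beta>)" using angles pi_gt_zero by (intro sin_gt_zero; linarith)+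
  show "0 < cos \<alpha>" "0 < cos \<beta>" "0 < cp" "0 < cm" using angles by (intro cos_gt_zero_pi; linarith)+
  have "0 < sin \<alpha> * sin \<beta>" using s by simp
  then show "cp < cm" by (simp add: cos_add cos_diff)
qed

text \<open>Multiply numerator and denominator of the radicand by
  \<open>cos \<alpha> * cos \<beta>\<close>.\<close>

lemma prism_b_sq: "(prism_b p q)\<^sup>2 = cp / cm" "prism_b p q = sqrt (cp / cm)"
proof -
  have eq: "(1 - tan \<alpha> * tan \<beta>) / (1 + tan \<alpha> * tan \<beta>) = cp / cm"
  proof -
    have "1 - tan \<alpha> * tan \<beta> = cp / (cos \<alpha> * cos \<beta>)" "1 + tan \<alpha> * tan \<beta> = cm / (cos \<alpha> * cos \<beta>)"
      using trig_pos by (simp_all add: tan_def cos_add cos_diff field_simps)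
    then show ?thesis using trig_pos by simp
  qed
  then show "prism_b p q = sqrt (cp / cm)" by (simp add: prism_b_def)
  then show "(prism_b p q)\<^sup>2 = cp / cm" using trig_pos by simp
qed

lemma prism_b_bounds: "0 < prism_b p q" "prism_b p q < 1"
  unfolding prism_b_sq(2) using trig_pos by (auto simp: real_sqrt_lt_1_iff)

sublocale regular_polygon p "prism_b p q"
  by standard (use p prism_b_bounds in auto)

text \<open>The common denominator of \<open>b\<close>, \<open>\<mu>\<close> and
  \<open>\<rho>\<close>; the relation \<open>\<mu>^2 - \<rho>^2 = 1\<close> becomes
  \<open>cp * cm = cos \<beta> ^ 2 - sin \<alpha> ^ 2\<close>.\<close>

abbreviation "D \<equiv> sqrt (cp * cm)"

lemma D: "0 < D" "D\<^sup>2 = cp * cm" "cp * cm = (cos \<beta>)\<^sup>2 - (sin \<alpha>)\<^sup>2"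
proof -
  show "0 < D" "D\<^sup>2 = cp * cm" using trig_pos by (simp_all add: less_imp_le)
  have "(sin \<alpha>)\<^sup>2 + (cos \<alpha>)\<^sup>2 = 1" "(sin \<beta>)\<^sup>2 + (cos \<beta>)\<^sup>2 = 1" by simp_all
  then show "cp * cm = (cos \<beta>)\<^sup>2 - (sin \<alpha>)\<^sup>2"
    unfolding cos_add cos_diff by algebra
qed

lemma prism_b_D: "prism_b p q = cp / D"
proof -
  have "(cp / D)\<^sup>2 = cp / cm" unfolding power_divide D(2) using trig_pos by (simp add: power2_eq_square)
  then show ?thesis unfolding prism_b_sq(2) using D trig_pos by (intro real_sqrt_unique) auto
qed

lemma pmu_D: "pmu p (prism_b p q) = cos \<beta> / D"
proof -
  have "1 + cp / cm = 2 * cos \<alpha> * cos \<beta> / cm"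
    using trig_pos by (simp add: field_simps cos_add cos_diff)
  then have "pmu p (prism_b p q) = (2 * cos \<alpha> * cos \<beta> / cm) / (2 * (cp / D) * cos \<alpha>)"
    unfolding pmu_def prism_b_sq(1) unfolding prism_b_D by simp
  also have "\<dots> = cos \<beta> * D / (cp * cm)" using trig_pos D by (simp add: field_simps)
  also have "\<dots> = cos \<beta> / D"
  proof -
    have "x * d / y = x / d" if "0 < d" "d\<^sup>2 = y" for x y d :: real
      using that by (auto simp: power2_eq_square)
    then show ?thesis using D(1,2) .
  qed
  finally show ?thesis .
qed

lemma rho_D: "sqrt ((pmu p (prism_b p q))\<^sup>2 - 1) = sin \<alpha> / D"
proof (rule real_sqrt_unique)
  have "(cos \<beta> / D)\<^sup>2 - 1 = ((cos \<beta>)\<^sup>2 - D\<^sup>2) / D\<^sup>2"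
  proof -
    have "(x / d)\<^sup>2 - 1 = (x\<^sup>2 - d\<^sup>2) / d\<^sup>2" if "0 < d" for x d :: real
      using that by (simp add: power_divide diff_divide_distrib)
    then show ?thesis using D(1) .
  qed
  also have "\<dots> = (sin \<alpha> / D)\<^sup>2" unfolding power_divide D(2) unfolding D(3) by simp
  finally show "(sin \<alpha> / D)\<^sup>2 = (pmu p (prism_b p q))\<^sup>2 - 1" unfolding pmu_D by simp
qed (use trig_pos D in auto)

text \<open>Sum-to-product and double-angle formulas turn the radicand of \<open>prism_C\<close>
  into \<open>(D / sin \<alpha>)^2\<close>, so the prescribed arc radius is
  \<open>\<rho>\<close>.\<close>

lemma prism_C_D: "1 / prism_C p q = sin \<alpha> / D"
proof -
  have 1: "sin (2 * pi / real p) + sin (2 * pi / real q) = 2 * sin (\<alpha> + \<beta>) * cm"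
  proof -
    have "sin (2 * pi / real p) + sin (2 * pi / real q) = sin ((\<alpha> + \<beta>) + (\<alpha> - \<beta>)) + sin ((\<alpha> + \<beta>) - (\<alpha> - \<beta>))"
      by simp
    also have "\<dots> = 2 * sin (\<alpha> + \<beta>) * cm" unfolding sin_add[of "\<alpha> + \<beta>" "\<alpha> - \<beta>"] sin_diff[of "\<alpha> + \<beta>" "\<alpha> - \<beta>"] by simp
    finally show ?thesis .
  qed
  have 2: "1 - cos (2 * pi / real p) = 2 * (sin \<alpha>)\<^sup>2"
    using cos_double_sin[of \<alpha>] by simp
  have "cp * (2 * sin (\<alpha> + \<beta>) * cm) / (sin (\<alpha> + \<beta>) * (2 * (sin \<alpha>)\<^sup>2)) = (D / sin \<alpha>)\<^sup>2"
    unfolding power_divide D(2) using trig_pos by (simp add: field_simps)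
  then have "prism_C p q = D / sin \<alpha>"
    unfolding prism_C_def 1 2 using trig_pos D by (simp only:) simp
  then show ?thesis by simp
qed

lemma side_curve_eq: "side_curve p q k = hsegment (pvertex p (prism_b p q) k) (pvertex p (prism_b p q) (Suc k))"
proof -
  have "1 / prism_C p q = sqrt ((pmu p (prism_b p q))\<^sup>2 - 1)" unfolding prism_C_D rho_D ..
  then show ?thesis
    unfolding side_curve_def Let_def arc_eq_hsegment[symmetric]
    by (simp only: chord_offset pnormal_def)
qed

lemma prism_base_eq: "prism_base p q = hpoly p (prism_b p q)"
  unfolding prism_base_def Let_def side_curve_eq by (rule component_Un_boundary)

lemma r_opt_eq: "r_opt p q = artanh (pmu p (prism_b p q) - sqrt ((pmu p (prism_b p q))\<^sup>2 - 1))"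
proof -
  let ?t = "pmu p (prism_b p q) - sqrt ((pmu p (prism_b p q))\<^sup>2 - 1)"
  have t: "tanh (artanh ?t) = ?t" using inradius(1,2) by (intro tanh_artanh_real) auto
  show ?thesis unfolding r_opt_def side_curve_eq
  proof (rule the_equality)
    show "\<forall>k<p. touches dist 0 (tanh (artanh ?t)) (hsegment (pvertex p (prism_b p q) k) (pvertex p (prism_b p q) (Suc k)))"
      unfolding t using touches_side by blast
    fix r assume "\<forall>k<p. touches dist 0 (tanh r) (hsegment (pvertex p (prism_b p q) k) (pvertex p (prism_b p q) (Suc k)))"
    then have "tanh r = ?t" using p touches_side_unique[of "tanh r" 0] by simp
    then show "r = artanh ?t" using artanh_tanh_real by metis
  qed
qed

lemma r_opt_nonneg: "0 \<le> r_opt p q"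
proof -
  have "0 \<le> tanh (r_opt p q)" unfolding r_opt_eq using inradius(1,2) by (subst tanh_artanh_real) auto
  then show ?thesis by simp
qed

lemma R_opt_pos: "0 < R_opt p q"
proof -
  have "0 < tanh (R_opt p q)" unfolding R_opt_def using prism_b_bounds by (subst tanh_artanh_real) auto
  then show ?thesis by simp
qed

text \<open>\<open>cosh (2 * r_opt p q)\<close> is \<open>\<mu> / \<rho>\<close>, in which the
  denominator \<open>D\<close> cancels.\<close>

lemma r_h_eq: "r_h p q = 2 * r_opt p q"
proof -
  have "cosh (2 * r_opt p q) = cos \<beta> / sin \<alpha>"
    unfolding r_opt_eq unfolding cosh_inradius unfolding rho_D unfolding pmu_D using D(1) trig_pos by simp
  then show ?thesis using arcosh_cosh_real[of "2 * r_opt p q"] r_opt_nonneg by (simp add: r_h_def)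
qed

text \<open>Here \<open>cm + cp = 2 * cos \<alpha> * cos \<beta>\<close> and
  \<open>cm - cp = 2 * sin \<alpha> * sin \<beta>\<close>, whose quotient is the product of
  cotangents.\<close>

lemma R_h_eq: "R_h p q = 2 * R_opt p q"
proof -
  have t: "tanh (R_opt p q) = prism_b p q"
    unfolding R_opt_def using prism_b_bounds by (intro tanh_artanh_real) auto
  have "1 + cp / cm = (cm + cp) / cm" "1 - cp / cm = (cm - cp) / cm" using trig_pos by (simp_all add: field_simps)
  then have "cosh (2 * R_opt p q) = (cm + cp) / (cm - cp)"
    unfolding cosh_double_eq_tanh t prism_b_sq(1) using trig_pos by simp
  also have "\<dots> = cot \<alpha> * cot \<beta>" by (simp add: cos_add cos_diff cot_def)
  finally show ?thesis using arcosh_cosh_real[of "2 * R_opt p q"] R_opt_pos by (simp add: R_h_def)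
qed

lemma harea_hpoly_prism: "harea (hpoly p (prism_b p q)) = 4 * sl2_area (prism_base p q)"
proof -
  have "hpoly p (prism_b p q) \<in> sets borel" by (rule borel_closed[OF closed_hpoly])
  moreover have "hpoly p (prism_b p q) \<subseteq> hplane" by (auto simp: hpoly_def)
  ultimately show ?thesis unfolding prism_base_eq by (rule harea_eq_sl2_area)
qed

text \<open>\<open>slope = tan \<beta>\<close> is linear in the square of the vertex modulus after
  clearing denominators, and its solution is the radicand of \<open>prism_b\<close>.\<close>

lemma tile_circumradius:
  assumes "regular_tessellation p q T" "c \<in> hplane" "w \<in> hplane" "hvertices p c w \<in> T"
  shows "hdist c w = R_h p q" "tanh (hdist c w / 2) = prism_b p q"
proof -
  let ?b = "tanh (hdist c w / 2)"
  have h: "0 < hdist c w" "real q * arctan (regular_polygon.slope p ?b) = pi"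
    using tessellation_circumradius[OF p q_pos assms] by auto
  interpret P: regular_polygon p ?b by standard (use p tanh_half_bounds[OF h(1)] in auto)
  have "arctan P.slope = \<beta>" using h(2) q_pos by (simp add: field_simps)
  then have "tan \<beta> = P.slope" using tan_arctan by metis
  then have sl: "tan \<alpha> * tan \<beta> * (1 + ?b\<^sup>2) = 1 - ?b\<^sup>2"
  proof -
    have "0 < (1 + ?b\<^sup>2) * tan \<alpha>" by (intro mult_pos_pos add_pos_nonneg P.tan_a) auto
    then have "tan \<beta> * ((1 + ?b\<^sup>2) * tan \<alpha>) = 1 - ?b\<^sup>2"
      using \<open>tan \<beta> = P.slope\<close> unfolding P.slope_def eq_divide_eq by (simp only: less_imp_neq[symmetric] if_True simp_thms split: if_splits)
    then show ?thesis by (simp only: mult_ac)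
  qed
  have "0 < tan \<alpha> * tan \<beta>" using angles by (intro mult_pos_pos tan_gt_zero) auto
  then have "?b\<^sup>2 = (1 - tan \<alpha> * tan \<beta>) / (1 + tan \<alpha> * tan \<beta>)"
    using sl by (simp add: field_simps)
  then show b: "?b = prism_b p q" unfolding prism_b_def using P.b by (intro real_sqrt_unique[symmetric]) auto
  have "hdist c w / 2 = R_opt p q" unfolding R_opt_def b[symmetric] by (simp add: artanh_tanh_real)
  then show "hdist c w = R_h p q" unfolding R_h_eq by simp
qed

text \<open>A motion reduces all claims to the polygon about 0, where
  \<open>hdist 0 z = 2 * artanh (cmod z)\<close> converts the Euclidean inradius and circumradius
  into hyperbolic ones.\<close>

lemma tile_properties:
  assumes T: "regular_tessellation p q T" and c: "c \<in> hplane" and w: "w \<in> hplane" and mem: "hvertices p c w \<in> T"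
  shows "\<forall>k<p. touches hdist c (r_h p q) (hsegment (hvertex p c w k) (hvertex p c w (Suc k)))"
    and "\<forall>x\<in>hvertices p c w. hdist c x = R_h p q"
    and "harea (hconvex hull (hvertices p c w)) = 4 * sl2_area (prism_base p q)"
proof -
  let ?b = "prism_b p q"
  obtain t where t: "\<And>k. hvertex p c w k = hmotion c t (pvertex p ?b k)"
    using hvertex_hmotion[OF c w] tile_circumradius(2)[OF assms] by metis
  have dist0: "hdist c (hmotion c t z) = hdist 0 z" if "z \<in> hplane" for z
    using hdist_hmotion[OF c zero_in_hplane that, of t] hmotion_0[OF c] by simp
  have hdist_artanh: "hdist 0 z = 2 * artanh (cmod z)" if "z \<in> hplane" for z
    unfolding cmod_eq_tanh_hdist[OF that] by (simp add: artanh_tanh_real)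
  show "\<forall>k<p. touches hdist c (r_h p q) (hsegment (hvertex p c w k) (hvertex p c w (Suc k)))"
  proof (intro allI impI)
    fix k
    let ?S = "hsegment (pvertex p ?b k) (pvertex p ?b (Suc k))"
    have S: "?S \<subseteq> hplane" by (auto simp: hsegment_def)
    have eq: "hdist c (hmotion c t z) = 2 * artanh (cmod z)" if "z \<in> ?S" for z
      using that S dist0 hdist_artanh by auto
    have mono: "artanh x \<le> artanh y" if "0 \<le> x" "x \<le> y" "y < 1" for x y :: real
    proof -
      have "tanh (artanh x) \<le> tanh (artanh y)" using that by (simp add: tanh_artanh_real)
      then show ?thesis by simp
    qed
    have lt: "cmod z < 1" if "z \<in> ?S" for z using that S by (auto simp: hplane_iff)
    show "touches hdist c (r_h p q) (hsegment (hvertex p c w k) (hvertex p c w (Suc k)))"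
      unfolding t hsegment_hmotion[OF c v_in_hplane v_in_hplane] touches_def r_h_eq r_opt_eq
    proof (intro conjI ballI)
      show "\<exists>z\<in>hmotion c t ` ?S. hdist c z = 2 * artanh (pmu p ?b - sqrt ((pmu p ?b)\<^sup>2 - 1))"
        using eq[OF inradius(3)] inradius(3) unfolding inradius(4) by blast
      fix z assume "z \<in> hmotion c t ` ?S"
      then obtain y where y: "y \<in> ?S" "z = hmotion c t y" by blast
      then show "2 * artanh (pmu p ?b - sqrt ((pmu p ?b)\<^sup>2 - 1)) \<le> hdist c z"
        using eq mono[OF _ inradius(5)[OF y(1)] lt[OF y(1)]] inradius(1) by simp
    qed
  qed
  show "\<forall>x\<in>hvertices p c w. hdist c x = R_h p q"
    unfolding hvertices_def R_h_eq R_opt_def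
    using t dist0 hdist_artanh v_in_hplane cmod_v by auto
  have "hvertices p c w = hmotion c t ` V" unfolding hvertices_def V_def image_image t ..
  then have "hconvex hull (hvertices p c w) = hmotion c t ` hpoly p ?b"
    using hull_hmotion[OF c V_in_hplane] hull_V by simp
  moreover have "harea (hmotion c t ` hpoly p ?b) = harea (hpoly p ?b)"
    by (rule harea_hmotion[OF c borel_closed[OF closed_hpoly]]) (auto simp: hpoly_def)
  ultimately show "harea (hconvex hull (hvertices p c w)) = 4 * sl2_area (prism_base p q)"
    by (simp only: harea_hpoly_prism)
qed

end

text \<open>In the last conjunct \<open>c\<close> is the centre of a tile. Through
  \<open>touches\<close> and the distances to the vertices it also certifies that the closed
  formulas \<open>r_h\<close> and \<open>R_h\<close> are the radii of the inscribed and
  circumscribed circles of that tile.\<close>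

theorem theorem5p1:
  fixes p q :: nat and c :: complex
  assumes "3 \<le> p" and "real q > 2 * real p / (real p - 2)"
    and "c \<in> hplane"
  shows "r_h p q = 2 * r_opt p q \<and> R_h p q = 2 * R_opt p q \<and>
    (harea (hdisc c (r_h p q)) = 4 * pi * (sinh (r_h p q / 2))\<^sup>2 \<and>
     4 * pi * (sinh (r_h p q / 2))\<^sup>2 = 4 * sl2_area (sl2_disc (r_opt p q)) \<and>
     4 * sl2_area (sl2_disc (r_opt p q)) = 4 * pi * (sinh (r_opt p q))\<^sup>2) \<and>
    (harea (hdisc c (R_h p q)) = 4 * pi * (sinh (R_h p q / 2))\<^sup>2 \<and>
     4 * pi * (sinh (R_h p q / 2))\<^sup>2 = 4 * sl2_area (sl2_disc (R_opt p q)) \<and>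
     4 * sl2_area (sl2_disc (R_opt p q)) = 4 * pi * (sinh (R_opt p q))\<^sup>2) \<and>
    (\<forall>T v. regular_tessellation p q T \<and> v \<in> hplane \<and> hvertices p c v \<in> T \<longrightarrow>
       (\<forall>k<p. touches hdist c (r_h p q) (hsegment (hvertex p c v k) (hvertex p c v (Suc k)))) \<and>
       (\<forall>x\<in>hvertices p c v. hdist c x = R_h p q) \<and>
       harea (hconvex hull (hvertices p c v)) = 4 * sl2_area (prism_base p q))"
proof -
  interpret hyperbolic_pair p q by standard (use assms in auto)
  have r: "0 \<le> r_opt p q" "0 \<le> r_h p q" and R: "0 \<le> R_opt p q" "0 \<le> R_h p q"
    using r_opt_nonneg R_opt_pos by (simp_all add: r_h_eq R_h_eq)
  have half: "r_h p q / 2 = r_opt p q" "R_h p q / 2 = R_opt p q" by (simp_all add: r_h_eq R_h_eq)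
  have tiles: "\<forall>T v. regular_tessellation p q T \<and> v \<in> hplane \<and> hvertices p c v \<in> T \<longrightarrow>
       (\<forall>k<p. touches hdist c (r_h p q) (hsegment (hvertex p c v k) (hvertex p c v (Suc k)))) \<and>
       (\<forall>x\<in>hvertices p c v. hdist c x = R_h p q) \<and>
       harea (hconvex hull (hvertices p c v)) = 4 * sl2_area (prism_base p q)"
    by (intro allI impI, elim conjE) (intro conjI tile_properties assms(3))
  have "4 * sl2_area (sl2_disc (r_opt p q)) = 4 * pi * (sinh (r_opt p q))\<^sup>2"
    "4 * sl2_area (sl2_disc (R_opt p q)) = 4 * pi * (sinh (R_opt p q))\<^sup>2"
    using sl2_area_disc r(1) R(1) by simp_all
  moreover have "harea (hdisc c (r_h p q)) = 4 * pi * (sinh (r_h p q / 2))\<^sup>2"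
    "harea (hdisc c (R_h p q)) = 4 * pi * (sinh (R_h p q / 2))\<^sup>2"
    using harea_hdisc[OF assms(3)] r(2) R(2) by simp_all
  ultimately show ?thesis unfolding half
    by (intro conjI r_h_eq R_h_eq tiles) simp_all
qed

end
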